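(* Let $E=(E^0,E^1,r,s)$ be a locally-finite directed graph with no sources or sinks, and let $\{t_e,p_v\}$ be the universal Cuntz-Krieger $E$-family which generates $C^*(E)$. Then there is an endomorphism $\beta$ of the core $C^*(E)^\gamma$ such that, for all $\mu,\nu\in E^*$ with $|\mu|=|\nu|$ and $s(\mu)=s(\nu)$, $$\beta(t_\mu t_\nu^* )=\sum_{s(e)=r(\mu),\;s(f)=r(\nu)}\big(|s^{-1}(r(\mu))|\,|s^{-1}(r(\nu))|\big)^{-1/2}\,t_{e\mu}t_{f\nu}^*.$$ The series $$\sum_{e\in E^1}|s^{-1}(s(e))|^{-1/2}\,t_e$$ converges strictly in $M(C^*(E))$ to an isometry $W$ satisfying $\beta(t_\mu t_\nu^* )=Wt_\mu t_\nu^*W^*$. If $\iota$ is the inclusion of $C^*(E)^\gamma$ in $C^*(E)$, then the associated representation $\iota\times W$ of the Stacey crossed product $C^*(E)^\gamma\times_\beta\mathbb{N}$ is an isomorphism onto $C^*(E)$.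
   Context: $E^0$ is the set of vertices, $E^1$ the set of edges, and $r,s:E^1\to E^0$ are the range and source maps. $E$ is locally finite if $r^{-1}(v)$ and $s^{-1}(v)$ are finite for every $v\in E^0$; no sources or sinks means $r^{-1}(v)\neq\emptyset$ and $s^{-1}(v)\neq\emptyset$ for every $v$. A finite path of length $n=|\mu|$ is $\mu=\mu_1\cdots\mu_n$ with $\mu_i\in E^1$ and $s(\mu_i)=r(\mu_{i+1})$; $r(\mu)=r(\mu_1)$, $s(\mu)=s(\mu_n)$; vertices are paths of length $0$ with $r(v)=s(v)=v$. $E^*$ is the set of finite paths, $t_\mu:=t_{\mu_1}\cdots t_{\mu_n}$ and $t_v:=p_v$. $C^*(E)$ is the universal $C^*$-algebra generated by a Cuntz-Krieger $E$-family: mutually orthogonal projections $\{p_v:v\in E^0\}$ and partial isometries $\{t_e:e\in E^1\}$ such that $t_e^*t_e=p_{s(e)}$ for all $e\in E^1$ and $p_v=\sum_{r(e)=v}t_et_e^*$ for all $v\in E^0$. The gauge action $\gamma$ of $\mathbb{T}$ satisfies $\gamma_z(p_v)=p_v$, $\gamma_z(t_e)=zt_e$; the core is its fixed-point algebra $C^*(E)^\gamma=\overline{\operatorname{span}}\{t_\mu t_\nu^*:\mu,\nu\in E^*,\ |\mu|=|\nu|\}$. $M(\cdot)$ denotes the multiplier algebra. A Stacey-covariant representation of a pair $(C,\beta)$ ($\beta$ an endomorphism of a $C^*$-algebra $C$) in a $C^*$-algebra $D$ consists of a nondegenerate homomorphism $\pi:C\to D$ and an isometry $W\in M(D)$ with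 $\pi(\beta(c))=W\pi(c)W^*$. The Stacey crossed product $C\times_\beta\mathbb{N}$ is generated by a universal Stacey-covariant representation $(i_C,v)$; $\pi\times W$ denotes the nondegenerate homomorphism of $C\times_\beta\mathbb{N}$ into $D$ with $(\pi\times W)\circ i_C=\pi$ and (on multipliers) $(\pi\times W)(v)=W$. *)

theory Defs
  imports
    "HOL-Analysis.Analysis"
    "HOL-Algebra.Module"
    "Graph_Theory.Digraph"
begin

section \<open>C*-algebras\<close>

text \<open>
  C*-algebras are records, so that statements can quantify over them. They extend the
  HOL-Algebra record of modules over the complex numbers; in particular finite sums are
  \<^const>\<open>finsum\<close>. C*-algebras need not be unital, and the field \<^const>\<open>one\<close> of the
  record is ignored throughout, except in multiplier algebras.
\<close>

definition complex_field :: "complex ring" where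
  "complex_field =
     \<lparr>carrier = UNIV, mult = (*), one = 1, zero = 0, add = (+)\<rparr>"

record 'a cstar = "(complex, 'a) module" +
  adj :: "'a \<Rightarrow> 'a" (\<open>(_\<^sup>\<star>\<index>)\<close> [1000] 999)
  nrm :: "'a \<Rightarrow> real" (\<open>\<parallel>_\<parallel>\<index>\<close>)

text \<open>The locale \<^locale>\<open>Metric_space\<close> wants a distance that is symmetric and nonnegative on
  the whole type; hence the value 0 outside the carrier.\<close>

definition cdist :: "'a cstar \<Rightarrow> 'a \<Rightarrow> 'a \<Rightarrow> real" where
  "cdist A x y =
     (if x \<in> carrier A \<and> y \<in> carrier A then \<parallel>x \<ominus>\<^bsub>A\<^esub> y\<parallel>\<^bsub>A\<^esub> else 0)"

definition norm_topology :: "'a cstar \<Rightarrow> 'a topology" where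
  "norm_topology A = Metric_space.mtopology (carrier A) (cdist A)"

locale cstar_algebra = module complex_field A for A :: "'a cstar" (structure) +
  assumes mult_closed:
      "\<lbrakk>x \<in> carrier A; y \<in> carrier A\<rbrakk> \<Longrightarrow> x \<otimes>\<^bsub>A\<^esub> y \<in> carrier A"
    and mult_assoc:
      "\<lbrakk>x \<in> carrier A; y \<in> carrier A; z \<in> carrier A\<rbrakk>
       \<Longrightarrow> (x \<otimes>\<^bsub>A\<^esub> y) \<otimes>\<^bsub>A\<^esub> z = x \<otimes>\<^bsub>A\<^esub> (y \<otimes>\<^bsub>A\<^esub> z)"
    and mult_distrib_right:
      "\<lbrakk>x \<in> carrier A; y \<in> carrier A; z \<in> carrier A\<rbrakk>
       \<Longrightarrow> (x \<oplus>\<^bsub>A\<^esub> y) \<otimes>\<^bsub>A\<^esub> z = x \<otimes>\<^bsub>A\<^esub> z \<oplus>\<^bsub>A\<^esub> y \<otimes>\<^bsub>A\<^esub> z"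
    and mult_distrib_left:
      "\<lbrakk>x \<in> carrier A; y \<in> carrier A; z \<in> carrier A\<rbrakk>
       \<Longrightarrow> x \<otimes>\<^bsub>A\<^esub> (y \<oplus>\<^bsub>A\<^esub> z) = x \<otimes>\<^bsub>A\<^esub> y \<oplus>\<^bsub>A\<^esub> x \<otimes>\<^bsub>A\<^esub> z"
    and smult_mult_left:
      "\<lbrakk>x \<in> carrier A; y \<in> carrier A\<rbrakk>
       \<Longrightarrow> (c \<odot>\<^bsub>A\<^esub> x) \<otimes>\<^bsub>A\<^esub> y = c \<odot>\<^bsub>A\<^esub> (x \<otimes>\<^bsub>A\<^esub> y)"
    and smult_mult_right:
      "\<lbrakk>x \<in> carrier A; y \<in> carrier A\<rbrakk>
       \<Longrightarrow> x \<otimes>\<^bsub>A\<^esub> (c \<odot>\<^bsub>A\<^esub> y) = c \<odot>\<^bsub>A\<^esub> (x \<otimes>\<^bsub>A\<^esub> y)"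
    and adj_closed: "x \<in> carrier A \<Longrightarrow> x\<^sup>\<star>\<^bsub>A\<^esub> \<in> carrier A"
    and adj_adj: "x \<in> carrier A \<Longrightarrow> (x\<^sup>\<star>\<^bsub>A\<^esub>)\<^sup>\<star>\<^bsub>A\<^esub> = x"
    and adj_add:
      "\<lbrakk>x \<in> carrier A; y \<in> carrier A\<rbrakk>
       \<Longrightarrow> (x \<oplus>\<^bsub>A\<^esub> y)\<^sup>\<star>\<^bsub>A\<^esub> = x\<^sup>\<star>\<^bsub>A\<^esub> \<oplus>\<^bsub>A\<^esub> y\<^sup>\<star>\<^bsub>A\<^esub>"
    and adj_smult:
      "x \<in> carrier A \<Longrightarrow> (c \<odot>\<^bsub>A\<^esub> x)\<^sup>\<star>\<^bsub>A\<^esub> = cnj c \<odot>\<^bsub>A\<^esub> x\<^sup>\<star>\<^bsub>A\<^esub>"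
    and adj_mult:
      "\<lbrakk>x \<in> carrier A; y \<in> carrier A\<rbrakk>
       \<Longrightarrow> (x \<otimes>\<^bsub>A\<^esub> y)\<^sup>\<star>\<^bsub>A\<^esub> = y\<^sup>\<star>\<^bsub>A\<^esub> \<otimes>\<^bsub>A\<^esub> x\<^sup>\<star>\<^bsub>A\<^esub>"
    and nrm_nonneg: "x \<in> carrier A \<Longrightarrow> 0 \<le> \<parallel>x\<parallel>\<^bsub>A\<^esub>"
    and nrm_eq_zero: "x \<in> carrier A \<Longrightarrow> \<parallel>x\<parallel>\<^bsub>A\<^esub> = 0 \<longleftrightarrow> x = \<zero>\<^bsub>A\<^esub>"
    and nrm_triangle:
      "\<lbrakk>x \<in> carrier A; y \<in> carrier A\<rbrakk>
       \<Longrightarrow> \<parallel>x \<oplus>\<^bsub>A\<^esub> y\<parallel>\<^bsub>A\<^esub> \<le> \<parallel>x\<parallel>\<^bsub>A\<^esub> + \<parallel>y\<parallel>\<^bsub>A\<^esub>"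
    and nrm_smult:
      "x \<in> carrier A \<Longrightarrow> \<parallel>c \<odot>\<^bsub>A\<^esub> x\<parallel>\<^bsub>A\<^esub> = cmod c * \<parallel>x\<parallel>\<^bsub>A\<^esub>"
    and nrm_mult:
      "\<lbrakk>x \<in> carrier A; y \<in> carrier A\<rbrakk>
       \<Longrightarrow> \<parallel>x \<otimes>\<^bsub>A\<^esub> y\<parallel>\<^bsub>A\<^esub> \<le> \<parallel>x\<parallel>\<^bsub>A\<^esub> * \<parallel>y\<parallel>\<^bsub>A\<^esub>"
    and cstar_identity:
      "x \<in> carrier A \<Longrightarrow> \<parallel>x\<^sup>\<star>\<^bsub>A\<^esub> \<otimes>\<^bsub>A\<^esub> x\<parallel>\<^bsub>A\<^esub> = \<parallel>x\<parallel>\<^bsub>A\<^esub>\<^sup>2"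
    and complete: "Metric_space.mcomplete (carrier A) (cdist A)"

definition cstar_hom :: "'a cstar \<Rightarrow> 'b cstar \<Rightarrow> ('a \<Rightarrow> 'b) set" where
  "cstar_hom A B = {\<phi> \<in> carrier A \<rightarrow> carrier B.
     (\<forall>x\<in>carrier A. \<forall>y\<in>carrier A.
        \<phi> (x \<oplus>\<^bsub>A\<^esub> y) = \<phi> x \<oplus>\<^bsub>B\<^esub> \<phi> y \<and> \<phi> (x \<otimes>\<^bsub>A\<^esub> y) = \<phi> x \<otimes>\<^bsub>B\<^esub> \<phi> y) \<and>
     (\<forall>c. \<forall>x\<in>carrier A. \<phi> (c \<odot>\<^bsub>A\<^esub> x) = c \<odot>\<^bsub>B\<^esub> \<phi> x) \<and>
     (\<forall>x\<in>carrier A. \<phi> (x\<^sup>\<star>\<^bsub>A\<^esub>) = (\<phi> x)\<^sup>\<star>\<^bsub>B\<^esub>)}"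

definition cstar_iso :: "'a cstar \<Rightarrow> 'b cstar \<Rightarrow> ('a \<Rightarrow> 'b) set" where
  "cstar_iso A B = {\<phi> \<in> cstar_hom A B. bij_betw \<phi> (carrier A) (carrier B)}"

definition closed_subspace :: "'a set \<Rightarrow> 'a cstar \<Rightarrow> bool" where
  "closed_subspace S A \<longleftrightarrow> submodule S complex_field A \<and> closedin (norm_topology A) S"

definition closed_span :: "'a cstar \<Rightarrow> 'a set \<Rightarrow> 'a set" where
  "closed_span A X = \<Inter> {S. closed_subspace S A \<and> X \<subseteq> S}"

definition cstar_subalgebra :: "'a set \<Rightarrow> 'a cstar \<Rightarrow> bool" where
  "cstar_subalgebra S A \<longleftrightarrow> closed_subspace S A \<and>
     (\<forall>x\<in>S. \<forall>y\<in>S. x \<otimes>\<^bsub>A\<^esub> y \<in> S) \<and> (\<forall>x\<in>S. x\<^sup>\<star>\<^bsub>A\<^esub> \<in> S)"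

definition generated_cstar :: "'a cstar \<Rightarrow> 'a set \<Rightarrow> 'a set" where
  "generated_cstar A X = \<Inter> {S. cstar_subalgebra S A \<and> X \<subseteq> S}"

definition projection :: "'a cstar \<Rightarrow> 'a \<Rightarrow> bool" where
  "projection A x \<longleftrightarrow> x \<in> carrier A \<and> x \<otimes>\<^bsub>A\<^esub> x = x \<and> x\<^sup>\<star>\<^bsub>A\<^esub> = x"

definition partial_isometry :: "'a cstar \<Rightarrow> 'a \<Rightarrow> bool" where
  "partial_isometry A x \<longleftrightarrow>
     x \<in> carrier A \<and> x \<otimes>\<^bsub>A\<^esub> x\<^sup>\<star>\<^bsub>A\<^esub> \<otimes>\<^bsub>A\<^esub> x = x"

section \<open>Multiplier algebras\<close>

text \<open>
  \<open>M(A)\<close> consists of the double centralisers \<open>(L, R)\<close> of \<open>A\<close>. For a multiplier \<open>m\<close>, the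
  product \<open>m a\<close> is \<open>fst m a\<close> and the product \<open>a m\<close> is \<open>snd m a\<close>. The maps are extensional,
  so that multipliers are equal iff they agree on the carrier of \<open>A\<close>.
\<close>

definition bounded_ops :: "'a cstar \<Rightarrow> ('a \<Rightarrow> 'a) set" where
  "bounded_ops A = {L \<in> carrier A \<rightarrow>\<^sub>E carrier A.
     (\<forall>x\<in>carrier A. \<forall>y\<in>carrier A. L (x \<oplus>\<^bsub>A\<^esub> y) = L x \<oplus>\<^bsub>A\<^esub> L y) \<and>
     (\<forall>c. \<forall>x\<in>carrier A. L (c \<odot>\<^bsub>A\<^esub> x) = c \<odot>\<^bsub>A\<^esub> L x) \<and>
     (\<exists>K. \<forall>x\<in>carrier A. \<parallel>L x\<parallel>\<^bsub>A\<^esub> \<le> K * \<parallel>x\<parallel>\<^bsub>A\<^esub>)}"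

definition double_centralizers :: "'a cstar \<Rightarrow> (('a \<Rightarrow> 'a) \<times> ('a \<Rightarrow> 'a)) set" where
  "double_centralizers A = {(L, R). L \<in> bounded_ops A \<and> R \<in> bounded_ops A \<and>
     (\<forall>x\<in>carrier A. \<forall>y\<in>carrier A.
        L (x \<otimes>\<^bsub>A\<^esub> y) = L x \<otimes>\<^bsub>A\<^esub> y \<and>
        R (x \<otimes>\<^bsub>A\<^esub> y) = x \<otimes>\<^bsub>A\<^esub> R y \<and>
        R x \<otimes>\<^bsub>A\<^esub> y = x \<otimes>\<^bsub>A\<^esub> L y)}"

definition multiplier_algebra :: "'a cstar \<Rightarrow> (('a \<Rightarrow> 'a) \<times> ('a \<Rightarrow> 'a)) cstar" where
  "multiplier_algebra A =
    \<lparr>carrier = double_centralizers A,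
     mult = (\<lambda>(L1, R1) (L2, R2).
       (compose (carrier A) L1 L2, compose (carrier A) R2 R1)),
     one = (\<lambda>x\<in>carrier A. x, \<lambda>x\<in>carrier A. x),
     zero = (\<lambda>x\<in>carrier A. \<zero>\<^bsub>A\<^esub>, \<lambda>x\<in>carrier A. \<zero>\<^bsub>A\<^esub>),
     add = (\<lambda>(L1, R1) (L2, R2).
       (\<lambda>x\<in>carrier A. L1 x \<oplus>\<^bsub>A\<^esub> L2 x, \<lambda>x\<in>carrier A. R1 x \<oplus>\<^bsub>A\<^esub> R2 x)),
     smult = (\<lambda>c (L, R).
       (\<lambda>x\<in>carrier A. c \<odot>\<^bsub>A\<^esub> L x, \<lambda>x\<in>carrier A. c \<odot>\<^bsub>A\<^esub> R x)),
     adj = (\<lambda>(L, R).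
       (\<lambda>x\<in>carrier A. (R (x\<^sup>\<star>\<^bsub>A\<^esub>))\<^sup>\<star>\<^bsub>A\<^esub>,
        \<lambda>x\<in>carrier A. (L (x\<^sup>\<star>\<^bsub>A\<^esub>))\<^sup>\<star>\<^bsub>A\<^esub>)),
     nrm = (\<lambda>(L, R). Sup {\<parallel>L x\<parallel>\<^bsub>A\<^esub> | x. x \<in> carrier A \<and> \<parallel>x\<parallel>\<^bsub>A\<^esub> \<le> 1})\<rparr>"

definition mult_of :: "'a cstar \<Rightarrow> 'a \<Rightarrow> ('a \<Rightarrow> 'a) \<times> ('a \<Rightarrow> 'a)" where
  "mult_of A a = (\<lambda>x\<in>carrier A. a \<otimes>\<^bsub>A\<^esub> x, \<lambda>x\<in>carrier A. x \<otimes>\<^bsub>A\<^esub> a)"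

definition isometry_in :: "'a cstar \<Rightarrow> ('a \<Rightarrow> 'a) \<times> ('a \<Rightarrow> 'a) \<Rightarrow> bool" where
  "isometry_in A W \<longleftrightarrow> W \<in> carrier (multiplier_algebra A) \<and>
     W\<^sup>\<star>\<^bsub>multiplier_algebra A\<^esub> \<otimes>\<^bsub>multiplier_algebra A\<^esub> W = \<one>\<^bsub>multiplier_algebra A\<^esub>"

definition strict_limit ::
  "'a cstar \<Rightarrow> ('i \<Rightarrow> ('a \<Rightarrow> 'a) \<times> ('a \<Rightarrow> 'a)) \<Rightarrow> ('a \<Rightarrow> 'a) \<times> ('a \<Rightarrow> 'a) \<Rightarrow> 'i filter \<Rightarrow> bool"
  where
  "strict_limit A X m F \<longleftrightarrow> m \<in> carrier (multiplier_algebra A) \<and>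
     (\<forall>a\<in>carrier A.
        limitin (norm_topology A) (\<lambda>i. fst (X i) a) (fst m a) F \<and>
        limitin (norm_topology A) (\<lambda>i. snd (X i) a) (snd m a) F)"

text \<open>Unordered series: the net of partial sums over the finite subsets of \<open>I\<close>.\<close>

definition strict_sums ::
  "'a cstar \<Rightarrow> ('i \<Rightarrow> 'a) \<Rightarrow> 'i set \<Rightarrow> ('a \<Rightarrow> 'a) \<times> ('a \<Rightarrow> 'a) \<Rightarrow> bool" where
  "strict_sums A f I m \<longleftrightarrow>
     strict_limit A (\<lambda>F. mult_of A (finsum A f F)) m (finite_subsets_at_top I)"

definition nondegenerate_hom :: "'a cstar \<Rightarrow> 'b cstar \<Rightarrow> ('a \<Rightarrow> 'b) set" where
  "nondegenerate_hom A B = {\<phi> \<in> cstar_hom A B.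
     closed_span B {\<phi> a \<otimes>\<^bsub>B\<^esub> b | a b. a \<in> carrier A \<and> b \<in> carrier B} = carrier B}"

text \<open>The extension of a nondegenerate homomorphism to multipliers: the unique \<open>m'\<close> in
  \<open>M(B)\<close> with \<open>m' \<phi>(a) = \<phi>(m a)\<close> and \<open>\<phi>(a) m' = \<phi>(a m)\<close> for all \<open>a\<close> in \<open>A\<close>.\<close>

definition mult_extension ::
  "'a cstar \<Rightarrow> 'b cstar \<Rightarrow> ('a \<Rightarrow> 'b) \<Rightarrow> ('a \<Rightarrow> 'a) \<times> ('a \<Rightarrow> 'a) \<Rightarrow> ('b \<Rightarrow> 'b) \<times> ('b \<Rightarrow> 'b)"
  where
  "mult_extension A B \<phi> m = (THE m'. m' \<in> carrier (multiplier_algebra B) \<and>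
     (\<forall>a\<in>carrier A. fst m' (\<phi> a) = \<phi> (fst m a) \<and> snd m' (\<phi> a) = \<phi> (snd m a)))"

section \<open>Stacey crossed products\<close>

definition stacey_covariant ::
  "'c cstar \<Rightarrow> ('c \<Rightarrow> 'c) \<Rightarrow> 'd cstar \<Rightarrow> ('c \<Rightarrow> 'd) \<Rightarrow> ('d \<Rightarrow> 'd) \<times> ('d \<Rightarrow> 'd) \<Rightarrow> bool" where
  "stacey_covariant C \<beta> D \<pi> W \<longleftrightarrow>
     \<pi> \<in> nondegenerate_hom C D \<and> isometry_in D W \<and>
     (\<forall>c\<in>carrier C. mult_of D (\<pi> (\<beta> c)) =
        W \<otimes>\<^bsub>multiplier_algebra D\<^esub> mult_of D (\<pi> c)
          \<otimes>\<^bsub>multiplier_algebra D\<^esub> W\<^sup>\<star>\<^bsub>multiplier_algebra D\<^esub>)"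

text \<open>
  A formula cannot quantify over all types, so universal properties refer to the C*-algebras
  carried by subsets of one type, which is passed as an argument: the universe. A C*-algebra with
  the universal property in the usual sense has it for every choice of the universe.

  \<open>(B, i, v)\<close> is a Stacey crossed product of \<open>(C, \<beta>)\<close>. As \<open>v\<close> is a multiplier of \<open>B\<close>, that \<open>B\<close>
  is generated by \<open>i\<close> and \<open>v\<close> is expressed by the elements \<open>i(c)\<close>, \<open>v i(c)\<close> and \<open>i(c) v\<close> of \<open>B\<close>.
\<close>

definition stacey_crossed_product ::
  "'d itself \<Rightarrow> 'c cstar \<Rightarrow> ('c \<Rightarrow> 'c) \<Rightarrow> 'b cstar \<Rightarrow> ('c \<Rightarrow> 'b) \<Rightarrow> ('b \<Rightarrow> 'b) \<times> ('b \<Rightarrow> 'b) \<Rightarrow> bool"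
  where
  "stacey_crossed_product U C \<beta> B i v \<longleftrightarrow>
     cstar_algebra B \<and> stacey_covariant C \<beta> B i v \<and>
     generated_cstar B (i ` carrier C \<union> (\<lambda>c. fst v (i c)) ` carrier C
       \<union> (\<lambda>c. snd v (i c)) ` carrier C) = carrier B \<and>
     (\<forall>(D :: 'd cstar) \<pi> W. cstar_algebra D \<and> stacey_covariant C \<beta> D \<pi> W \<longrightarrow>
        (\<exists>\<phi>\<in>nondegenerate_hom B D.
           (\<forall>c\<in>carrier C. \<phi> (i c) = \<pi> c) \<and> mult_extension B D \<phi> v = W))"

text \<open>The homomorphism \<open>\<pi> \<times> W\<close> of the crossed product \<open>(B, i, v)\<close> of \<open>C\<close> into \<open>D\<close>.\<close>

definition stacey_integrated ::
  "'c cstar \<Rightarrow> 'b cstar \<Rightarrow> ('c \<Rightarrow> 'b) \<Rightarrow> ('b \<Rightarrow> 'b) \<times> ('b \<Rightarrow> 'b) \<Rightarrow>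
   'd cstar \<Rightarrow> ('c \<Rightarrow> 'd) \<Rightarrow> ('d \<Rightarrow> 'd) \<times> ('d \<Rightarrow> 'd) \<Rightarrow> 'b \<Rightarrow> 'd" where
  "stacey_integrated C B i v D \<pi> W = (THE \<phi>.
     \<phi> \<in> nondegenerate_hom B D \<and> \<phi> \<in> extensional (carrier B) \<and>
     (\<forall>c\<in>carrier C. \<phi> (i c) = \<pi> c) \<and> mult_extension B D \<phi> v = W)"

section \<open>Graph algebras\<close>

text \<open>
  The source map of a graph is \<^const>\<open>tail\<close> and the range map is \<^const>\<open>head\<close>, so
  \<open>s\<^sup>-\<^sup>1(v)\<close> is \<^const>\<open>out_arcs\<close> and \<open>r\<^sup>-\<^sup>1(v)\<close> is \<^const>\<open>in_arcs\<close>. Paths are composed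
  like operators: consecutive edges \<open>e f\<close> satisfy \<open>s(e) = r(f)\<close>. The nonempty list of edges of a
  path of positive length is given by its head and its tail.
\<close>

datatype ('v, 'e) fpath = Vertex 'v | Edges 'e "'e list"

fun fpath_length :: "('v, 'e) fpath \<Rightarrow> nat" where
  "fpath_length (Vertex v) = 0"
| "fpath_length (Edges e es) = length (e # es)"

fun fpath_range :: "('v, 'e) pre_digraph \<Rightarrow> ('v, 'e) fpath \<Rightarrow> 'v" where
  "fpath_range E (Vertex v) = v"
| "fpath_range E (Edges e es) = head E e"

fun fpath_source :: "('v, 'e) pre_digraph \<Rightarrow> ('v, 'e) fpath \<Rightarrow> 'v" where
  "fpath_source E (Vertex v) = v"
| "fpath_source E (Edges e es) = tail E (last (e # es))"

fun is_fpath :: "('v, 'e) pre_digraph \<Rightarrow> ('v, 'e) fpath \<Rightarrow> bool" where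
  "is_fpath E (Vertex v) \<longleftrightarrow> v \<in> verts E"
| "is_fpath E (Edges e es) \<longleftrightarrow>
     set (e # es) \<subseteq> arcs E \<and> successively (\<lambda>f g. tail E f = head E g) (e # es)"

definition finite_paths :: "('v, 'e) pre_digraph \<Rightarrow> ('v, 'e) fpath set" where
  "finite_paths E = {\<mu>. is_fpath E \<mu>}"

text \<open>The path \<open>e\<mu>\<close>, for an edge \<open>e\<close> with \<open>s(e) = r(\<mu>)\<close>.\<close>

fun edge_cons :: "'e \<Rightarrow> ('v, 'e) fpath \<Rightarrow> ('v, 'e) fpath" where
  "edge_cons e (Vertex v) = Edges e []"
| "edge_cons e (Edges f fs) = Edges e (f # fs)"

fun edges_prod :: "'a cstar \<Rightarrow> ('e \<Rightarrow> 'a) \<Rightarrow> 'e \<Rightarrow> 'e list \<Rightarrow> 'a" where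
  "edges_prod A t e [] = t e"
| "edges_prod A t e (f # fs) = t e \<otimes>\<^bsub>A\<^esub> edges_prod A t f fs"

fun path_elt :: "'a cstar \<Rightarrow> ('v \<Rightarrow> 'a) \<Rightarrow> ('e \<Rightarrow> 'a) \<Rightarrow> ('v, 'e) fpath \<Rightarrow> 'a" where
  "path_elt A p t (Vertex v) = p v"
| "path_elt A p t (Edges e es) = edges_prod A t e es"

definition cuntz_krieger_family ::
  "('v, 'e) pre_digraph \<Rightarrow> 'a cstar \<Rightarrow> ('v \<Rightarrow> 'a) \<Rightarrow> ('e \<Rightarrow> 'a) \<Rightarrow> bool" where
  "cuntz_krieger_family E A p t \<longleftrightarrow>
     (\<forall>v\<in>verts E. projection A (p v)) \<and>
     (\<forall>v\<in>verts E. \<forall>w\<in>verts E. v \<noteq> w \<longrightarrow> p v \<otimes>\<^bsub>A\<^esub> p w = \<zero>\<^bsub>A\<^esub>) \<and>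
     (\<forall>e\<in>arcs E. partial_isometry A (t e)) \<and>
     (\<forall>e\<in>arcs E. (t e)\<^sup>\<star>\<^bsub>A\<^esub> \<otimes>\<^bsub>A\<^esub> t e = p (tail E e)) \<and>
     (\<forall>v\<in>verts E. p v = (\<Oplus>\<^bsub>A\<^esub> e\<in>in_arcs E v. t e \<otimes>\<^bsub>A\<^esub> (t e)\<^sup>\<star>\<^bsub>A\<^esub>))"

text \<open>\<open>A\<close> is \<open>C\<^sup>*(E)\<close>, with its universal Cuntz-Krieger family \<open>(p, t)\<close>.\<close>

definition graph_algebra ::
  "'d itself \<Rightarrow> ('v, 'e) pre_digraph \<Rightarrow> 'a cstar \<Rightarrow> ('v \<Rightarrow> 'a) \<Rightarrow> ('e \<Rightarrow> 'a) \<Rightarrow> bool" where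
  "graph_algebra U E A p t \<longleftrightarrow>
     cstar_algebra A \<and> cuntz_krieger_family E A p t \<and>
     generated_cstar A (p ` verts E \<union> t ` arcs E) = carrier A \<and>
     (\<forall>(D :: 'd cstar) P T. cstar_algebra D \<and> cuntz_krieger_family E D P T \<longrightarrow>
        (\<exists>\<phi>\<in>cstar_hom A D. (\<forall>v\<in>verts E. \<phi> (p v) = P v) \<and> (\<forall>e\<in>arcs E. \<phi> (t e) = T e)))"

definition gauge_action ::
  "('v, 'e) pre_digraph \<Rightarrow> 'a cstar \<Rightarrow> ('v \<Rightarrow> 'a) \<Rightarrow> ('e \<Rightarrow> 'a) \<Rightarrow> complex \<Rightarrow> 'a \<Rightarrow> 'a" where
  "gauge_action E A p t z = (THE \<gamma>.
     \<gamma> \<in> cstar_iso A A \<and> \<gamma> \<in> extensional (carrier A) \<and>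
     (\<forall>v\<in>verts E. \<gamma> (p v) = p v) \<and> (\<forall>e\<in>arcs E. \<gamma> (t e) = z \<odot>\<^bsub>A\<^esub> t e))"

definition core ::
  "('v, 'e) pre_digraph \<Rightarrow> 'a cstar \<Rightarrow> ('v \<Rightarrow> 'a) \<Rightarrow> ('e \<Rightarrow> 'a) \<Rightarrow> 'a cstar" where
  "core E A p t = A\<lparr>carrier :=
     {a \<in> carrier A. \<forall>z. cmod z = 1 \<longrightarrow> gauge_action E A p t z a = a}\<rparr>"

end

theory Submission
  imports Defs
begin

text \<open>
  Write \<open>n\<^sub>e = |s\<^sup>-\<^sup>1(s(e))|\<^sup>-\<^sup>1\<^sup>/\<^sup>2\<close> and \<open>q\<^sub>e = t\<^sub>e t\<^sub>e\<^sup>*\<close>. The partial sums of \<open>\<Sum> n\<^sub>e t\<^sub>e\<close> are contractions, and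
  multiplied by a vertex projection on either side they are eventually constant; so they converge
  strictly, the limit \<open>W\<close> satisfies \<open>W p\<^sub>v = \<Sum> n\<^sub>e t\<^sub>e\<close> (sum over \<open>s(e) = v\<close>), and \<open>\<beta>\<close> is conjugation
  by \<open>W\<close>.

  Since \<open>n\<^sub>e t\<^sub>e = q\<^sub>e W p\<^sub>s\<^sub>(\<^sub>e\<^sub>)\<close>, a crossed product \<open>(B, i, v)\<close> contains the Cuntz-Krieger family
  \<open>T\<^sub>e = n\<^sub>e\<^sup>-\<^sup>1 i(q\<^sub>e) v i(p\<^sub>s\<^sub>(\<^sub>e\<^sub>))\<close>, \<open>P\<^sub>v = i(p\<^sub>v)\<close>, and hence receives a homomorphism \<open>\<psi>\<close> from the graph
  algebra. It extends \<open>i\<close>, because \<open>T\<^sub>e i(c) T\<^sub>f\<^sup>* = i(t\<^sub>e c t\<^sub>f\<^sup>*)\<close> and the core is the closed span of the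
  \<open>t\<^sub>\<mu> t\<^sub>\<nu>\<^sup>*\<close> with \<open>|\<mu>| = |\<nu>|\<close>. Every candidate for \<open>\<iota> \<times> W\<close> is a two-sided inverse of \<open>\<psi>\<close>, which gives
  uniqueness and bijectivity at once.
\<close>

section \<open>Norms, limits and closed subspaces\<close>

text \<open>The algebras have no unit, and the Cuntz-Krieger relations do not say that the range
  projections \<open>t\<^sub>e t\<^sub>e\<^sup>\<star>\<close> at a vertex are orthogonal, only that
  they add up to a projection. Orthogonality of such projections and continuity of
  star-homomorphisms carry everything else. Both are drawn from the axioms through one substitute
  for functional calculus: an iterated square root that lies in every C*-subalgebra containing its
  argument. The multiplier \<open>v\<close> of a crossed product is carried along a homomorphism by
  \<open>mult_extension\<close>, a definite description. It can be evaluated only once it is known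
  to exist uniquely, and for this the finite sums of vertex projections are shown to be an
  approximate unit. The two universes do separate work. Over the type of \<open>A\<close> the
  universal properties give the gauge action and the map from the crossed product to
  \<open>A\<close>; over the type of \<open>B\<close> the graph algebra gives the map from
  \<open>A\<close> to \<open>B\<close>.\<close>

lemma complex_field_simps [simp]:
  "carrier complex_field = UNIV" "x \<otimes>\<^bsub>complex_field\<^esub> y = x * y" "\<one>\<^bsub>complex_field\<^esub> = 1"
  "\<zero>\<^bsub>complex_field\<^esub> = 0" "x \<oplus>\<^bsub>complex_field\<^esub> y = x + y"
  by (simp_all add: complex_field_def)

context cstar_algebra
begin

declare mult_closed [simp, intro] adj_closed [simp, intro] adj_adj [simp] nrm_nonneg [simp]

lemma smult_in [simp, intro]: "x \<in> carrier A \<Longrightarrow> c \<odot> x \<in> carrier A"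
  using smult_closed by simp

lemma smult_add_left: "x \<in> carrier A \<Longrightarrow> (c + d) \<odot> x = c \<odot> x \<oplus> d \<odot> x"
  using smult_l_distr by simp

lemma smult_add_right: "x \<in> carrier A \<Longrightarrow> y \<in> carrier A \<Longrightarrow> c \<odot> (x \<oplus> y) = c \<odot> x \<oplus> c \<odot> y"
  using smult_r_distr by simp

lemma smult_smult [simp]: "x \<in> carrier A \<Longrightarrow> c \<odot> (d \<odot> x) = (c * d) \<odot> x"
  using smult_assoc1 by simp

lemma one_smult [simp]: "x \<in> carrier A \<Longrightarrow> 1 \<odot> x = x"
  using smult_one by simp

lemma zero_smult [simp]: "x \<in> carrier A \<Longrightarrow> 0 \<odot> x = \<zero>"
  using smult_l_null by simp

lemma smult_zero [simp]: "c \<odot> \<zero> = \<zero>"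
  using smult_r_null by simp

lemma a_inv_eq_smult: "x \<in> carrier A \<Longrightarrow> \<ominus> x = (-1) \<odot> x"
  by (metis M.minus_equality add.commute add.right_inverse one_smult smult_add_left smult_in zero_smult)

lemma minus_eq_smult: "x \<in> carrier A \<Longrightarrow> y \<in> carrier A \<Longrightarrow> x \<ominus> y = x \<oplus> (-1) \<odot> y"
  by (simp add: M.minus_eq a_inv_eq_smult)

lemma smult_minus_left: "x \<in> carrier A \<Longrightarrow> (- c) \<odot> x = \<ominus> (c \<odot> x)"
  by (simp add: a_inv_eq_smult)

lemma smult_a_inv: "x \<in> carrier A \<Longrightarrow> c \<odot> (\<ominus> x) = \<ominus> (c \<odot> x)"
  by (simp add: a_inv_eq_smult)

lemma smult_minus: "x \<in> carrier A \<Longrightarrow> y \<in> carrier A \<Longrightarrow> c \<odot> (x \<ominus> y) = c \<odot> x \<ominus> c \<odot> y"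
  by (simp add: M.minus_eq smult_a_inv smult_add_right)

lemma smult_diff_left: "x \<in> carrier A \<Longrightarrow> (c - d) \<odot> x = c \<odot> x \<ominus> d \<odot> x"
  by (metis M.minus_eq smult_add_left smult_minus_left add_uminus_conv_diff)

lemma mult_zero [simp]: "x \<in> carrier A \<Longrightarrow> x \<otimes> \<zero> = \<zero>"
  by (metis M.zero_closed mult_closed smult_mult_right smult_zero zero_smult)

lemma zero_mult [simp]: "x \<in> carrier A \<Longrightarrow> \<zero> \<otimes> x = \<zero>"
  by (metis M.zero_closed mult_closed smult_mult_left smult_zero zero_smult)

lemma mult_a_inv: "x \<in> carrier A \<Longrightarrow> y \<in> carrier A \<Longrightarrow> x \<otimes> (\<ominus> y) = \<ominus> (x \<otimes> y)"
  by (simp add: a_inv_eq_smult smult_mult_right)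

lemma a_inv_mult: "x \<in> carrier A \<Longrightarrow> y \<in> carrier A \<Longrightarrow> (\<ominus> x) \<otimes> y = \<ominus> (x \<otimes> y)"
  by (simp add: a_inv_eq_smult smult_mult_left)

lemma mult_minus_right:
  "\<lbrakk>x \<in> carrier A; y \<in> carrier A; z \<in> carrier A\<rbrakk> \<Longrightarrow> x \<otimes> (y \<ominus> z) = x \<otimes> y \<ominus> x \<otimes> z"
  by (simp add: M.minus_eq mult_distrib_left mult_a_inv)

lemma mult_minus_left:
  "\<lbrakk>x \<in> carrier A; y \<in> carrier A; z \<in> carrier A\<rbrakk> \<Longrightarrow> (y \<ominus> z) \<otimes> x = y \<otimes> x \<ominus> z \<otimes> x"
  by (simp add: M.minus_eq mult_distrib_right a_inv_mult)

lemma adj_zero [simp]: "\<zero>\<^sup>\<star> = \<zero>"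
  by (metis M.zero_closed adj_closed adj_smult complex_cnj_zero zero_smult)

lemma adj_minus: "\<lbrakk>x \<in> carrier A; y \<in> carrier A\<rbrakk> \<Longrightarrow> (x \<ominus> y)\<^sup>\<star> = x\<^sup>\<star> \<ominus> y\<^sup>\<star>"
  by (simp add: minus_eq_smult adj_add adj_smult)

lemma minus_zero [simp]: "x \<in> carrier A \<Longrightarrow> x \<ominus> \<zero> = x"
  by (simp add: minus_eq_smult)

lemma minus_self [simp]: "x \<in> carrier A \<Longrightarrow> x \<ominus> x = \<zero>"
  by (simp add: M.minus_eq M.r_neg)

lemma minus_eq_zero_iff: "\<lbrakk>x \<in> carrier A; y \<in> carrier A\<rbrakk> \<Longrightarrow> x \<ominus> y = \<zero> \<longleftrightarrow> x = y"
  by (metis M.minus_eq M.minus_equality M.minus_minus M.a_inv_closed minus_self)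

lemma minus_chain:
  "\<lbrakk>x \<in> carrier A; y \<in> carrier A; z \<in> carrier A\<rbrakk> \<Longrightarrow> (x \<ominus> y) \<oplus> (y \<ominus> z) = x \<ominus> z"
  by (simp add: M.minus_eq M.a_assoc M.r_neg2 M.r_neg1)

lemma add_minus_add:
  "\<lbrakk>x \<in> carrier A; y \<in> carrier A; x' \<in> carrier A; y' \<in> carrier A\<rbrakk>
    \<Longrightarrow> (x \<oplus> y) \<ominus> (x' \<oplus> y') = (x \<ominus> x') \<oplus> (y \<ominus> y')"
  by (simp add: M.minus_eq M.minus_add M.a_ac)

lemma nrm_zero [simp]: "\<parallel>\<zero>\<parallel> = 0"
  using nrm_eq_zero by simp

lemma nrm_a_inv [simp]: "x \<in> carrier A \<Longrightarrow> \<parallel>\<ominus> x\<parallel> = \<parallel>x\<parallel>"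
  by (simp add: a_inv_eq_smult nrm_smult)

lemma nrm_minus_le: "\<lbrakk>x \<in> carrier A; y \<in> carrier A\<rbrakk> \<Longrightarrow> \<parallel>x \<ominus> y\<parallel> \<le> \<parallel>x\<parallel> + \<parallel>y\<parallel>"
  by (metis M.a_inv_closed M.minus_eq nrm_a_inv nrm_triangle)

lemma nrm_minus_commute: "\<lbrakk>x \<in> carrier A; y \<in> carrier A\<rbrakk> \<Longrightarrow> \<parallel>x \<ominus> y\<parallel> = \<parallel>y \<ominus> x\<parallel>"
  by (metis M.minus_closed M.minus_eq M.minus_equality minus_chain minus_self nrm_a_inv)

lemma nrm_minus_triangle:
  "\<lbrakk>x \<in> carrier A; y \<in> carrier A; z \<in> carrier A\<rbrakk> \<Longrightarrow> \<parallel>x \<ominus> z\<parallel> \<le> \<parallel>x \<ominus> y\<parallel> + \<parallel>y \<ominus> z\<parallel>"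
  using nrm_triangle [of "x \<ominus> y" "y \<ominus> z"] minus_chain by simp

lemma nrm_le_add_minus: "\<lbrakk>x \<in> carrier A; y \<in> carrier A\<rbrakk> \<Longrightarrow> \<parallel>x\<parallel> \<le> \<parallel>y\<parallel> + \<parallel>x \<ominus> y\<parallel>"
  using nrm_minus_triangle [of x y \<zero>] by simp

text \<open>The C*-identity and submultiplicativity give \<open>\<parallel>x\<parallel>\<^sup>2
  \<le> \<parallel>x\<^sup>\<star>\<parallel> * \<parallel>x\<parallel>\<close>, hence one
  inequality; applied to the adjoint of \<open>x\<close> it gives the other.\<close>

lemma nrm_adj [simp]: "x \<in> carrier A \<Longrightarrow> \<parallel>x\<^sup>\<star>\<parallel> = \<parallel>x\<parallel>"
proof -
  have le: "\<parallel>x\<parallel> \<le> \<parallel>x\<^sup>\<star>\<parallel>" if x: "x \<in> carrier A" for x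
  proof (cases "\<parallel>x\<parallel> = 0")
    case False
    have "\<parallel>x\<parallel> * \<parallel>x\<parallel> \<le> \<parallel>x\<^sup>\<star>\<parallel> * \<parallel>x\<parallel>"
      using cstar_identity [OF x] nrm_mult [of "x\<^sup>\<star>" x] x by (simp add: power2_eq_square)
    then show ?thesis
      using False nrm_nonneg [OF x] by simp
  qed (use x in simp)
  show "\<parallel>x\<^sup>\<star>\<parallel> = \<parallel>x\<parallel>" if "x \<in> carrier A"
    using le [OF that] le [of "x\<^sup>\<star>"] that by simp
qed

lemma cstar_identity': "x \<in> carrier A \<Longrightarrow> \<parallel>x \<otimes> x\<^sup>\<star>\<parallel> = \<parallel>x\<parallel>\<^sup>2"
  using cstar_identity [of "x\<^sup>\<star>"] by simp

text \<open>With \<open>z\<close> the adjoint of \<open>x \<ominus> y\<close> the C*-identity yields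
  norm zero. This replaces evaluation at a unit: later, elements of the algebra are identified
  through the way they multiply.\<close>

lemma eq_of_right_mult:
  assumes "x \<in> carrier A" "y \<in> carrier A" "\<And>z. z \<in> carrier A \<Longrightarrow> x \<otimes> z = y \<otimes> z"
  shows "x = y"
proof -
  have "\<parallel>(x \<ominus> y) \<otimes> (x \<ominus> y)\<^sup>\<star>\<parallel> = 0"
    using assms by (simp add: mult_minus_left)
  then show ?thesis
    using assms by (simp add: cstar_identity' nrm_eq_zero minus_eq_zero_iff)
qed

lemma Metric_space_cdist: "Metric_space (carrier A) (cdist A)"
proof
  show "0 \<le> cdist A x y" for x y
    by (simp add: cdist_def)
  show "cdist A x y = cdist A y x" for x y
    by (simp add: cdist_def nrm_minus_commute)
  show "cdist A x y = 0 \<longleftrightarrow> x = y" if "x \<in> carrier A" "y \<in> carrier A" for x y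
    using that by (simp add: cdist_def nrm_eq_zero minus_eq_zero_iff)
  show "cdist A x z \<le> cdist A x y + cdist A y z"
    if "x \<in> carrier A" "y \<in> carrier A" "z \<in> carrier A" for x y z
    using that by (simp add: cdist_def nrm_minus_triangle)
qed

text \<open>Convergence in \<open>norm_topology A\<close> as a real limit, so that the limit rules
  for real functions apply; \<open>limitin_iff_conv\<close> is the bridge. Membership in the carrier
  is only asked for eventually, as in the topological notion.\<close>

definition conv :: "('i \<Rightarrow> 'a) \<Rightarrow> 'a \<Rightarrow> 'i filter \<Rightarrow> bool" where
  "conv f l F \<longleftrightarrow> l \<in> carrier A \<and> eventually (\<lambda>i. f i \<in> carrier A) F \<and> ((\<lambda>i. \<parallel>f i \<ominus> l\<parallel>) \<longlongrightarrow> 0) F"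

lemma limitin_iff_conv: "limitin (norm_topology A) f l F \<longleftrightarrow> conv f l F"
proof -
  interpret Metric_space "carrier A" "cdist A" by (rule Metric_space_cdist)
  have "((\<lambda>i. cdist A (f i) l) \<longlongrightarrow> 0) F \<longleftrightarrow> ((\<lambda>i. \<parallel>f i \<ominus> l\<parallel>) \<longlongrightarrow> 0) F"
    if "l \<in> carrier A" "eventually (\<lambda>i. f i \<in> carrier A) F"
    by (rule tendsto_cong, rule eventually_mono [OF that(2)]) (simp add: cdist_def that)
  then show ?thesis
    unfolding norm_topology_def conv_def limitin_metric_dist_null by blast
qed

lemma conv_carrier: "conv f l F \<Longrightarrow> l \<in> carrier A"
  by (simp add: conv_def)

lemma conv_unique: "conv f l F \<Longrightarrow> conv f m F \<Longrightarrow> F \<noteq> bot \<Longrightarrow> l = m"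
proof -
  interpret Metric_space "carrier A" "cdist A" by (rule Metric_space_cdist)
  show "conv f l F \<Longrightarrow> conv f m F \<Longrightarrow> F \<noteq> bot \<Longrightarrow> l = m"
    unfolding limitin_iff_conv [symmetric] norm_topology_def by (rule limitin_metric_unique)
qed

lemma conv_I:
  assumes "l \<in> carrier A" "eventually (\<lambda>i. f i \<in> carrier A \<and> \<parallel>f i \<ominus> l\<parallel> \<le> g i) F" "(g \<longlongrightarrow> 0) F"
  shows "conv f l F"
  unfolding conv_def
proof (intro conjI)
  show "eventually (\<lambda>i. f i \<in> carrier A) F"
    using assms(2) by (rule eventually_mono) simp
  show "((\<lambda>i. \<parallel>f i \<ominus> l\<parallel>) \<longlongrightarrow> 0) F"
  proof (rule tendsto_sandwich [OF _ _ tendsto_const assms(3)])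
    show "eventually (\<lambda>i. 0 \<le> \<parallel>f i \<ominus> l\<parallel>) F" "eventually (\<lambda>i. \<parallel>f i \<ominus> l\<parallel> \<le> g i) F"
      using assms by (auto elim: eventually_mono)
  qed
qed (rule assms)

lemma conv_eventually_const:
  "l \<in> carrier A \<Longrightarrow> eventually (\<lambda>i. f i = l) F \<Longrightarrow> conv f l F"
  by (rule conv_I [where g = "\<lambda>_. 0"]) (auto elim: eventually_mono)

lemma conv_cong: "conv f l F \<Longrightarrow> eventually (\<lambda>i. f i = g i) F \<Longrightarrow> conv g l F"
proof -
  assume *: "conv f l F" "eventually (\<lambda>i. f i = g i) F"
  show "conv g l F"
  proof (rule conv_I [where g = "\<lambda>i. \<parallel>f i \<ominus> l\<parallel>"])
    have "eventually (\<lambda>i. f i \<in> carrier A) F" using * by (simp add: conv_def)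
    then show "eventually (\<lambda>i. g i \<in> carrier A \<and> \<parallel>g i \<ominus> l\<parallel> \<le> \<parallel>f i \<ominus> l\<parallel>) F"
      using *(2) by eventually_elim simp
  qed (use * in \<open>auto simp: conv_def\<close>)
qed

text \<open>A Lipschitz bound instead of linearity, so that the conjugate-linear adjoint is covered
  as well.\<close>

lemma conv_bounded_linear:
  assumes f: "conv f l F"
    and T: "\<And>x. x \<in> carrier A \<Longrightarrow> T x \<in> carrier A"
      "\<And>x y. \<lbrakk>x \<in> carrier A; y \<in> carrier A\<rbrakk> \<Longrightarrow> \<parallel>T x \<ominus> T y\<parallel> \<le> K * \<parallel>x \<ominus> y\<parallel>"
  shows "conv (\<lambda>i. T (f i)) (T l) F"
proof (rule conv_I)
  show "T l \<in> carrier A" using f T by (simp add: conv_def)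
  have "eventually (\<lambda>i. f i \<in> carrier A) F" "l \<in> carrier A" using f by (simp_all add: conv_def)
  then show "eventually (\<lambda>i. T (f i) \<in> carrier A \<and> \<parallel>T (f i) \<ominus> T l\<parallel> \<le> K * \<parallel>f i \<ominus> l\<parallel>) F"
    using T by (auto elim: eventually_mono)
  show "((\<lambda>i. K * \<parallel>f i \<ominus> l\<parallel>) \<longlongrightarrow> 0) F"
    using f by (auto simp: conv_def intro: tendsto_mult_right_zero)
qed

lemma conv_add:
  assumes "conv f l F" "conv g m F"
  shows "conv (\<lambda>i. f i \<oplus> g i) (l \<oplus> m) F"
proof (rule conv_I)
  have "eventually (\<lambda>i. f i \<in> carrier A) F" "l \<in> carrier A" "eventually (\<lambda>i. g i \<in> carrier A) F" "m \<in> carrier A"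
    using assms by (simp_all add: conv_def)
  then show "l \<oplus> m \<in> carrier A"
    "eventually (\<lambda>i. f i \<oplus> g i \<in> carrier A \<and> \<parallel>f i \<oplus> g i \<ominus> (l \<oplus> m)\<parallel> \<le> \<parallel>f i \<ominus> l\<parallel> + \<parallel>g i \<ominus> m\<parallel>) F"
     apply simp
    using \<open>eventually (\<lambda>i. f i \<in> carrier A) F\<close> \<open>eventually (\<lambda>i. g i \<in> carrier A) F\<close>
    by eventually_elim (use \<open>l \<in> carrier A\<close> \<open>m \<in> carrier A\<close> in \<open>simp add: add_minus_add nrm_triangle\<close>)
  show "((\<lambda>i. \<parallel>f i \<ominus> l\<parallel> + \<parallel>g i \<ominus> m\<parallel>) \<longlongrightarrow> 0) F"
    using assms tendsto_add_zero by (auto simp: conv_def)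
qed

lemma conv_smult: "conv f l F \<Longrightarrow> conv (\<lambda>i. c \<odot> f i) (c \<odot> l) F"
  by (rule conv_bounded_linear [where T = "(\<odot>) c" and K = "cmod c"])
    (auto simp: smult_minus [symmetric] nrm_smult)

lemma conv_adj: "conv f l F \<Longrightarrow> conv (\<lambda>i. (f i)\<^sup>\<star>) (l\<^sup>\<star>) F"
  by (rule conv_bounded_linear [where T = "\<lambda>x. x\<^sup>\<star>" and K = 1])
    (auto simp: adj_minus [symmetric])

lemma conv_mult_left: "a \<in> carrier A \<Longrightarrow> conv f l F \<Longrightarrow> conv (\<lambda>i. a \<otimes> f i) (a \<otimes> l) F"
  by (rule conv_bounded_linear [where T = "\<lambda>x. a \<otimes> x" and K = "\<parallel>a\<parallel>"])
    (auto simp: mult_minus_right [symmetric] nrm_mult)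

lemma conv_mult_right: "a \<in> carrier A \<Longrightarrow> conv f l F \<Longrightarrow> conv (\<lambda>i. f i \<otimes> a) (l \<otimes> a) F"
  by (rule conv_bounded_linear [where T = "\<lambda>x. x \<otimes> a" and K = "\<parallel>a\<parallel>"])
    (auto simp: mult_minus_left [symmetric] mult.commute [of "\<parallel>a\<parallel>"] nrm_mult)

lemma conv_nrm_le:
  assumes "conv f l F" "F \<noteq> bot" "eventually (\<lambda>i. \<parallel>f i\<parallel> \<le> K) F"
  shows "\<parallel>l\<parallel> \<le> K"
proof (rule tendsto_le [OF assms(2)])
  show "((\<lambda>i. K + \<parallel>f i \<ominus> l\<parallel>) \<longlongrightarrow> K) F"
    using tendsto_add [OF tendsto_const [of K F], of "\<lambda>i. \<parallel>f i \<ominus> l\<parallel>" 0] assms(1) by (simp add: conv_def)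
  show "((\<lambda>i. \<parallel>l\<parallel>) \<longlongrightarrow> \<parallel>l\<parallel>) F" by (rule tendsto_const)
  have l: "l \<in> carrier A" and "eventually (\<lambda>i. f i \<in> carrier A) F" using assms(1) by (simp_all add: conv_def)
  from this(2) assms(3) show "eventually (\<lambda>i. \<parallel>l\<parallel> \<le> K + \<parallel>f i \<ominus> l\<parallel>) F"
  proof eventually_elim
    case (elim i)
    then show ?case using nrm_le_add_minus [of l "f i"] nrm_minus_commute [of l "f i"] l by simp
  qed
qed

lemma Cauchy_conv:
  assumes "\<And>n. \<sigma> n \<in> carrier A"
    and "\<And>e. e > 0 \<Longrightarrow> \<exists>N. \<forall>m\<ge>N. \<forall>n\<ge>N. \<parallel>\<sigma> m \<ominus> \<sigma> n\<parallel> < e"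
  shows "\<exists>l. conv \<sigma> l sequentially"
proof -
  interpret Metric_space "carrier A" "cdist A" by (rule Metric_space_cdist)
  have "MCauchy \<sigma>"
    using assms unfolding MCauchy_def by (fastforce simp: cdist_def)
  then show ?thesis
    using complete unfolding mcomplete_def limitin_iff_conv [symmetric] norm_topology_def by blast
qed

lemma closedin_iff:
  "closedin (norm_topology A) S \<longleftrightarrow> S \<subseteq> carrier A \<and>
    (\<forall>x\<in>carrier A. (\<forall>e>0. \<exists>y\<in>S. \<parallel>x \<ominus> y\<parallel> < e) \<longrightarrow> x \<in> S)"
proof -
  interpret Metric_space "carrier A" "cdist A" by (rule Metric_space_cdist)
  have "(\<exists>r>0. disjnt S (mball x r)) \<longleftrightarrow> \<not> (\<forall>e>0. \<exists>y\<in>S. \<parallel>x \<ominus> y\<parallel> < e)" if "x \<in> carrier A" "S \<subseteq> carrier A" for x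
    using that by (fastforce simp: disjnt_def in_mball cdist_def subset_iff)
  then show ?thesis
    unfolding norm_topology_def closedin_metric by blast
qed

end

section \<open>Products of limits, closed subspaces, closed spans and finite sums\<close>

context cstar_algebra
begin

text \<open>Splits the error as \<open>(f i \<ominus> l) \<otimes> g i \<oplus> l \<otimes> (g i
  \<ominus> m)\<close>. Since \<open>g\<close> need not be bounded along the filter,
  \<open>\<parallel>g i\<parallel>\<close> is replaced by \<open>\<parallel>m\<parallel> +
  \<parallel>g i \<ominus> m\<parallel>\<close>, which converges.\<close>

lemma conv_mult:
  assumes "conv f l F" "conv g m F"
  shows "conv (\<lambda>i. f i \<otimes> g i) (l \<otimes> m) F"
proof (rule conv_I)
  have c: "l \<in> carrier A" "m \<in> carrier A" 
    and ev: "eventually (\<lambda>i. f i \<in> carrier A) F" "eventually (\<lambda>i. g i \<in> carrier A) F"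
    and t: "((\<lambda>i. \<parallel>f i \<ominus> l\<parallel>) \<longlongrightarrow> 0) F" "((\<lambda>i. \<parallel>g i \<ominus> m\<parallel>) \<longlongrightarrow> 0) F"
    using assms by (simp_all add: conv_def)
  show "l \<otimes> m \<in> carrier A" using c by simp
  show "eventually (\<lambda>i. f i \<otimes> g i \<in> carrier A \<and> \<parallel>f i \<otimes> g i \<ominus> l \<otimes> m\<parallel>
      \<le> \<parallel>f i \<ominus> l\<parallel> * (\<parallel>m\<parallel> + \<parallel>g i \<ominus> m\<parallel>) + \<parallel>l\<parallel> * \<parallel>g i \<ominus> m\<parallel>) F"
    using ev
  proof eventually_elim
    case (elim i)
    have "\<parallel>f i \<otimes> g i \<ominus> l \<otimes> m\<parallel> \<le> \<parallel>f i \<otimes> g i \<ominus> l \<otimes> g i\<parallel> + \<parallel>l \<otimes> g i \<ominus> l \<otimes> m\<parallel>"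
      using elim c by (intro nrm_minus_triangle) auto
    also have "\<dots> = \<parallel>(f i \<ominus> l) \<otimes> g i\<parallel> + \<parallel>l \<otimes> (g i \<ominus> m)\<parallel>"
      using elim c by (simp add: mult_minus_left mult_minus_right)
    also have "\<dots> \<le> \<parallel>f i \<ominus> l\<parallel> * \<parallel>g i\<parallel> + \<parallel>l\<parallel> * \<parallel>g i \<ominus> m\<parallel>"
      using elim c by (intro add_mono nrm_mult) auto
    also have "\<dots> \<le> \<parallel>f i \<ominus> l\<parallel> * (\<parallel>m\<parallel> + \<parallel>g i \<ominus> m\<parallel>) + \<parallel>l\<parallel> * \<parallel>g i \<ominus> m\<parallel>"
      using elim c by (intro add_mono mult_left_mono nrm_le_add_minus) auto
    finally show ?case using elim c by simp
  qed
  show "((\<lambda>i. \<parallel>f i \<ominus> l\<parallel> * (\<parallel>m\<parallel> + \<parallel>g i \<ominus> m\<parallel>) + \<parallel>l\<parallel> * \<parallel>g i \<ominus> m\<parallel>) \<longlongrightarrow> 0) F"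
    using t by (auto intro!: tendsto_eq_intros)
qed

lemma closed_subspaceI:
  assumes "S \<subseteq> carrier A" "\<zero> \<in> S" "\<And>x y. \<lbrakk>x \<in> S; y \<in> S\<rbrakk> \<Longrightarrow> x \<oplus> y \<in> S"
    "\<And>c x. x \<in> S \<Longrightarrow> c \<odot> x \<in> S"
    "\<And>x. \<lbrakk>x \<in> carrier A; \<And>e. e > 0 \<Longrightarrow> \<exists>y\<in>S. \<parallel>x \<ominus> y\<parallel> < e\<rbrakk> \<Longrightarrow> x \<in> S"
  shows "closed_subspace S A"
  unfolding closed_subspace_def
proof
  show "submodule S complex_field A"
  proof (rule submoduleI)
    show "\<ominus> a \<in> S" if "a \<in> S" for a
      using assms that a_inv_eq_smult [of a] by auto
  qed (use assms in auto)
  show "closedin (norm_topology A) S"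
    unfolding closedin_iff using assms by blast
qed

lemma
  assumes "closed_subspace S A"
  shows closed_subspace_sub: "S \<subseteq> carrier A"
    and closed_subspace_add: "\<lbrakk>x \<in> S; y \<in> S\<rbrakk> \<Longrightarrow> x \<oplus> y \<in> S"
    and closed_subspace_smult: "x \<in> S \<Longrightarrow> c \<odot> x \<in> S"
    and closed_subspace_minus: "\<lbrakk>x \<in> S; y \<in> S\<rbrakk> \<Longrightarrow> x \<ominus> y \<in> S"
    and closed_subspace_zero: "\<zero> \<in> S"
    and closed_subspace_approx: "\<lbrakk>x \<in> carrier A; \<And>e. e > 0 \<Longrightarrow> \<exists>y\<in>S. \<parallel>x \<ominus> y\<parallel> < e\<rbrakk> \<Longrightarrow> x \<in> S"
proof -
  have m: "submodule S complex_field A" and c: "closedin (norm_topology A) S"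
    using assms by (simp_all add: closed_subspace_def)
  show "S \<subseteq> carrier A" "\<lbrakk>x \<in> S; y \<in> S\<rbrakk> \<Longrightarrow> x \<oplus> y \<in> S" "x \<in> S \<Longrightarrow> c \<odot> x \<in> S"
    "\<lbrakk>x \<in> S; y \<in> S\<rbrakk> \<Longrightarrow> x \<ominus> y \<in> S"
    using submoduleE [OF m] by (simp_all add: M.minus_eq)
  show "\<zero> \<in> S"
    using submodule.axioms(1) [OF m] subgroup.one_closed by fastforce
  show "\<lbrakk>x \<in> carrier A; \<And>e. e > 0 \<Longrightarrow> \<exists>y\<in>S. \<parallel>x \<ominus> y\<parallel> < e\<rbrakk> \<Longrightarrow> x \<in> S"
    using c unfolding closedin_iff by blast
qed

lemma closed_subspace_conv:
  assumes "closed_subspace S A" "conv f l F" "eventually (\<lambda>i. f i \<in> S) F" "F \<noteq> bot"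
  shows "l \<in> S"
proof (rule closed_subspace_approx [OF assms(1)])
  show l: "l \<in> carrier A" using assms by (simp add: conv_def)
  fix e :: real assume "e > 0"
  then have "eventually (\<lambda>i. \<parallel>f i \<ominus> l\<parallel> < e) F"
    using assms(2) by (auto simp: conv_def dest: order_tendstoD)
  with assms(3) have "eventually (\<lambda>i. f i \<in> S \<and> \<parallel>f i \<ominus> l\<parallel> < e) F" by eventually_elim simp
  then obtain i where "f i \<in> S" "\<parallel>f i \<ominus> l\<parallel> < e"
    using assms(4) eventually_happens by fastforce
  then show "\<exists>y\<in>S. \<parallel>l \<ominus> y\<parallel> < e"
    using closed_subspace_sub [OF assms(1)] nrm_minus_commute [OF l, of "f i"]
    by (intro bexI [of _ "f i"]) auto
qed

lemma closed_subspace_carrier: "closed_subspace (carrier A) A"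
  by (rule closed_subspaceI) auto

lemma closed_subspace_Inter:
  assumes "\<And>S. S \<in> \<S> \<Longrightarrow> closed_subspace S A" "\<S> \<noteq> {}"
  shows "closed_subspace (\<Inter>\<S>) A"
proof (rule closed_subspaceI)
  show "x \<in> \<Inter>\<S>" if "x \<in> carrier A" and "\<And>e. 0 < e \<Longrightarrow> \<exists>y\<in>\<Inter>\<S>. \<parallel>x \<ominus> y\<parallel> < e" for x
    using closed_subspace_approx [OF assms(1)] that by (metis InterE InterI)
  show "\<Inter>\<S> \<subseteq> carrier A"
    using assms closed_subspace_sub by blast
qed (use closed_subspace_zero [OF assms(1)] closed_subspace_add [OF assms(1)]
    closed_subspace_smult [OF assms(1)] in auto)

lemma closed_span_subspace: "X \<subseteq> carrier A \<Longrightarrow> closed_subspace (closed_span A X) A"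
  unfolding closed_span_def
  by (rule closed_subspace_Inter) (use closed_subspace_carrier in auto)

lemma closed_span_superset: "X \<subseteq> closed_span A X"
  by (auto simp: closed_span_def)

lemma closed_span_least: "closed_subspace S A \<Longrightarrow> X \<subseteq> S \<Longrightarrow> closed_span A X \<subseteq> S"
  by (auto simp: closed_span_def)

lemma closed_span_sub_carrier: "X \<subseteq> carrier A \<Longrightarrow> closed_span A X \<subseteq> carrier A"
  by (rule closed_span_least [OF closed_subspace_carrier])

lemma closed_span_mono: "X \<subseteq> Y \<Longrightarrow> closed_span A X \<subseteq> closed_span A Y"
  by (auto simp: closed_span_def)

lemma closed_subspace_finsum:
  assumes S: "closed_subspace S A" and f: "\<And>i. i \<in> I \<Longrightarrow> f i \<in> S"
  shows "finsum A f I \<in> S"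
proof (cases "finite I")
  case True
  then show ?thesis using f
  proof (induction I rule: finite_induct)
    case (insert i I)
    have "f j \<in> carrier A" if "j \<in> insert i I" for j
      using insert closed_subspace_sub [OF S] that by blast
    with insert show ?case by (simp add: closed_subspace_add [OF S] Pi_def)
  qed (simp add: closed_subspace_zero [OF S])
qed (simp add: closed_subspace_zero [OF S] M.finsum_infinite)

lemma closed_subspace_closure:
  assumes G: "G \<subseteq> carrier A" "\<zero> \<in> G" "\<And>x y. \<lbrakk>x \<in> G; y \<in> G\<rbrakk> \<Longrightarrow> x \<oplus> y \<in> G"
    "\<And>c x. x \<in> G \<Longrightarrow> c \<odot> x \<in> G"
  shows "closed_subspace {x \<in> carrier A. \<forall>e>0. \<exists>y\<in>G. \<parallel>x \<ominus> y\<parallel> < e} A" (is "closed_subspace ?S A")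
proof (rule closed_subspaceI)
  have ex: "\<exists>y\<in>G. \<parallel>x \<ominus> y\<parallel> < e" if "x \<in> ?S" "e > 0" for x e
    using that by blast
  have "x \<in> ?S" if "x \<in> G" for x
    using that G by (auto intro!: bexI [of _ x])
  then show "\<zero> \<in> ?S" using G by simp
  show "x \<oplus> y \<in> ?S" if xy: "x \<in> ?S" "y \<in> ?S" for x y
  proof (clarsimp, intro conjI allI impI)
    show "x \<oplus> y \<in> carrier A" using xy by simp
    fix e :: real assume "e > 0"
    then obtain x' y' where *: "x' \<in> G" "\<parallel>x \<ominus> x'\<parallel> < e/2" "y' \<in> G" "\<parallel>y \<ominus> y'\<parallel> < e/2"
      using ex [OF xy(1), of "e/2"] ex [OF xy(2), of "e/2"] by auto
    then have c: "x' \<in> carrier A" "y' \<in> carrier A" using G by auto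
    have "\<parallel>x \<oplus> y \<ominus> (x' \<oplus> y')\<parallel> \<le> \<parallel>x \<ominus> x'\<parallel> + \<parallel>y \<ominus> y'\<parallel>"
      using c xy by (simp add: add_minus_add nrm_triangle)
    then show "\<exists>z\<in>G. \<parallel>x \<oplus> y \<ominus> z\<parallel> < e" using * G by (auto intro!: bexI [of _ "x' \<oplus> y'"])
  qed
  show "c \<odot> x \<in> ?S" if x: "x \<in> ?S" for c x
  proof (clarsimp, intro conjI allI impI)
    show "c \<odot> x \<in> carrier A" using x by simp
    fix e :: real assume "e > 0"
    \<comment> \<open>The summand 1 keeps the divisor positive when \<open>c = 0\<close>.\<close>
    then obtain x' where *: "x' \<in> G" "\<parallel>x \<ominus> x'\<parallel> < e / (cmod c + 1)"
      using ex [OF x, of "e / (cmod c + 1)"] by (auto simp: add_nonneg_pos)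
    then have c: "x' \<in> carrier A" using G by auto
    have "\<parallel>c \<odot> x \<ominus> c \<odot> x'\<parallel> = cmod c * \<parallel>x \<ominus> x'\<parallel>"
      using c x by (simp add: smult_minus [symmetric] nrm_smult)
    also have "\<dots> \<le> (cmod c + 1) * \<parallel>x \<ominus> x'\<parallel>"
      using c x by (intro mult_right_mono) auto
    also have "\<dots> < e"
      using * by (metis add_nonneg_pos less_divide_eq mult.commute norm_ge_zero zero_less_one)
    finally show "\<exists>z\<in>G. \<parallel>c \<odot> x \<ominus> z\<parallel> < e" using * G by blast
  qed
  show "x \<in> ?S" if x: "x \<in> carrier A" and ap: "\<And>e. 0 < e \<Longrightarrow> \<exists>y\<in>?S. \<parallel>x \<ominus> y\<parallel> < e" for x
  proof (clarsimp, intro conjI allI impI)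
    fix e :: real assume "e > 0"
    then obtain y where y: "y \<in> ?S" "\<parallel>x \<ominus> y\<parallel> < e/2" using ap [of "e/2"] by auto
    then obtain z where z: "z \<in> G" "\<parallel>y \<ominus> z\<parallel> < e/2"
      using \<open>e > 0\<close> ex [OF y(1), of "e/2"] by auto
    have "\<parallel>x \<ominus> z\<parallel> \<le> \<parallel>x \<ominus> y\<parallel> + \<parallel>y \<ominus> z\<parallel>"
      using x y z G by (intro nrm_minus_triangle) auto
    then show "\<exists>z\<in>G. \<parallel>x \<ominus> z\<parallel> < e" using z y by (intro bexI [of _ z]) auto
  qed (rule x)
qed auto

lemma cstar_subalgebra_carrier: "cstar_subalgebra (carrier A) A"
  by (simp add: cstar_subalgebra_def closed_subspace_carrier)

lemma generated_least: "cstar_subalgebra S A \<Longrightarrow> X \<subseteq> S \<Longrightarrow> generated_cstar A X \<subseteq> S"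
  by (auto simp: generated_cstar_def)

lemma finsum_smult: "\<lbrakk>\<And>i. i \<in> I \<Longrightarrow> f i \<in> carrier A\<rbrakk> \<Longrightarrow> c \<odot> finsum A f I = finsum A (\<lambda>i. c \<odot> f i) I"
  by (cases "finite I") (auto intro: finsum_smult_ldistr simp: M.finsum_infinite)

lemma finsum_smult_const:
  "finite I \<Longrightarrow> x \<in> carrier A \<Longrightarrow> finsum A (\<lambda>i. c i \<odot> x) I = (\<Sum>i\<in>I. c i) \<odot> x"
  by (induction I rule: finite_induct) (auto simp: smult_add_left)

lemma finsum_mult_left:
  "\<lbrakk>a \<in> carrier A; \<And>i. i \<in> I \<Longrightarrow> f i \<in> carrier A\<rbrakk> \<Longrightarrow> a \<otimes> finsum A f I = finsum A (\<lambda>i. a \<otimes> f i) I"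
proof (induction I rule: infinite_finite_induct)
  case (insert i I)
  then show ?case by (simp add: Pi_def mult_distrib_left)
qed (auto simp: M.finsum_infinite)

lemma finsum_mult_right:
  "\<lbrakk>a \<in> carrier A; \<And>i. i \<in> I \<Longrightarrow> f i \<in> carrier A\<rbrakk> \<Longrightarrow> finsum A f I \<otimes> a = finsum A (\<lambda>i. f i \<otimes> a) I"
proof (induction I rule: infinite_finite_induct)
  case (insert i I)
  then show ?case by (simp add: Pi_def mult_distrib_right)
qed (auto simp: M.finsum_infinite)

lemma finsum_adj:
  "\<lbrakk>\<And>i. i \<in> I \<Longrightarrow> f i \<in> carrier A\<rbrakk> \<Longrightarrow> (finsum A f I)\<^sup>\<star> = finsum A (\<lambda>i. (f i)\<^sup>\<star>) I"
proof (induction I rule: infinite_finite_induct)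
  case (insert i I)
  then show ?case by (simp add: Pi_def adj_add)
qed (auto simp: M.finsum_infinite)

lemma finsum_eq: "\<lbrakk>\<And>i. i \<in> I \<Longrightarrow> f i = g i; \<And>i. i \<in> I \<Longrightarrow> g i \<in> carrier A\<rbrakk> \<Longrightarrow> finsum A f I = finsum A g I"
  by (rule M.finsum_cong') auto

lemma finsum_zero': "(\<And>i. i \<in> I \<Longrightarrow> f i = \<zero>) \<Longrightarrow> finsum A f I = \<zero>"
  using finsum_eq [of I f "\<lambda>_. \<zero>"] by simp

lemma finsum_neutral:
  assumes "finite J" "I \<subseteq> J" "\<And>i. i \<in> J - I \<Longrightarrow> f i = \<zero>" "\<And>i. i \<in> I \<Longrightarrow> f i \<in> carrier A"
  shows "finsum A f J = finsum A f I"
proof -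
  have "finsum A f (I \<union> (J - I)) = finsum A f I \<oplus> finsum A f (J - I)"
    using assms by (intro M.finsum_Un_disjoint) (auto intro: finite_subset)
  then show ?thesis
    using assms finsum_zero' [of "J - I" f] by (simp add: Un_absorb1 Pi_def)
qed

lemma finsum_single:
  assumes "finite J" "i \<in> J" "\<And>j. j \<in> J \<Longrightarrow> j \<noteq> i \<Longrightarrow> f j = \<zero>" "f i \<in> carrier A"
  shows "finsum A f J = f i"
  using finsum_neutral [of J "{i}" f] assms by auto

lemma finsum_closed': "(\<And>i. i \<in> I \<Longrightarrow> f i \<in> carrier A) \<Longrightarrow> finsum A f I \<in> carrier A"
  by (rule M.finsum_closed) auto

lemma nrm_finsum_le:
  "(\<And>i. i \<in> I \<Longrightarrow> f i \<in> carrier A) \<Longrightarrow> \<parallel>finsum A f I\<parallel> \<le> (\<Sum>i\<in>I. \<parallel>f i\<parallel>)"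
proof (induction I rule: infinite_finite_induct)
  case (insert i I)
  then have "\<parallel>f i \<oplus> finsum A f I\<parallel> \<le> \<parallel>f i\<parallel> + \<parallel>finsum A f I\<parallel>"
    by (intro nrm_triangle) (auto intro: finsum_closed')
  moreover have "finsum A f (insert i I) = f i \<oplus> finsum A f I"
    using insert by (intro M.finsum_insert) auto
  moreover have "\<parallel>finsum A f I\<parallel> \<le> (\<Sum>i\<in>I. \<parallel>f i\<parallel>)"
    using insert by blast
  ultimately show ?case using insert(1,2) by simp
qed (auto simp: M.finsum_infinite)

end

section \<open>Bounded linear maps and star-homomorphisms\<close>

text \<open>The domain \<open>S\<close> is kept apart from the record \<open>A\<close>. The core has
  the operations of \<open>A\<close> on a smaller carrier, so maps on the core and maps on
  \<open>A\<close> fall under one notion; the same holds for \<open>star_hom\<close> below.\<close>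

definition blin :: "'a set \<Rightarrow> 'a cstar \<Rightarrow> 'b cstar \<Rightarrow> ('a \<Rightarrow> 'b) \<Rightarrow> bool" where
  "blin S A B T \<longleftrightarrow> (\<forall>x\<in>S. T x \<in> carrier B) \<and>
    (\<forall>x\<in>S. \<forall>y\<in>S. T (x \<oplus>\<^bsub>A\<^esub> y) = T x \<oplus>\<^bsub>B\<^esub> T y) \<and>
    (\<forall>c. \<forall>x\<in>S. T (c \<odot>\<^bsub>A\<^esub> x) = c \<odot>\<^bsub>B\<^esub> T x) \<and>
    (\<exists>K. \<forall>x\<in>S. \<parallel>T x\<parallel>\<^bsub>B\<^esub> \<le> K * \<parallel>x\<parallel>\<^bsub>A\<^esub>)"

definition star_hom :: "'a set \<Rightarrow> 'a cstar \<Rightarrow> 'b cstar \<Rightarrow> ('a \<Rightarrow> 'b) \<Rightarrow> bool" where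
  "star_hom S A B \<phi> \<longleftrightarrow> (\<forall>x\<in>S. \<phi> x \<in> carrier B) \<and>
    (\<forall>x\<in>S. \<forall>y\<in>S. \<phi> (x \<oplus>\<^bsub>A\<^esub> y) = \<phi> x \<oplus>\<^bsub>B\<^esub> \<phi> y) \<and>
    (\<forall>x\<in>S. \<forall>y\<in>S. \<phi> (x \<otimes>\<^bsub>A\<^esub> y) = \<phi> x \<otimes>\<^bsub>B\<^esub> \<phi> y) \<and>
    (\<forall>c. \<forall>x\<in>S. \<phi> (c \<odot>\<^bsub>A\<^esub> x) = c \<odot>\<^bsub>B\<^esub> \<phi> x) \<and>
    (\<forall>x\<in>S. \<phi> (x\<^sup>\<star>\<^bsub>A\<^esub>) = (\<phi> x)\<^sup>\<star>\<^bsub>B\<^esub>)"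

lemma cstar_hom_iff: "\<phi> \<in> cstar_hom A B \<longleftrightarrow> star_hom (carrier A) A B \<phi>"
  unfolding cstar_hom_def star_hom_def Pi_def by blast

lemma cstar_hom_core_iff: "\<phi> \<in> cstar_hom (A\<lparr>carrier := S\<rparr>) B \<longleftrightarrow> star_hom S A B \<phi>"
  unfolding cstar_hom_def star_hom_def Pi_def by simp blast

lemma
  assumes "star_hom S A B \<phi>"
  shows star_hom_closed: "x \<in> S \<Longrightarrow> \<phi> x \<in> carrier B"
    and star_hom_add: "x \<in> S \<Longrightarrow> y \<in> S \<Longrightarrow> \<phi> (x \<oplus>\<^bsub>A\<^esub> y) = \<phi> x \<oplus>\<^bsub>B\<^esub> \<phi> y"
    and star_hom_mult: "x \<in> S \<Longrightarrow> y \<in> S \<Longrightarrow> \<phi> (x \<otimes>\<^bsub>A\<^esub> y) = \<phi> x \<otimes>\<^bsub>B\<^esub> \<phi> y"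
    and star_hom_smult: "x \<in> S \<Longrightarrow> \<phi> (c \<odot>\<^bsub>A\<^esub> x) = c \<odot>\<^bsub>B\<^esub> \<phi> x"
    and star_hom_adj: "x \<in> S \<Longrightarrow> \<phi> (x\<^sup>\<star>\<^bsub>A\<^esub>) = (\<phi> x)\<^sup>\<star>\<^bsub>B\<^esub>"
  using assms by (simp_all add: star_hom_def)

locale two_cstar = A: cstar_algebra A + B: cstar_algebra B
  for A :: "'a cstar" and B :: "'b cstar"
begin

lemma
  assumes "blin S A B T" 
  shows blin_closed: "x \<in> S \<Longrightarrow> T x \<in> carrier B"
    and blin_add: "x \<in> S \<Longrightarrow> y \<in> S \<Longrightarrow> T (x \<oplus>\<^bsub>A\<^esub> y) = T x \<oplus>\<^bsub>B\<^esub> T y"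
    and blin_smult: "x \<in> S \<Longrightarrow> T (c \<odot>\<^bsub>A\<^esub> x) = c \<odot>\<^bsub>B\<^esub> T x"
  using assms by (simp_all add: blin_def)

text \<open>The constant is made positive so that an error may be divided by it.\<close>

lemma blin_bound:
  assumes "blin S A B T" "S \<subseteq> carrier A"
  obtains K where "K > 0" "\<And>x. x \<in> S \<Longrightarrow> \<parallel>T x\<parallel>\<^bsub>B\<^esub> \<le> K * \<parallel>x\<parallel>\<^bsub>A\<^esub>"
proof -
  obtain K where K: "\<And>x. x \<in> S \<Longrightarrow> \<parallel>T x\<parallel>\<^bsub>B\<^esub> \<le> K * \<parallel>x\<parallel>\<^bsub>A\<^esub>"
    using assms unfolding blin_def by blast
  have "\<parallel>T x\<parallel>\<^bsub>B\<^esub> \<le> (\<bar>K\<bar> + 1) * \<parallel>x\<parallel>\<^bsub>A\<^esub>" if "x \<in> S" for x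
  proof -
    have "K * \<parallel>x\<parallel>\<^bsub>A\<^esub> \<le> (\<bar>K\<bar> + 1) * \<parallel>x\<parallel>\<^bsub>A\<^esub>"
      using that assms(2) by (intro mult_right_mono) auto
    with K [OF that] show ?thesis by linarith
  qed
  then show thesis by (intro that [of "\<bar>K\<bar> + 1"]) auto
qed

lemma blin_minus:
  assumes S: "closed_subspace S A" and T: "blin S A B T" and x: "x \<in> S" "y \<in> S"
  shows "T (x \<ominus>\<^bsub>A\<^esub> y) = T x \<ominus>\<^bsub>B\<^esub> T y"
proof -
  have "x \<in> carrier A" "y \<in> carrier A" using x A.closed_subspace_sub [OF S] by auto
  then show ?thesis
    using x T by (simp add: A.minus_eq_smult B.minus_eq_smult blin_add blin_smult blin_closed
        A.closed_subspace_smult [OF S])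
qed

lemma blin_zero:
  assumes S: "closed_subspace S A" and T: "blin S A B T"
  shows "T \<zero>\<^bsub>A\<^esub> = \<zero>\<^bsub>B\<^esub>"
  using blin_minus [OF S T, of "\<zero>\<^bsub>A\<^esub>" "\<zero>\<^bsub>A\<^esub>"] A.closed_subspace_zero [OF S] blin_closed [OF T]
  by simp

lemma blin_finsum:
  assumes S: "closed_subspace S A" and T: "blin S A B T" and f: "\<And>i. i \<in> I \<Longrightarrow> f i \<in> S"
  shows "T (finsum A f I) = finsum B (\<lambda>i. T (f i)) I"
  using f
proof (induction I rule: infinite_finite_induct)
  case (insert i I)
  have fc: "f j \<in> carrier A" "T (f j) \<in> carrier B" if "j \<in> insert i I" for j
    using insert(4) [OF that] A.closed_subspace_sub [OF S] blin_closed [OF T] by auto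
  have "finsum A f I \<in> S"
    by (rule A.closed_subspace_finsum [OF S]) (use insert in auto)
  with insert fc show ?case by (simp add: Pi_def blin_add [OF T])
qed (auto simp: A.M.finsum_infinite B.M.finsum_infinite blin_zero [OF S T])

text \<open>The device by which statements pass from a spanning set to its closed span: the elements
  satisfying the statement form a closed subspace, so \<open>closed_span_least\<close>
  applies.\<close>

lemma blin_preimage:
  assumes S: "closed_subspace S A" and T: "blin S A B T" and P: "closed_subspace P B"
  shows "closed_subspace {x \<in> S. T x \<in> P} A"
proof (rule A.closed_subspaceI)
  have Ssub: "S \<subseteq> carrier A" by (rule A.closed_subspace_sub [OF S])
  then show "{x \<in> S. T x \<in> P} \<subseteq> carrier A" by blast
  show "\<zero>\<^bsub>A\<^esub> \<in> {x \<in> S. T x \<in> P}"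
    using blin_zero [OF S T] A.closed_subspace_zero [OF S] B.closed_subspace_zero [OF P] by simp
  fix x assume x: "x \<in> carrier A" and ap: "\<And>e. 0 < e \<Longrightarrow> \<exists>y\<in>{x \<in> S. T x \<in> P}. \<parallel>x \<ominus>\<^bsub>A\<^esub> y\<parallel>\<^bsub>A\<^esub> < e"
  have xS: "x \<in> S" by (rule A.closed_subspace_approx [OF S x]) (use ap in blast)
  obtain K where K: "K > 0" "\<And>x. x \<in> S \<Longrightarrow> \<parallel>T x\<parallel>\<^bsub>B\<^esub> \<le> K * \<parallel>x\<parallel>\<^bsub>A\<^esub>"
    using blin_bound [OF T Ssub] by blast
  have "T x \<in> P"
  proof (rule B.closed_subspace_approx [OF P blin_closed [OF T xS]])
    fix e :: real assume "e > 0"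
    then obtain y where y: "y \<in> S" "T y \<in> P" "\<parallel>x \<ominus>\<^bsub>A\<^esub> y\<parallel>\<^bsub>A\<^esub> < e / K"
      using ap [of "e / K"] K by auto
    have "\<parallel>T x \<ominus>\<^bsub>B\<^esub> T y\<parallel>\<^bsub>B\<^esub> \<le> K * \<parallel>x \<ominus>\<^bsub>A\<^esub> y\<parallel>\<^bsub>A\<^esub>"
      using K(2) [of "x \<ominus>\<^bsub>A\<^esub> y"] A.closed_subspace_minus [OF S xS y(1)] blin_minus [OF S T xS y(1)] by simp
    also have "\<dots> < e" using y(3) K(1) by (simp add: field_simps)
    finally show "\<exists>z\<in>P. \<parallel>T x \<ominus>\<^bsub>B\<^esub> z\<parallel>\<^bsub>B\<^esub> < e" using y by blast
  qed
  with xS show "x \<in> {x \<in> S. T x \<in> P}" by simp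
qed (use T A.closed_subspace_add [OF S] A.closed_subspace_smult [OF S] B.closed_subspace_add [OF P]
    B.closed_subspace_smult [OF P] in \<open>auto simp: blin_add blin_smult\<close>)

text \<open>The preimage of the closed subspace \<open>{\<zero>}\<close> under the difference of the
  two maps.\<close>

lemma blin_equalizer:
  assumes S: "closed_subspace S A" and T: "blin S A B T" and U: "blin S A B U"
  shows "closed_subspace {x \<in> S. T x = U x} A"
proof -
  have Ssub: "S \<subseteq> carrier A" by (rule A.closed_subspace_sub [OF S])
  obtain K where K: "K > 0" "\<And>x. x \<in> S \<Longrightarrow> \<parallel>T x\<parallel>\<^bsub>B\<^esub> \<le> K * \<parallel>x\<parallel>\<^bsub>A\<^esub>"
    using blin_bound [OF T Ssub] by blast
  obtain L where L: "L > 0" "\<And>x. x \<in> S \<Longrightarrow> \<parallel>U x\<parallel>\<^bsub>B\<^esub> \<le> L * \<parallel>x\<parallel>\<^bsub>A\<^esub>"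
    using blin_bound [OF U Ssub] by blast
  have bd: "\<parallel>T x \<ominus>\<^bsub>B\<^esub> U x\<parallel>\<^bsub>B\<^esub> \<le> (K + L) * \<parallel>x\<parallel>\<^bsub>A\<^esub>" if "x \<in> S" for x
    using B.nrm_minus_le [OF blin_closed [OF T that] blin_closed [OF U that]] K(2) [OF that] L(2) [OF that]
    by (simp add: algebra_simps)
  have "blin S A B (\<lambda>x. T x \<ominus>\<^bsub>B\<^esub> U x)"
    unfolding blin_def using bd T U
    by (auto simp: blin_add blin_smult blin_closed B.add_minus_add B.smult_minus)
  moreover have "closed_subspace {\<zero>\<^bsub>B\<^esub>} B"
  proof (rule B.closed_subspaceI)
    fix x assume x: "x \<in> carrier B" and ap: "\<And>e. 0 < e \<Longrightarrow> \<exists>y\<in>{\<zero>\<^bsub>B\<^esub>}. \<parallel>x \<ominus>\<^bsub>B\<^esub> y\<parallel>\<^bsub>B\<^esub> < e"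
    have "\<parallel>x\<parallel>\<^bsub>B\<^esub> \<le> 0"
    proof (rule field_le_epsilon)
      show "\<parallel>x\<parallel>\<^bsub>B\<^esub> \<le> 0 + e" if "0 < e" for e
        using ap [OF that] x by simp
    qed
    then show "x \<in> {\<zero>\<^bsub>B\<^esub>}" using x B.nrm_nonneg [OF x] B.nrm_eq_zero [OF x] by simp
  qed auto
  ultimately have "closed_subspace {x \<in> S. T x \<ominus>\<^bsub>B\<^esub> U x \<in> {\<zero>\<^bsub>B\<^esub>}} A"
    by (rule blin_preimage [OF S])
  also have "{x \<in> S. T x \<ominus>\<^bsub>B\<^esub> U x \<in> {\<zero>\<^bsub>B\<^esub>}} = {x \<in> S. T x = U x}"
    using blin_closed [OF T] blin_closed [OF U] by (auto simp: B.minus_eq_zero_iff)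
  finally show ?thesis .
qed

end

section \<open>Square roots and norm estimates from the C*-identity\<close>

context cstar_algebra
begin

lemma geometric_conv:
  assumes "\<And>n. \<sigma> n \<in> carrier A" "0 \<le> r" "r < 1" "\<And>n. \<parallel>\<sigma> (Suc n) \<ominus> \<sigma> n\<parallel> \<le> r ^ n"
  shows "\<exists>l. conv \<sigma> l sequentially"
proof (rule Cauchy_conv [OF assms(1)])
  fix e :: real assume "e > 0"
  \<comment> \<open>The exact partial sum of the geometric series is kept, since the weaker bound
    \<open>r ^ n / (1 - r)\<close> would not pass through the induction on \<open>k\<close>.\<close>
  have diff: "\<parallel>\<sigma> (n + k) \<ominus> \<sigma> n\<parallel> \<le> (r ^ n - r ^ (n + k)) / (1 - r)" for n k
  proof (induction k)
    case (Suc k)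
    have "\<parallel>\<sigma> (n + Suc k) \<ominus> \<sigma> n\<parallel> \<le> \<parallel>\<sigma> (Suc (n + k)) \<ominus> \<sigma> (n + k)\<parallel> + \<parallel>\<sigma> (n + k) \<ominus> \<sigma> n\<parallel>"
      using nrm_minus_triangle assms(1) by simp
    also have "\<dots> \<le> r ^ (n + k) + (r ^ n - r ^ (n + k)) / (1 - r)"
      using Suc assms(4) by (intro add_mono) auto
    also have "\<dots> = (r ^ n - r ^ (n + Suc k)) / (1 - r)"
      using assms(3) by (simp add: field_simps)
    finally show ?case .
  qed (use assms(1) in simp)
  have diff2: "\<parallel>\<sigma> m \<ominus> \<sigma> n\<parallel> \<le> r ^ n / (1 - r)" if "m \<ge> n" for m n
  proof -
    have "\<parallel>\<sigma> m \<ominus> \<sigma> n\<parallel> \<le> (r ^ n - r ^ m) / (1 - r)" using diff [of n "m - n"] that by simp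
    also have "\<dots> \<le> r ^ n / (1 - r)" using assms by (intro divide_right_mono) auto
    finally show ?thesis .
  qed
  have "(\<lambda>n. r ^ n / (1 - r)) \<longlonglongrightarrow> 0 / (1 - r)"
    by (intro tendsto_divide tendsto_const LIMSEQ_realpow_zero) (use assms in auto)
  then have "eventually (\<lambda>n. r ^ n / (1 - r) < e / 2) sequentially"
    using \<open>e > 0\<close> by (intro order_tendstoD(2)) auto
  then obtain N where N: "r ^ N / (1 - r) < e / 2" by (auto simp: eventually_sequentially)
  have "\<parallel>\<sigma> m \<ominus> \<sigma> n\<parallel> < e" if "m \<ge> N" "n \<ge> N" for m n
  proof -
    have "\<parallel>\<sigma> m \<ominus> \<sigma> n\<parallel> \<le> \<parallel>\<sigma> m \<ominus> \<sigma> N\<parallel> + \<parallel>\<sigma> N \<ominus> \<sigma> n\<parallel>"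
      using nrm_minus_triangle assms(1) by simp
    also have "\<dots> < e"
      using diff2 [OF that(1)] diff2 [OF that(2)] N
      unfolding nrm_minus_commute [OF assms(1) assms(1), of N n] by linarith
    finally show ?thesis .
  qed
  then show "\<exists>N. \<forall>m\<ge>N. \<forall>n\<ge>N. \<parallel>\<sigma> m \<ominus> \<sigma> n\<parallel> < e" by blast
qed

lemma
  assumes "cstar_subalgebra S A"
  shows cstar_subalgebra_subspace: "closed_subspace S A"
    and cstar_subalgebra_mult: "x \<in> S \<Longrightarrow> y \<in> S \<Longrightarrow> x \<otimes> y \<in> S"
    and cstar_subalgebra_adj: "x \<in> S \<Longrightarrow> x\<^sup>\<star> \<in> S"
  using assms by (simp_all add: cstar_subalgebra_def)

lemma half_double: "x \<in> carrier A \<Longrightarrow> (1/2) \<odot> x \<oplus> (1/2) \<odot> x = x"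
  by (simp add: smult_add_left [symmetric])

text \<open>With a unit adjoined, the equation for \<open>x\<close> says \<open>(1 - x)\<^sup>2 = 1 - a\<close>.\<close>

lemma square_root:
  assumes a: "a \<in> carrier A" "a\<^sup>\<star> = a" "\<parallel>a\<parallel> < 1"
  obtains x where "x \<in> carrier A" "x\<^sup>\<star> = x" "x \<oplus> x = a \<oplus> x \<otimes> x"
    "\<And>S. cstar_subalgebra S A \<Longrightarrow> a \<in> S \<Longrightarrow> x \<in> S"
proof -
  \<comment> \<open>The smaller root of
    \<open>r = (\<parallel>a\<parallel> + r\<^sup>2) / 2\<close>, the scalar form of the equation
    for \<open>x\<close>. The iteration below therefore preserves the ball of radius
    \<open>r\<close>, and contracts there with factor \<open>r < 1\<close>.\<close>
  define r where "r = 1 - sqrt (1 - \<parallel>a\<parallel>)"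
  have s: "sqrt (1 - \<parallel>a\<parallel>) > 0" "sqrt (1 - \<parallel>a\<parallel>) \<le> 1" "sqrt (1 - \<parallel>a\<parallel>) ^ 2 = 1 - \<parallel>a\<parallel>"
    using a by simp_all
  then have r: "0 \<le> r" "r < 1" by (simp_all add: r_def)
  have r2: "(\<parallel>a\<parallel> + r * r) / 2 = r" using s(3) unfolding r_def by (simp only: power2_eq_square algebra_simps) (simp add: field_simps)
  \<comment> \<open>Fixed-point iteration for \<open>x = (a + x x) / 2\<close>, started at
    zero.\<close>
  define \<sigma> where "\<sigma> = rec_nat \<zero> (\<lambda>_ x. (1/2) \<odot> (a \<oplus> x \<otimes> x))"
  have \<sigma>0: "\<sigma> 0 = \<zero>" and \<sigma>S: "\<sigma> (Suc n) = (1/2) \<odot> (a \<oplus> \<sigma> n \<otimes> \<sigma> n)" for n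
    by (simp_all add: \<sigma>_def)
  have c: "\<sigma> n \<in> carrier A" for n by (induction n) (simp_all add: \<sigma>0 \<sigma>S a)
  have b: "\<parallel>\<sigma> n\<parallel> \<le> r" for n
  proof (induction n)
    case (Suc n)
    have "\<parallel>\<sigma> (Suc n)\<parallel> = \<parallel>a \<oplus> \<sigma> n \<otimes> \<sigma> n\<parallel> / 2" using c a by (simp add: \<sigma>S nrm_smult)
    also have "\<dots> \<le> (\<parallel>a\<parallel> + \<parallel>\<sigma> n\<parallel> * \<parallel>\<sigma> n\<parallel>) / 2"
      using nrm_triangle [of a "\<sigma> n \<otimes> \<sigma> n"] nrm_mult [of "\<sigma> n" "\<sigma> n"] c [of n] a by simp
    also have "\<dots> \<le> (\<parallel>a\<parallel> + r * r) / 2"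
      using Suc r c [of n] by (intro divide_right_mono add_left_mono mult_mono) auto
    finally show ?case using r2 by simp
  qed (simp add: \<sigma>0 r)
  have step: "\<parallel>\<sigma> (Suc n) \<ominus> \<sigma> n\<parallel> \<le> r ^ n" for n
  proof (induction n)
    case 0
    show ?case using a by (simp add: \<sigma>0 \<sigma>S nrm_smult)
  next
    case (Suc n)
    let ?x = "\<sigma> (Suc n)" and ?y = "\<sigma> n"
    have xy: "?x \<in> carrier A" "?y \<in> carrier A" by (rule c)+
    have "\<sigma> (Suc (Suc n)) \<ominus> \<sigma> (Suc n) = (1/2) \<odot> (a \<oplus> ?x \<otimes> ?x \<ominus> (a \<oplus> ?y \<otimes> ?y))"
      unfolding \<sigma>S [of "Suc n"] by (subst (3) \<sigma>S) (simp add: smult_minus a xy)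
    also have "a \<oplus> ?x \<otimes> ?x \<ominus> (a \<oplus> ?y \<otimes> ?y) = ?x \<otimes> ?x \<ominus> ?y \<otimes> ?y"
      using xy a by (simp add: add_minus_add)
    \<comment> \<open>This form of the difference of two squares does not need the iterates to
      commute.\<close>
    also have "\<dots> = (?x \<ominus> ?y) \<otimes> ?x \<oplus> ?y \<otimes> (?x \<ominus> ?y)"
      using xy by (simp add: mult_minus_left mult_minus_right minus_chain)
    finally have "\<parallel>\<sigma> (Suc (Suc n)) \<ominus> \<sigma> (Suc n)\<parallel> = \<parallel>(?x \<ominus> ?y) \<otimes> ?x \<oplus> ?y \<otimes> (?x \<ominus> ?y)\<parallel> / 2"
      using xy by (simp add: nrm_smult)
    also have "\<dots> \<le> (\<parallel>?x \<ominus> ?y\<parallel> * \<parallel>?x\<parallel> + \<parallel>?y\<parallel> * \<parallel>?x \<ominus> ?y\<parallel>) / 2"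
      using xy nrm_triangle [of "(?x \<ominus> ?y) \<otimes> ?x" "?y \<otimes> (?x \<ominus> ?y)"] nrm_mult [of "?x \<ominus> ?y" ?x]
        nrm_mult [of ?y "?x \<ominus> ?y"] by simp
    also have "\<dots> \<le> (\<parallel>?x \<ominus> ?y\<parallel> * r + r * \<parallel>?x \<ominus> ?y\<parallel>) / 2"
      using xy by (intro divide_right_mono add_mono mult_mono b r) auto
    also have "\<dots> = r * \<parallel>?x \<ominus> ?y\<parallel>" by simp
    also have "\<dots> \<le> r * r ^ n" by (rule mult_left_mono [OF Suc r(1)])
    finally show ?case by simp
  qed
  obtain x where x: "conv \<sigma> x sequentially"
    using geometric_conv [of \<sigma> r, OF c r step] by blast
  have xc: "x \<in> carrier A" by (rule conv_carrier [OF x])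
  have "conv (\<lambda>n. (\<sigma> n)\<^sup>\<star>) (x\<^sup>\<star>) sequentially" by (rule conv_adj [OF x])
  moreover have "(\<sigma> n)\<^sup>\<star> = \<sigma> n" for n
    by (induction n) (simp_all add: \<sigma>0 \<sigma>S a c adj_add adj_mult adj_smult)
  ultimately have "x\<^sup>\<star> = x" using conv_unique x by fastforce
  moreover have "x \<oplus> x = a \<oplus> x \<otimes> x"
  proof (rule conv_unique)
    have "conv (\<lambda>n. \<sigma> (Suc n)) x sequentially"
      using x unfolding conv_def by (simp add: filterlim_sequentially_Suc [of "\<lambda>i. \<parallel>\<sigma> i \<ominus> x\<parallel>"] c)
    from conv_add [OF this this] show "conv (\<lambda>n. a \<oplus> \<sigma> n \<otimes> \<sigma> n) (x \<oplus> x) sequentially"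
      by (simp add: \<sigma>S half_double a c)
    show "conv (\<lambda>n. a \<oplus> \<sigma> n \<otimes> \<sigma> n) (a \<oplus> x \<otimes> x) sequentially"
      by (intro conv_add conv_mult x conv_eventually_const) (auto simp: a)
  qed simp
  \<comment> \<open>The iterates are polynomials in \<open>a\<close> without constant term. Applied
    to a commutant this clause yields commutation relations, applied to the domain of a homomorphism
    it keeps \<open>x\<close> inside that domain.\<close>
  moreover have "x \<in> S" if S: "cstar_subalgebra S A" "a \<in> S" for S
  proof (rule closed_subspace_conv [OF cstar_subalgebra_subspace [OF S(1)] x])
    note cs = cstar_subalgebra_subspace [OF S(1)]
    have "\<sigma> n \<in> S" for n
      by (induction n) (auto simp: \<sigma>0 \<sigma>S intro: closed_subspace_zero [OF cs] S
          closed_subspace_smult [OF cs] closed_subspace_add [OF cs] cstar_subalgebra_mult [OF S(1)])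
    then show "eventually (\<lambda>n. \<sigma> n \<in> S) sequentially" by simp
  qed simp
  ultimately show thesis using that xc by blast
qed

text \<open>Both \<open>(a \<plusminus> \<i>b)\<^sup>* (a \<plusminus> \<i>b)\<close> equal \<open>a\<^sup>* a + b\<^sup>* b\<close>, and \<open>a\<close> is the mean of \<open>a \<plusminus> \<i>b\<close>.\<close>

lemma nrm_sq_le_sum:
  assumes ab: "a \<in> carrier A" "b \<in> carrier A" and eq: "a\<^sup>\<star> \<otimes> b = b\<^sup>\<star> \<otimes> a"
  shows "\<parallel>a\<parallel>\<^sup>2 \<le> \<parallel>a\<^sup>\<star> \<otimes> a \<oplus> b\<^sup>\<star> \<otimes> b\<parallel>"
proof -
  define N where "N = \<parallel>a\<^sup>\<star> \<otimes> a \<oplus> b\<^sup>\<star> \<otimes> b\<parallel>"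
  have u: "\<parallel>a \<oplus> c \<odot> b\<parallel>\<^sup>2 = N" if c: "c = \<i> \<or> c = - \<i>" for c
  proof -
    have cc: "cnj c = - c" "c * c = - 1" using c by auto
    let ?z = "b\<^sup>\<star> \<otimes> a"
    have "(a \<oplus> c \<odot> b)\<^sup>\<star> = a\<^sup>\<star> \<oplus> (-c) \<odot> b\<^sup>\<star>"
      using ab cc by (simp add: adj_add adj_smult)
    then have "(a \<oplus> c \<odot> b)\<^sup>\<star> \<otimes> (a \<oplus> c \<odot> b)
        = (a\<^sup>\<star> \<oplus> (-c) \<odot> b\<^sup>\<star>) \<otimes> a \<oplus> (a\<^sup>\<star> \<oplus> (-c) \<odot> b\<^sup>\<star>) \<otimes> (c \<odot> b)"
      using ab by (simp add: mult_distrib_left)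
    also have "\<dots> = (a\<^sup>\<star> \<otimes> a \<oplus> (-c) \<odot> ?z) \<oplus> (c \<odot> ?z \<oplus> b\<^sup>\<star> \<otimes> b)"
      using ab cc by (simp add: mult_distrib_right smult_add_right smult_mult_left smult_mult_right eq)
    also have "\<dots> = a\<^sup>\<star> \<otimes> a \<oplus> b\<^sup>\<star> \<otimes> b"
      using ab by (simp add: smult_minus_left M.a_assoc M.r_neg1)
    finally show ?thesis using ab by (simp add: cstar_identity [symmetric] N_def)
  qed
  have "a \<oplus> a = (a \<oplus> \<i> \<odot> b) \<oplus> (a \<oplus> (-\<i>) \<odot> b)"
    using ab by (simp add: smult_minus_left M.a_ac M.r_neg M.r_neg1 M.r_neg2)
  then have "\<parallel>2 \<odot> a\<parallel> \<le> \<parallel>a \<oplus> \<i> \<odot> b\<parallel> + \<parallel>a \<oplus> (-\<i>) \<odot> b\<parallel>"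
    using nrm_triangle [of "a \<oplus> \<i> \<odot> b" "a \<oplus> (-\<i>) \<odot> b"] ab smult_add_left [of a 1 1] by simp
  moreover have "\<parallel>a \<oplus> \<i> \<odot> b\<parallel> = sqrt N" "\<parallel>a \<oplus> (-\<i>) \<odot> b\<parallel> = sqrt N"
    using u [of \<i>] u [of "-\<i>"] ab by (auto intro!: real_sqrt_unique [symmetric])
  ultimately have "\<parallel>a\<parallel> \<le> sqrt N" using ab by (simp add: nrm_smult)
  then have "\<parallel>a\<parallel>\<^sup>2 \<le> (sqrt N)\<^sup>2" using ab by (intro power_mono) auto
  also have "\<dots> = N" using ab by (simp add: N_def)
  finally show ?thesis by (simp add: N_def)
qed

end

section \<open>Positivity in corners and orthogonality of projections\<close>

context cstar_algebra
begin

lemma closed_subspace_Int: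
  "closed_subspace S A \<Longrightarrow> closed_subspace T A \<Longrightarrow> closed_subspace (S \<inter> T) A"
  using closed_subspace_Inter [of "{S, T}"] by auto

lemma two_cstar_self: "two_cstar A A"
  by (intro two_cstar.intro cstar_algebra_axioms)

lemma blin_mult_right: "b \<in> carrier A \<Longrightarrow> blin (carrier A) A A (\<lambda>x. x \<otimes> b)"
  unfolding blin_def using nrm_mult
  by (auto simp: mult_distrib_right smult_mult_left mult.commute [of "\<parallel>b\<parallel>"] intro!: exI [of _ "\<parallel>b\<parallel>"]) 

lemma blin_mult_left: "b \<in> carrier A \<Longrightarrow> blin (carrier A) A A (\<lambda>x. b \<otimes> x)"
  unfolding blin_def using nrm_mult
  by (auto simp: mult_distrib_left smult_mult_right intro!: exI [of _ "\<parallel>b\<parallel>"]) 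

lemma blin_id: "S \<subseteq> carrier A \<Longrightarrow> blin S A A (\<lambda>x. x)"
  unfolding blin_def by (auto intro!: exI [of _ 1])

text \<open>Taking adjoints in \<open>x b = b x\<close> returns a relation with the same
  \<open>b\<close> because \<open>b\<close> is self-adjoint. Together with the last clause of
  \<open>square_root\<close> this shows that the root commutes with every self-adjoint element
  commuting with \<open>a\<close>.\<close>

lemma commutant_subalgebra:
  assumes b: "b \<in> carrier A" "b\<^sup>\<star> = b"
  shows "cstar_subalgebra {x \<in> carrier A. x \<otimes> b = b \<otimes> x} A"
  unfolding cstar_subalgebra_def
proof (intro conjI ballI)
  interpret two_cstar A A by (rule two_cstar_self)
  show "closed_subspace {x \<in> carrier A. x \<otimes> b = b \<otimes> x} A"
    by (rule blin_equalizer) (auto intro: closed_subspace_carrier blin_mult_left blin_mult_right b)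
next
  fix x y assume "x \<in> {x \<in> carrier A. x \<otimes> b = b \<otimes> x}" "y \<in> {x \<in> carrier A. x \<otimes> b = b \<otimes> x}"
  then show "x \<otimes> y \<in> {x \<in> carrier A. x \<otimes> b = b \<otimes> x}"
    using b by simp (metis mult_assoc)
next
  fix x assume "x \<in> {x \<in> carrier A. x \<otimes> b = b \<otimes> x}"
  then show "x\<^sup>\<star> \<in> {x \<in> carrier A. x \<otimes> b = b \<otimes> x}"
    using b by simp (metis adj_mult)
qed

lemma nrm_square: "x \<in> carrier A \<Longrightarrow> x\<^sup>\<star> = x \<Longrightarrow> \<parallel>x \<otimes> x\<parallel> = \<parallel>x\<parallel>\<^sup>2"
  using cstar_identity [of x] by simp

text \<open>With a unit adjoined, the hypotheses make \<open>h + \<i>(1 - k)\<close> a unitary with real part \<open>h\<close>. Multiplying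
  by \<open>h\<close> on the right avoids the unit.\<close>

lemma nrm_le_one_of_pythagoras:
  assumes h: "h \<in> carrier A" "h\<^sup>\<star> = h" and k: "k \<in> carrier A" "k\<^sup>\<star> = k"
    and hk: "h \<otimes> k = k \<otimes> h" and eq: "k \<oplus> k = h \<otimes> h \<oplus> k \<otimes> k"
  shows "\<parallel>h\<parallel> \<le> 1"
proof -
  \<comment> \<open>The words \<open>hhhh\<close>, \<open>hkkh\<close>, \<open>hkh\<close> and
    \<open>hh\<close>. Multiplying the hypothesis by \<open>h\<close> on both sides gives
    \<open>2R = P + Q\<close>. With \<open>a = hh\<close> and \<open>b = h - kh\<close> one gets
    \<open>a\<^sup>\<star> a + b\<^sup>\<star> b = P + Y - 2R + Q = Y\<close>, so
    \<open>nrm_sq_le_sum\<close> reads \<open>\<parallel>h\<parallel>\<^sup>4 \<le>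
    \<parallel>h\<parallel>\<^sup>2\<close>.\<close>
  define P Q R Y where "P = h \<otimes> (h \<otimes> (h \<otimes> h))" and "Q = h \<otimes> (k \<otimes> (k \<otimes> h))" and "R = h \<otimes> (k \<otimes> h)" and "Y = h \<otimes> h"
  have c: "P \<in> carrier A" "Q \<in> carrier A" "R \<in> carrier A" "Y \<in> carrier A"
    using h k by (simp_all add: P_def Q_def R_def Y_def)
  have "h \<otimes> ((k \<oplus> k) \<otimes> h) = h \<otimes> ((h \<otimes> h \<oplus> k \<otimes> k) \<otimes> h)" by (simp add: eq)
  then have RR: "R \<oplus> R = P \<oplus> Q"
    using h k by (simp add: P_def Q_def R_def mult_distrib_left mult_distrib_right mult_assoc)
  let ?a = "h \<otimes> h" and ?b = "h \<ominus> k \<otimes> h"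
  have bs: "?b\<^sup>\<star> = h \<ominus> h \<otimes> k" using h k by (simp add: adj_minus adj_mult)
  have cross: "h \<otimes> h \<otimes> (k \<otimes> h) = h \<otimes> k \<otimes> (h \<otimes> h)"
    using h k hk by (metis mult_assoc mult_closed)
  have "\<parallel>?a\<parallel>\<^sup>2 \<le> \<parallel>?a\<^sup>\<star> \<otimes> ?a \<oplus> ?b\<^sup>\<star> \<otimes> ?b\<parallel>"
    by (rule nrm_sq_le_sum)
      (use h k cross in \<open>auto simp: bs adj_mult mult_minus_left mult_minus_right mult_assoc\<close>)
  also have "?a\<^sup>\<star> \<otimes> ?a \<oplus> ?b\<^sup>\<star> \<otimes> ?b = P \<oplus> ((Y \<ominus> R) \<ominus> (R \<ominus> Q))"
    unfolding bs using h k by (simp add: P_def Q_def R_def Y_def mult_minus_left mult_minus_right mult_assoc adj_mult)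
  also have "\<dots> = P \<oplus> (Y \<oplus> (\<ominus> (R \<oplus> R) \<oplus> Q))"
    using c by (simp add: M.minus_eq M.minus_add M.a_assoc)
  also have "\<dots> = P \<oplus> (Y \<oplus> \<ominus> P)"
    using c by (simp add: RR M.minus_add M.a_assoc M.l_neg)
  also have "\<dots> = Y"
    using c by (simp add: M.a_lcomm [of P Y] M.r_neg)
  finally have "(\<parallel>h\<parallel>\<^sup>2)\<^sup>2 \<le> \<parallel>h\<parallel>\<^sup>2" using h by (simp add: Y_def nrm_square)
  then have "\<parallel>h\<parallel>\<^sup>2 \<le> 1\<^sup>2" by (smt (verit) power2_eq_square mult_le_cancel_left2 zero_le_power2 one_power2 mult_right_le_one_le)
  then show ?thesis using abs_le_square_iff [of "\<parallel>h\<parallel>" 1] h by simp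
qed

lemma projectionD: "projection A q \<Longrightarrow> q \<in> carrier A \<and> q \<otimes> q = q \<and> q\<^sup>\<star> = q"
  by (simp add: projection_def)

lemma nrm_projection_le: "projection A q \<Longrightarrow> \<parallel>q\<parallel> \<le> 1"
proof -
  assume "projection A q"
  then have "\<parallel>q\<parallel>\<^sup>2 = \<parallel>q\<parallel>" "0 \<le> \<parallel>q\<parallel>" using cstar_identity [of q] by (auto dest: projectionD)
  then show ?thesis by (cases "\<parallel>q\<parallel> = 0") (simp_all add: power2_eq_square)
qed

lemma nrm_smult_projection_le: "projection A q \<Longrightarrow> 0 \<le> r \<Longrightarrow> \<parallel>complex_of_real r \<odot> q\<parallel> \<le> r"
  using nrm_projection_le [of q] projectionD [of q]
  by (simp add: nrm_smult mult_left_le)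

text \<open>Here \<open>y\<close> plays the role of the unit: \<open>l = y - x\<close> for the
  solution \<open>x\<close> of \<open>square_root\<close>, so that
  \<open>l l = y - (x + x) + x x = y - a\<close>.\<close>

lemma square_root_corner:
  assumes y: "projection A y" and a: "a \<in> carrier A" "a\<^sup>\<star> = a" "y \<otimes> a = a" "\<parallel>a\<parallel> < 1"
  obtains l where "l \<in> carrier A" "l\<^sup>\<star> = l" "l \<otimes> l = y \<ominus> a"
    "\<And>b. \<lbrakk>b \<in> carrier A; b\<^sup>\<star> = b; a \<otimes> b = b \<otimes> a; y \<otimes> b = b \<otimes> y\<rbrakk> \<Longrightarrow> l \<otimes> b = b \<otimes> l"
    "y \<otimes> l = l" "l \<otimes> y = l"
proof -
  note yp = projectionD [OF y]
  obtain x where x: "x \<in> carrier A" "x\<^sup>\<star> = x" "x \<oplus> x = a \<oplus> x \<otimes> x"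
    and xS: "\<And>S. cstar_subalgebra S A \<Longrightarrow> a \<in> S \<Longrightarrow> x \<in> S"
    using square_root [OF a(1,2,4)] by blast
  have com: "x \<otimes> b = b \<otimes> x" if "b \<in> carrier A" "b\<^sup>\<star> = b" "a \<otimes> b = b \<otimes> a" for b
    using xS [OF commutant_subalgebra [OF that(1,2)]] a(1) that(3) by simp
  have ay: "a \<otimes> y = a" using a yp by (metis adj_mult)
  \<comment> \<open>The elements for which \<open>y\<close> is a two-sided unit form a
    C*-subalgebra; it contains \<open>a\<close> and hence \<open>x\<close>.\<close>
  have "cstar_subalgebra {x \<in> carrier A. y \<otimes> x = x \<and> x \<otimes> y = x} A"
    unfolding cstar_subalgebra_def
  proof (intro conjI ballI)
    interpret two_cstar A A by (rule two_cstar_self)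
    have cs: "closed_subspace {x \<in> carrier A. y \<otimes> x = x} A" "closed_subspace {x \<in> carrier A. x \<otimes> y = x} A"
      using yp by (auto intro!: blin_equalizer closed_subspace_carrier blin_mult_left blin_mult_right blin_id)
    have eq: "{x \<in> carrier A. y \<otimes> x = x \<and> x \<otimes> y = x}
        = {x \<in> carrier A. y \<otimes> x = x} \<inter> {x \<in> carrier A. x \<otimes> y = x}"
      by auto
    show "closed_subspace {x \<in> carrier A. y \<otimes> x = x \<and> x \<otimes> y = x} A"
      unfolding eq by (rule closed_subspace_Int [OF cs])
  next
    fix x z assume "x \<in> {x \<in> carrier A. y \<otimes> x = x \<and> x \<otimes> y = x}" "z \<in> {x \<in> carrier A. y \<otimes> x = x \<and> x \<otimes> y = x}"
    then show "x \<otimes> z \<in> {x \<in> carrier A. y \<otimes> x = x \<and> x \<otimes> y = x}"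
      using yp by simp (metis mult_assoc)
  next
    fix x assume "x \<in> {x \<in> carrier A. y \<otimes> x = x \<and> x \<otimes> y = x}"
    then show "x\<^sup>\<star> \<in> {x \<in> carrier A. y \<otimes> x = x \<and> x \<otimes> y = x}"
      using yp by simp (metis adj_mult)
  qed
  from xS [OF this] have xy: "y \<otimes> x = x" "x \<otimes> y = x" using a ay by simp_all
  define l where "l = y \<ominus> x"
  have "l \<otimes> l = (y \<ominus> x) \<ominus> (x \<ominus> x \<otimes> x)"
    unfolding l_def using x(1) yp xy by (simp add: mult_minus_left mult_minus_right)
  also have "\<dots> = y \<oplus> (\<ominus> (x \<oplus> x) \<oplus> x \<otimes> x)"
    using x(1) yp by (simp add: M.minus_eq M.minus_add M.a_assoc)
  also have "\<dots> = y \<ominus> a"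
    unfolding x(3) using x(1) a yp by (simp add: M.minus_eq M.minus_add M.a_assoc M.l_neg)
  finally have "l \<otimes> l = y \<ominus> a" .
  moreover have "l \<otimes> b = b \<otimes> l" if "b \<in> carrier A" "b\<^sup>\<star> = b" "a \<otimes> b = b \<otimes> a" "y \<otimes> b = b \<otimes> y" for b
    using com [OF that(1-3)] that x yp by (simp add: l_def mult_minus_left mult_minus_right)
  ultimately show thesis
    using that [of l] x yp xy by (simp add: l_def adj_minus mult_minus_left mult_minus_right)
qed

text \<open>Positivity in the corner of a projection \<open>y\<close>, expressed by the norm alone.\<close>

definition corner_positive :: "'a \<Rightarrow> 'a \<Rightarrow> bool" where
  "corner_positive y z \<longleftrightarrow> z \<in> carrier A \<and> z\<^sup>\<star> = z \<and> y \<otimes> z = z \<and>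
    (\<exists>c\<ge>0. \<parallel>z \<ominus> complex_of_real c \<odot> y\<parallel> \<le> c)"

text \<open>In the norm form of positivity the constants simply add, by the triangle inequality; no
  square roots are involved.\<close>

lemma corner_positive_add:
  assumes y: "projection A y" and "corner_positive y z" "corner_positive y w"
  shows "corner_positive y (z \<oplus> w)"
proof -
  note yp = projectionD [OF y]
  obtain c d where z: "z \<in> carrier A" "z\<^sup>\<star> = z" "y \<otimes> z = z" "c \<ge> 0" "\<parallel>z \<ominus> complex_of_real c \<odot> y\<parallel> \<le> c"
    and w: "w \<in> carrier A" "w\<^sup>\<star> = w" "y \<otimes> w = w" "d \<ge> 0" "\<parallel>w \<ominus> complex_of_real d \<odot> y\<parallel> \<le> d"
    using assms unfolding corner_positive_def by blast
  have "z \<oplus> w \<ominus> complex_of_real (c + d) \<odot> y = (z \<ominus> complex_of_real c \<odot> y) \<oplus> (w \<ominus> complex_of_real d \<odot> y)"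
    using z w yp by (simp add: smult_add_left add_minus_add)
  then have "\<parallel>z \<oplus> w \<ominus> complex_of_real (c + d) \<odot> y\<parallel> \<le> c + d"
    using z w yp nrm_triangle [of "z \<ominus> complex_of_real c \<odot> y" "w \<ominus> complex_of_real d \<odot> y"] by simp
  with z w show ?thesis
    unfolding corner_positive_def using yp
    by (auto simp: adj_add mult_distrib_left intro!: exI [of _ "c + d"])
qed

lemma corner_positive_finsum:
  assumes y: "projection A y"
  shows "(\<And>i. i \<in> I \<Longrightarrow> corner_positive y (f i)) \<Longrightarrow> corner_positive y (finsum A f I)"
proof (induction I rule: infinite_finite_induct)
  case (insert i I)
  have "f j \<in> carrier A" if "j \<in> insert i I" for j using insert(4) [OF that] by (simp add: corner_positive_def)
  then have "finsum A f (insert i I) = f i \<oplus> finsum A f I"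
    using insert(1,2) by (intro M.finsum_insert) auto
  then show ?case using corner_positive_add [OF y] insert by simp
qed (use projectionD [OF y] in \<open>auto simp: M.finsum_infinite corner_positive_def intro!: exI [of _ 0]\<close>)

text \<open>Changing the constant moves the element by at most \<open>d - c\<close>, as a projection
  has norm at most 1. It allows one constant to serve both \<open>z\<close> and its
  negative.\<close>

lemma corner_positive_bound_mono:
  assumes y: "projection A y" and z: "z \<in> carrier A" "\<parallel>z \<ominus> complex_of_real c \<odot> y\<parallel> \<le> c" and "c \<le> d"
  shows "\<parallel>z \<ominus> complex_of_real d \<odot> y\<parallel> \<le> d"
proof -
  note yp = projectionD [OF y]
  have "\<parallel>z \<ominus> complex_of_real d \<odot> y\<parallel> \<le> \<parallel>z \<ominus> complex_of_real c \<odot> y\<parallel> +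
      \<parallel>complex_of_real c \<odot> y \<ominus> complex_of_real d \<odot> y\<parallel>"
    using yp z by (intro nrm_minus_triangle) auto
  also have "complex_of_real c \<odot> y \<ominus> complex_of_real d \<odot> y = complex_of_real (c - d) \<odot> y"
    using yp by (simp add: smult_diff_left)
  also have "\<parallel>complex_of_real (c - d) \<odot> y\<parallel> = (d - c) * \<parallel>y\<parallel>"
    using yp assms(4) by (simp add: nrm_smult del: of_real_diff)
  also have "\<dots> \<le> d - c" using nrm_projection_le [OF y] assms(4) by (simp add: mult_left_le)
  finally show ?thesis using z(2) by linarith
qed

text \<open>For \<open>\<epsilon> > 0\<close> both \<open>\<epsilon>y - z\<close> and \<open>\<epsilon>y + z\<close> are positive multiples of squares of commuting
  self-adjoint elements, and they add up to \<open>2\<epsilon>y\<close>; so \<open>\<epsilon>y - z\<close> has norm at most \<open>2\<epsilon>\<close>.\<close>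

lemma corner_positive_antisym:
  assumes y: "projection A y" and "corner_positive y z" "corner_positive y (\<ominus> z)"
  shows "z = \<zero>"
proof -
  note yp = projectionD [OF y]
  obtain c1 c2 where z: "z \<in> carrier A" "z\<^sup>\<star> = z" "y \<otimes> z = z" "c1 \<ge> 0" "\<parallel>z \<ominus> complex_of_real c1 \<odot> y\<parallel> \<le> c1"
    and mz: "c2 \<ge> 0" "\<parallel>\<ominus> z \<ominus> complex_of_real c2 \<odot> y\<parallel> \<le> c2"
    using assms unfolding corner_positive_def by blast
  \<comment> \<open>The maximum with 1 makes \<open>c\<close> positive as well as common to
    \<open>z\<close> and \<open>\<ominus> z\<close>.\<close>
  define c where "c = max 1 (max c1 c2)"
  have c: "c > 0" "\<parallel>z \<ominus> complex_of_real c \<odot> y\<parallel> \<le> c" "\<parallel>\<ominus> z \<ominus> complex_of_real c \<odot> y\<parallel> \<le> c"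
    using corner_positive_bound_mono [OF y z(1,5), of c] corner_positive_bound_mono [OF y _ mz(2), of c] z(1)
    by (auto simp: c_def)
  have zy: "z \<otimes> y = z" using z yp by (metis adj_mult)
  have "\<parallel>z\<parallel> \<le> 0 + e'" if "e' > 0" for e'
  proof -
    \<comment> \<open>A third, because the end of the argument bounds
      \<open>\<parallel>z\<parallel>\<close> by \<open>\<parallel>e y\<parallel> + \<parallel>z - e
      y\<parallel> \<le> e + 2e\<close>.\<close>
    define e where "e = e' / 3"
    have e: "e > 0" using that by (simp add: e_def)
    define s where "s = complex_of_real (1 / (c + e))"
    \<comment> \<open>The scaling gives \<open>a1\<close> and \<open>a2\<close> norm at most
      \<open>c / (c + e) < 1\<close>, while \<open>y - a1\<close> and \<open>y - a2\<close> are
      \<open>e y - z\<close> and \<open>e y + z\<close> divided by \<open>c + e\<close>. Both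
      therefore have square roots in the corner.\<close>
    define a1 where "a1 = s \<odot> (complex_of_real c \<odot> y \<oplus> z)"
    define a2 where "a2 = s \<odot> (complex_of_real c \<odot> y \<ominus> z)"
    have a1c: "a1 \<in> carrier A" "a1\<^sup>\<star> = a1" "y \<otimes> a1 = a1" 
      using z yp by (simp_all add: a1_def s_def adj_smult adj_add mult_distrib_left smult_mult_right)
    have a2c: "a2 \<in> carrier A" "a2\<^sup>\<star> = a2" "y \<otimes> a2 = a2" 
      using z yp by (simp_all add: a2_def s_def adj_smult adj_minus mult_minus_right smult_mult_right)
    have n1: "\<parallel>complex_of_real c \<odot> y \<oplus> z\<parallel> \<le> c"
    proof -
      have "\<ominus> z \<ominus> complex_of_real c \<odot> y = \<ominus> (complex_of_real c \<odot> y \<oplus> z)"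
        using z yp by (simp add: M.minus_eq M.minus_add M.a_comm)
      then show ?thesis using c(3) z yp by simp
    qed
    have n2: "\<parallel>complex_of_real c \<odot> y \<ominus> z\<parallel> \<le> c"
      using c(2) nrm_minus_commute [of z "complex_of_real c \<odot> y"] z yp by simp
    have cs: "cmod s = 1 / (c + e)" unfolding s_def norm_of_real using c e by simp
    have b: "\<parallel>a1\<parallel> < 1" "\<parallel>a2\<parallel> < 1"
      using z yp c e n1 n2
      by (auto simp: a1_def a2_def cs nrm_smult)
    obtain l where l: "l \<in> carrier A" "l\<^sup>\<star> = l" "l \<otimes> l = y \<ominus> a1" "y \<otimes> l = l" "l \<otimes> y = l"
      and lcom: "\<And>b. \<lbrakk>b \<in> carrier A; b\<^sup>\<star> = b; a1 \<otimes> b = b \<otimes> a1; y \<otimes> b = b \<otimes> y\<rbrakk> \<Longrightarrow> l \<otimes> b = b \<otimes> l"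
      using square_root_corner [OF y a1c b(1)] by metis
    obtain k where k: "k \<in> carrier A" "k\<^sup>\<star> = k" "k \<otimes> k = y \<ominus> a2"
      and kcom: "\<And>b. \<lbrakk>b \<in> carrier A; b\<^sup>\<star> = b; a2 \<otimes> b = b \<otimes> a2; y \<otimes> b = b \<otimes> y\<rbrakk> \<Longrightarrow> k \<otimes> b = b \<otimes> k"
      using square_root_corner [OF y a2c b(2)] by metis
    have ay: "a1 \<otimes> y = a1" "a2 \<otimes> y = a2" using a1c a2c yp by (metis adj_mult)+
    have "a1 \<otimes> a2 = a2 \<otimes> a1"
      using z(1-3) yp zy unfolding a1_def a2_def
      by (simp add: mult_distrib_left mult_distrib_right mult_a_inv a_inv_mult smult_mult_left
          smult_mult_right M.minus_eq M.minus_add M.a_ac smult_add_right smult_a_inv ac_simps)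
    \<comment> \<open>Commutation is transferred twice: the root \<open>l\<close> of
      \<open>y - a1\<close> commutes with \<open>a2\<close>, hence with the root \<open>k\<close> of
      \<open>y - a2\<close>. This is the hypothesis of \<open>nrm_sq_le_sum\<close>.\<close>
    then have "l \<otimes> a2 = a2 \<otimes> l" using lcom a2c ay by simp
    then have "k \<otimes> l = l \<otimes> k" using kcom l by simp
    then have "\<parallel>l\<parallel>\<^sup>2 \<le> \<parallel>l \<otimes> l \<oplus> k \<otimes> k\<parallel>" using nrm_sq_le_sum [of l k] l k by simp
    also have "l \<otimes> l \<oplus> k \<otimes> k = (y \<oplus> y) \<ominus> (a1 \<oplus> a2)"
      unfolding l k using a1c a2c yp by (simp add: add_minus_add)
    also have "a1 \<oplus> a2 = s \<odot> (complex_of_real c \<odot> y \<oplus> complex_of_real c \<odot> y)"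
      unfolding a1_def a2_def using z(1) yp
      by (simp add: smult_add_right [symmetric] M.minus_eq M.a_ac M.r_neg M.r_neg2)
    also have "(y \<oplus> y) \<ominus> s \<odot> (complex_of_real c \<odot> y \<oplus> complex_of_real c \<odot> y)
        = complex_of_real (2 * e / (c + e)) \<odot> y"
    proof -
      have "y \<oplus> y = 2 \<odot> y" using smult_add_left [of y 1 1] yp by simp
      moreover have "2 - s * (2 * complex_of_real c) = complex_of_real (2 * e / (c + e))"
      proof -
        have "2 - 1 / (c + e) * (2 * c) = 2 * e / (c + e)" using c e by (simp add: field_simps)
        from arg_cong [OF this, of complex_of_real] show ?thesis by (simp add: s_def)
      qed
      ultimately show ?thesis
        using yp by (simp add: smult_add_left [symmetric] smult_diff_left [symmetric])
    qed
    also have "\<parallel>complex_of_real (2 * e / (c + e)) \<odot> y\<parallel> \<le> 2 * e / (c + e)"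
      using c e by (intro nrm_smult_projection_le [OF y]) simp
    finally have "\<parallel>y \<ominus> a1\<parallel> \<le> 2 * e / (c + e)" using nrm_square [OF l(1,2)] l(3) by simp
    moreover have "y \<ominus> a1 = s \<odot> (complex_of_real e \<odot> y \<ominus> z)"
    proof -
      have 1: "1 - s * complex_of_real c = s * complex_of_real e"
      proof -
        have "1 - 1 / (c + e) * c = 1 / (c + e) * e" using c e by (simp add: field_simps)
        from arg_cong [OF this, of complex_of_real] show ?thesis by (simp add: s_def)
      qed
      have "s \<odot> (complex_of_real e \<odot> y \<ominus> z) = (1 - s * complex_of_real c) \<odot> y \<ominus> s \<odot> z"
        using yp z by (simp add: smult_minus 1)
      also have "\<dots> = y \<ominus> a1"
        using yp z by (simp add: a1_def smult_diff_left smult_add_right M.minus_eq M.minus_add M.a_assoc)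
      finally show ?thesis by simp
    qed
    ultimately have "\<parallel>complex_of_real e \<odot> y \<ominus> z\<parallel> / (c + e) \<le> 2 * e / (c + e)"
      using yp z by (simp add: nrm_smult cs)
    then have "\<parallel>complex_of_real e \<odot> y \<ominus> z\<parallel> \<le> 2 * e" using c e by (simp add: divide_le_cancel)
    moreover have "\<parallel>z\<parallel> \<le> \<parallel>complex_of_real e \<odot> y\<parallel> + \<parallel>z \<ominus> complex_of_real e \<odot> y\<parallel>"
      using yp z by (intro nrm_le_add_minus) auto
    moreover have "\<parallel>complex_of_real e \<odot> y\<parallel> \<le> e"
      using e by (intro nrm_smult_projection_le [OF y]) simp
    moreover have "\<parallel>z \<ominus> complex_of_real e \<odot> y\<parallel> = \<parallel>complex_of_real e \<odot> y \<ominus> z\<parallel>"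
      using yp z by (intro nrm_minus_commute) auto
    ultimately show ?thesis by (simp add: e_def)
  qed
  then have "\<parallel>z\<parallel> \<le> 0" by (rule field_le_epsilon)
  then show ?thesis using nrm_nonneg [OF z(1)] nrm_eq_zero [OF z(1)] by simp
qed

text \<open>Compressing the sum to the corner of \<open>q i\<close>, the positive elements \<open>q i q k q i\<close> with \<open>k \<noteq> i\<close> add up to
  an element whose negative is positive as well.\<close>

lemma projections_orthogonal:
  assumes fin: "finite I" and q: "\<And>i. i \<in> I \<Longrightarrow> projection A (q i)"
    and p: "projection A (finsum A q I)" and ij: "i \<in> I" "j \<in> I" "i \<noteq> j"
  shows "q i \<otimes> q j = \<zero>"
proof -
  let ?y = "q i"
  define z where "z = (\<lambda>k. ?y \<otimes> (q k \<otimes> ?y))"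
  note y = q [OF ij(1)] and yp = projectionD [OF q [OF ij(1)]]
  have qp: "q k \<in> carrier A" "q k \<otimes> q k = q k" "(q k)\<^sup>\<star> = q k" if "k \<in> I" for k
    using projectionD [OF q [OF that]] by auto
  note pp = projectionD [OF p]
  \<comment> \<open>Both elements are positive in the corner with constant 1. The difference form is
    applied below to the sum of all \<open>q k\<close>, the other to each single
    \<open>q k\<close>.\<close>
  have compress: "corner_positive ?y (?y \<ominus> ?y \<otimes> (r \<otimes> ?y))" "corner_positive ?y (?y \<otimes> (r \<otimes> ?y))"
    if r: "projection A r" for r
  proof -
    note rp = projectionD [OF r]
    have le: "\<parallel>?y \<otimes> (r \<otimes> ?y)\<parallel> \<le> 1"
    proof -
      have "\<parallel>?y \<otimes> (r \<otimes> ?y)\<parallel> \<le> \<parallel>?y\<parallel> * (\<parallel>r\<parallel> * \<parallel>?y\<parallel>)"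
        using yp rp by (meson mult_closed nrm_mult mult_left_mono nrm_nonneg order_trans)
      also have "\<dots> \<le> 1"
        using nrm_projection_le [OF y] nrm_projection_le [OF r] yp rp by (intro mult_le_one) auto
      finally show ?thesis .
    qed
    show "corner_positive ?y (?y \<ominus> ?y \<otimes> (r \<otimes> ?y))"
      unfolding corner_positive_def
    proof (intro conjI exI [of _ 1])
      have "?y \<ominus> ?y \<otimes> (r \<otimes> ?y) \<ominus> complex_of_real 1 \<odot> ?y = \<ominus> (?y \<otimes> (r \<otimes> ?y))"
        using yp rp by (simp add: M.minus_eq M.a_ac M.r_neg M.r_neg1 M.r_neg2)
      then show "\<parallel>?y \<ominus> ?y \<otimes> (r \<otimes> ?y) \<ominus> complex_of_real 1 \<odot> ?y\<parallel> \<le> 1"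
        using le yp rp by simp
    qed (use yp rp in \<open>simp_all add: adj_minus adj_mult mult_minus_right mult_assoc mult_assoc [symmetric, of ?y ?y]\<close>)
    show "corner_positive ?y (?y \<otimes> (r \<otimes> ?y))"
      unfolding corner_positive_def
    proof (intro conjI exI [of _ 1])
      \<comment> \<open>Chosen so that its square \<open>?b\<^sup>\<star> \<otimes> ?b\<close> is
        \<open>y - y r y\<close>, which also equals \<open>y \<otimes> ?b\<close>. Hence
        \<open>\<parallel>?b\<parallel>\<^sup>2 \<le> \<parallel>?b\<parallel>\<close>, and the norm
        of \<open>y - y r y\<close> is at most 1.\<close>
      let ?b = "?y \<ominus> r \<otimes> ?y"
      have "?b\<^sup>\<star> \<otimes> ?b = (?y \<ominus> ?y \<otimes> (r \<otimes> ?y)) \<ominus> (?y \<otimes> (r \<otimes> ?y) \<ominus> ?y \<otimes> (r \<otimes> (r \<otimes> ?y)))"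
        using yp rp by (simp add: adj_minus adj_mult mult_minus_left mult_minus_right mult_assoc)
      also have "r \<otimes> (r \<otimes> ?y) = r \<otimes> ?y" using yp rp by (metis mult_assoc)
      finally have bb: "?b\<^sup>\<star> \<otimes> ?b = ?y \<ominus> ?y \<otimes> (r \<otimes> ?y)" using yp rp by simp
      let ?r = "r \<otimes> ?y"
      have "\<parallel>?b\<parallel>\<^sup>2 = \<parallel>?y \<otimes> ?b\<parallel>"
        using bb yp rp cstar_identity [of ?b] by (simp add: mult_minus_right)
      also have "\<dots> \<le> 1 * \<parallel>?b\<parallel>"
        using nrm_mult [of ?y ?b] yp rp nrm_projection_le [OF y] mult_right_mono [of "\<parallel>?y\<parallel>" 1 "\<parallel>?b\<parallel>"] by simp
      finally have "\<parallel>?b\<parallel> * \<parallel>?b\<parallel> \<le> 1 * \<parallel>?b\<parallel>" by (simp add: power2_eq_square)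
      then have "\<parallel>?b\<parallel> \<le> 1"
        using mult_right_le_imp_le [of "\<parallel>?b\<parallel>" "\<parallel>?b\<parallel>" 1] nrm_nonneg [of ?b] yp rp
        by (cases "\<parallel>?b\<parallel> = 0") (auto simp: less_le)
      then have "\<parallel>?y \<ominus> ?y \<otimes> (r \<otimes> ?y)\<parallel> \<le> 1"
        using bb yp rp cstar_identity [of ?b] by (simp add: power_le_one)
      then show "\<parallel>?y \<otimes> (r \<otimes> ?y) \<ominus> complex_of_real 1 \<odot> ?y\<parallel> \<le> 1"
        using yp rp by (simp add: nrm_minus_commute)
    qed (use yp rp in \<open>simp_all add: adj_mult mult_assoc mult_assoc [symmetric, of ?y ?y]\<close>)
  qed
  have zp: "corner_positive ?y (z k)" if "k \<in> I" for k
    unfolding z_def by (rule compress [OF q [OF that]])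
  have zc: "z k \<in> carrier A" if "k \<in> I" for k using zp [OF that] by (simp add: corner_positive_def)
  have split: "finsum A z J = z k \<oplus> finsum A z (J - {k})" if "J \<subseteq> I" "k \<in> J" for J k
  proof -
    have "finsum A z (insert k (J - {k})) = z k \<oplus> finsum A z (J - {k})"
      using that fin zc by (intro M.finsum_insert) (auto intro: finite_subset)
    then show ?thesis using that by (simp add: insert_absorb)
  qed
  have Zc: "finsum A z J \<in> carrier A" if "J \<subseteq> I" for J
    using zc that by (intro finsum_closed') auto
  \<comment> \<open>The term with index \<open>i\<close> is \<open>y\<close> itself, so compressing
    the projection \<open>finsum A q I\<close> leaves exactly the negative of the remaining terms in
    \<open>y - y (\<dots>) y\<close>.\<close>
  have "?y \<otimes> (finsum A q I \<otimes> ?y) = finsum A z I"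
    using yp qp by (simp add: finsum_mult_left finsum_mult_right z_def)
  also have "\<dots> = ?y \<oplus> finsum A z (I - {i})"
    using split [of I i] ij yp by (simp add: z_def)
  finally have "?y \<ominus> ?y \<otimes> (finsum A q I \<otimes> ?y) = \<ominus> finsum A z (I - {i})"
    using yp Zc [of "I - {i}"] by (simp add: M.minus_eq M.minus_add M.r_neg2 M.r_neg)
  then have "corner_positive ?y (\<ominus> finsum A z (I - {i}))" using compress(1) [OF p] by simp
  moreover have "corner_positive ?y (finsum A z J)" if "J \<subseteq> I" for J
    using that zp by (intro corner_positive_finsum [OF y]) auto
  ultimately have "finsum A z (I - {i}) = \<zero>"
    by (intro corner_positive_antisym [OF y]) auto
  then have "z j \<oplus> finsum A z (I - {i} - {j}) = \<zero>" using split [of "I - {i}" j] ij by auto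
  \<comment> \<open>A sum of positive elements vanishes; the same antisymmetry now isolates one of
    them, as its negative is the sum of the others.\<close>
  then have "\<ominus> z j = finsum A z (I - {i} - {j})"
    using zc ij Zc [of "I - {i} - {j}"] M.minus_equality [of "finsum A z (I - {i} - {j})" "z j"]
    by (simp add: M.a_comm) 
  then have "corner_positive ?y (\<ominus> z j)"
    using \<open>\<And>J. J \<subseteq> I \<Longrightarrow> corner_positive ?y (finsum A z J)\<close> [of "I - {i} - {j}"] by auto
  then have "z j = \<zero>" by (intro corner_positive_antisym [OF y zp [OF ij(2)]])
  moreover have "(q j \<otimes> ?y)\<^sup>\<star> \<otimes> (q j \<otimes> ?y) = z j"
    using qp [OF ij(2)] yp unfolding z_def by (simp add: adj_mult) (metis mult_assoc mult_closed)
  ultimately have "\<parallel>q j \<otimes> ?y\<parallel> = 0"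
    using cstar_identity [of "q j \<otimes> ?y"] qp [OF ij(2)] yp by simp
  then have "q j \<otimes> ?y = \<zero>" using qp [OF ij(2)] yp by (simp add: nrm_eq_zero)
  then have "(q j \<otimes> ?y)\<^sup>\<star> = \<zero>" by simp
  then show ?thesis using qp [OF ij(2)] yp by (simp add: adj_mult)
qed

end

section \<open>Continuity of star-homomorphisms\<close>

context two_cstar
begin

text \<open>For self-adjoint \<open>a\<close> of norm below 1, \<open>square_root\<close> applied to
  \<open>a a\<close> gives \<open>y\<close> with \<open>y + y = a a + y y\<close>. This relation
  survives under \<open>\<phi>\<close>, and \<open>nrm_le_one_of_pythagoras\<close> bounds the image
  by 1. Scaling gives the self-adjoint case, the C*-identity the general one.\<close>

lemma star_hom_contractive:
  assumes S: "cstar_subalgebra S A" and \<phi>: "star_hom S A B \<phi>" and x: "x \<in> S"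
  shows "\<parallel>\<phi> x\<parallel>\<^bsub>B\<^esub> \<le> \<parallel>x\<parallel>\<^bsub>A\<^esub>"
proof -
  note cs = A.cstar_subalgebra_subspace [OF S]
  have Sc: "z \<in> carrier A" if "z \<in> S" for z using A.closed_subspace_sub [OF cs] that by blast
  have one: "\<parallel>\<phi> a\<parallel>\<^bsub>B\<^esub> \<le> 1" if a: "a \<in> S" "a\<^sup>\<star>\<^bsub>A\<^esub> = a" "\<parallel>a\<parallel>\<^bsub>A\<^esub> < 1" for a
  proof -
    have aa: "a \<otimes>\<^bsub>A\<^esub> a \<in> S" using A.cstar_subalgebra_mult [OF S] a by blast
    have "\<parallel>a \<otimes>\<^bsub>A\<^esub> a\<parallel>\<^bsub>A\<^esub> < 1"
      using A.nrm_square [OF Sc [OF a(1)] a(2)] a Sc by (simp add: power_less_one_iff abs_square_less_1)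
    then obtain y where y: "y \<in> carrier A" "y\<^sup>\<star>\<^bsub>A\<^esub> = y" "y \<oplus>\<^bsub>A\<^esub> y = a \<otimes>\<^bsub>A\<^esub> a \<oplus>\<^bsub>A\<^esub> y \<otimes>\<^bsub>A\<^esub> y"
      and yS: "\<And>S. cstar_subalgebra S A \<Longrightarrow> a \<otimes>\<^bsub>A\<^esub> a \<in> S \<Longrightarrow> y \<in> S"
      using A.square_root [of "a \<otimes>\<^bsub>A\<^esub> a"] Sc [OF a(1)] a(2) by (metis A.adj_mult A.mult_closed)
    have y1: "y \<in> S" by (rule yS [OF S aa])
    \<comment> \<open>The root lies in every C*-subalgebra containing \<open>a a\<close>, in
      particular in the commutant of \<open>a\<close>.\<close>
    have com: "y \<otimes>\<^bsub>A\<^esub> a = a \<otimes>\<^bsub>A\<^esub> y"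
      using yS [OF A.commutant_subalgebra [OF Sc [OF a(1)] a(2)]] Sc [OF a(1)] by (simp add: A.mult_assoc)
    have yy: "y \<otimes>\<^bsub>A\<^esub> y \<in> S" using A.cstar_subalgebra_mult [OF S] y1 by blast
    show ?thesis
    proof (rule B.nrm_le_one_of_pythagoras [of _ "\<phi> y"])
      show "\<phi> a \<otimes>\<^bsub>B\<^esub> \<phi> y = \<phi> y \<otimes>\<^bsub>B\<^esub> \<phi> a"
        using com a y1 star_hom_mult [OF \<phi>] by metis
      show "\<phi> y \<oplus>\<^bsub>B\<^esub> \<phi> y = \<phi> a \<otimes>\<^bsub>B\<^esub> \<phi> a \<oplus>\<^bsub>B\<^esub> \<phi> y \<otimes>\<^bsub>B\<^esub> \<phi> y"
        using y(3) a y1 aa yy star_hom_mult [OF \<phi>] star_hom_add [OF \<phi>] by metis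
      show "(\<phi> a)\<^sup>\<star>\<^bsub>B\<^esub> = \<phi> a" "(\<phi> y)\<^sup>\<star>\<^bsub>B\<^esub> = \<phi> y"
        using star_hom_adj [OF \<phi>] a y1 y(2) by metis+
    qed (use star_hom_closed [OF \<phi>] a y1 in auto)
  qed
  have sa: "\<parallel>\<phi> a\<parallel>\<^bsub>B\<^esub> \<le> \<parallel>a\<parallel>\<^bsub>A\<^esub>" if a: "a \<in> S" "a\<^sup>\<star>\<^bsub>A\<^esub> = a" for a
  proof (rule field_le_epsilon)
    fix e :: real assume e: "e > 0"
    \<comment> \<open>The added \<open>e\<close> brings the norm of the scaled element strictly
      below 1 and keeps the divisor positive when \<open>a\<close> is zero.\<close>
    define s where "s = \<parallel>a\<parallel>\<^bsub>A\<^esub> + e"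
    have s: "s > 0" using e A.nrm_nonneg [OF Sc [OF a(1)]] unfolding s_def by linarith
    let ?b = "complex_of_real (1 / s) \<odot>\<^bsub>A\<^esub> a"
    have "?b \<in> S" using A.closed_subspace_smult [OF cs] a by blast
    moreover have "?b\<^sup>\<star>\<^bsub>A\<^esub> = ?b" using a Sc by (simp add: A.adj_smult)
    moreover have "\<parallel>?b\<parallel>\<^bsub>A\<^esub> < 1"
      using s e Sc [OF a(1)] unfolding s_def [symmetric]
      by (simp add: A.nrm_smult norm_divide) (simp add: s_def)
    ultimately have "\<parallel>\<phi> ?b\<parallel>\<^bsub>B\<^esub> \<le> 1" by (rule one)
    then have "\<parallel>\<phi> a\<parallel>\<^bsub>B\<^esub> / s \<le> 1"
      using a s star_hom_smult [OF \<phi>] star_hom_closed [OF \<phi>] by (simp add: B.nrm_smult norm_divide)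
    then show "\<parallel>\<phi> a\<parallel>\<^bsub>B\<^esub> \<le> \<parallel>a\<parallel>\<^bsub>A\<^esub> + e" using s by (simp add: s_def)
  qed
  have xx: "x\<^sup>\<star>\<^bsub>A\<^esub> \<in> S" "x\<^sup>\<star>\<^bsub>A\<^esub> \<otimes>\<^bsub>A\<^esub> x \<in> S"
    using A.cstar_subalgebra_mult [OF S] A.cstar_subalgebra_adj [OF S] x by auto
  have "\<parallel>\<phi> x\<parallel>\<^bsub>B\<^esub>\<^sup>2 = \<parallel>(\<phi> x)\<^sup>\<star>\<^bsub>B\<^esub> \<otimes>\<^bsub>B\<^esub> \<phi> x\<parallel>\<^bsub>B\<^esub>"
    using star_hom_closed [OF \<phi> x] by (simp add: B.cstar_identity)
  also have "\<dots> = \<parallel>\<phi> (x\<^sup>\<star>\<^bsub>A\<^esub> \<otimes>\<^bsub>A\<^esub> x)\<parallel>\<^bsub>B\<^esub>"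
    using star_hom_mult [OF \<phi>] star_hom_adj [OF \<phi>] x xx by simp
  also have "\<dots> \<le> \<parallel>x\<^sup>\<star>\<^bsub>A\<^esub> \<otimes>\<^bsub>A\<^esub> x\<parallel>\<^bsub>A\<^esub>"
    by (rule sa) (use xx Sc x in \<open>auto simp: A.adj_mult\<close>)
  also have "\<dots> = \<parallel>x\<parallel>\<^bsub>A\<^esub>\<^sup>2" using Sc [OF x] by (simp add: A.cstar_identity)
  finally show ?thesis
    by (rule power2_le_imp_le) (use Sc [OF x] in auto)
qed

lemma star_hom_blin:
  assumes "cstar_subalgebra S A" "star_hom S A B \<phi>"
  shows "blin S A B \<phi>"
  using star_hom_contractive [OF assms] assms(2) unfolding blin_def star_hom_def
  by (auto intro!: exI [of _ 1])

end

section \<open>Multipliers\<close>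

context cstar_algebra
begin

abbreviation MA where "MA \<equiv> multiplier_algebra A"

lemma multiplier_iff:
  "m \<in> carrier MA \<longleftrightarrow>
    fst m \<in> extensional (carrier A) \<and> snd m \<in> extensional (carrier A) \<and>
    blin (carrier A) A A (fst m) \<and> blin (carrier A) A A (snd m) \<and>
    (\<forall>x\<in>carrier A. \<forall>y\<in>carrier A. fst m (x \<otimes> y) = fst m x \<otimes> y \<and>
      snd m (x \<otimes> y) = x \<otimes> snd m y \<and> snd m x \<otimes> y = x \<otimes> fst m y)"
  by (cases m) (auto simp: multiplier_algebra_def double_centralizers_def bounded_ops_def blin_def PiE_iff)

lemma
  assumes "m \<in> carrier MA"
  shows multiplier_fst_blin: "blin (carrier A) A A (fst m)"
    and multiplier_snd_blin: "blin (carrier A) A A (snd m)"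
    and multiplier_fst_in: "x \<in> carrier A \<Longrightarrow> fst m x \<in> carrier A"
    and multiplier_snd_in: "x \<in> carrier A \<Longrightarrow> snd m x \<in> carrier A"
    and multiplier_fst_mult: "\<lbrakk>x \<in> carrier A; y \<in> carrier A\<rbrakk> \<Longrightarrow> fst m (x \<otimes> y) = fst m x \<otimes> y"
    and multiplier_snd_mult: "\<lbrakk>x \<in> carrier A; y \<in> carrier A\<rbrakk> \<Longrightarrow> snd m (x \<otimes> y) = x \<otimes> snd m y"
    and multiplier_mid: "\<lbrakk>x \<in> carrier A; y \<in> carrier A\<rbrakk> \<Longrightarrow> snd m x \<otimes> y = x \<otimes> fst m y"
  using assms unfolding multiplier_iff by (auto simp: blin_def)

lemma fst_multiplier_mult:
  "x \<in> carrier A \<Longrightarrow> fst (m \<otimes>\<^bsub>MA\<^esub> n) x = fst m (fst n x)"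
  by (simp add: multiplier_algebra_def split_beta compose_def)

lemma snd_multiplier_mult:
  "x \<in> carrier A \<Longrightarrow> snd (m \<otimes>\<^bsub>MA\<^esub> n) x = snd n (snd m x)"
  by (simp add: multiplier_algebra_def split_beta compose_def)

lemma fst_multiplier_adj: "x \<in> carrier A \<Longrightarrow> fst (m\<^sup>\<star>\<^bsub>MA\<^esub>) x = (snd m (x\<^sup>\<star>))\<^sup>\<star>"
  by (simp add: multiplier_algebra_def split_beta)

lemma snd_multiplier_adj: "x \<in> carrier A \<Longrightarrow> snd (m\<^sup>\<star>\<^bsub>MA\<^esub>) x = (fst m (x\<^sup>\<star>))\<^sup>\<star>"
  by (simp add: multiplier_algebra_def split_beta)

lemma fst_mult_of: "x \<in> carrier A \<Longrightarrow> fst (mult_of A a) x = a \<otimes> x"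
  by (simp add: mult_of_def)

lemma snd_mult_of: "x \<in> carrier A \<Longrightarrow> snd (mult_of A a) x = x \<otimes> a"
  by (simp add: mult_of_def)

lemma fst_multiplier_one: "x \<in> carrier A \<Longrightarrow> fst \<one>\<^bsub>MA\<^esub> x = x"
  by (simp add: multiplier_algebra_def)

lemma snd_multiplier_one: "x \<in> carrier A \<Longrightarrow> snd \<one>\<^bsub>MA\<^esub> x = x"
  by (simp add: multiplier_algebra_def)

lemma blin_extensional_cong:
  "blin (carrier A) A A T \<Longrightarrow> (\<And>x. x \<in> carrier A \<Longrightarrow> U x = T x) \<Longrightarrow> blin (carrier A) A A U"
  by (simp add: blin_def)

lemma mult_of_in: "a \<in> carrier A \<Longrightarrow> mult_of A a \<in> carrier MA"
  unfolding multiplier_iff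
  by (auto simp: mult_of_def mult_assoc intro: blin_extensional_cong [OF blin_mult_left]
      blin_extensional_cong [OF blin_mult_right])

lemma blin_compose:
  assumes "blin (carrier A) A A T" "blin (carrier A) A A U"
  shows "blin (carrier A) A A (\<lambda>x. T (U x))"
proof -
  interpret two_cstar A A by (rule two_cstar_self)
  obtain K where K: "K > 0" "\<And>x. x \<in> carrier A \<Longrightarrow> \<parallel>T x\<parallel> \<le> K * \<parallel>x\<parallel>"
    using blin_bound [OF assms(1)] by blast
  obtain L where L: "L > 0" "\<And>x. x \<in> carrier A \<Longrightarrow> \<parallel>U x\<parallel> \<le> L * \<parallel>x\<parallel>"
    using blin_bound [OF assms(2)] by blast
  have "\<parallel>T (U x)\<parallel> \<le> (K * L) * \<parallel>x\<parallel>" if "x \<in> carrier A" for x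
  proof -
    have "\<parallel>T (U x)\<parallel> \<le> K * \<parallel>U x\<parallel>" using K(2) assms(2) that by (simp add: blin_def)
    also have "\<dots> \<le> K * (L * \<parallel>x\<parallel>)" using L(2) [OF that] K(1) by (intro mult_left_mono) auto
    finally show ?thesis by simp
  qed
  then show ?thesis using assms unfolding blin_def by auto
qed

lemma blin_adj_conj:
  assumes "blin (carrier A) A A T"
  shows "blin (carrier A) A A (\<lambda>x. (T (x\<^sup>\<star>))\<^sup>\<star>)"
proof -
  obtain K where K: "\<And>x. x \<in> carrier A \<Longrightarrow> \<parallel>T x\<parallel> \<le> K * \<parallel>x\<parallel>" using assms unfolding blin_def by blast
  have "\<parallel>(T (x\<^sup>\<star>))\<^sup>\<star>\<parallel> \<le> K * \<parallel>x\<parallel>" if "x \<in> carrier A" for x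
    using K [of "x\<^sup>\<star>"] that assms by (simp add: blin_def)
  then show ?thesis
    using assms unfolding blin_def by (auto simp: adj_add adj_smult)
qed

lemma multiplier_mult_in:
  assumes "m \<in> carrier MA" "n \<in> carrier MA"
  shows "m \<otimes>\<^bsub>MA\<^esub> n \<in> carrier MA"
  unfolding multiplier_iff
proof (intro conjI ballI)
  show "blin (carrier A) A A (fst (m \<otimes>\<^bsub>MA\<^esub> n))"
    by (rule blin_extensional_cong [OF blin_compose [OF multiplier_fst_blin [OF assms(1)]
            multiplier_fst_blin [OF assms(2)]]]) (simp add: fst_multiplier_mult)
  show "blin (carrier A) A A (snd (m \<otimes>\<^bsub>MA\<^esub> n))"
    by (rule blin_extensional_cong [OF blin_compose [OF multiplier_snd_blin [OF assms(2)]
            multiplier_snd_blin [OF assms(1)]]]) (simp add: snd_multiplier_mult)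
  show "fst (m \<otimes>\<^bsub>MA\<^esub> n) \<in> extensional (carrier A)" "snd (m \<otimes>\<^bsub>MA\<^esub> n) \<in> extensional (carrier A)"
    by (simp_all add: multiplier_algebra_def split_beta)
qed (use assms in \<open>simp_all add: fst_multiplier_mult snd_multiplier_mult multiplier_fst_in
    multiplier_snd_in multiplier_fst_mult multiplier_snd_mult multiplier_mid\<close>)

lemma multiplier_adj_in:
  assumes "m \<in> carrier MA"
  shows "m\<^sup>\<star>\<^bsub>MA\<^esub> \<in> carrier MA"
  unfolding multiplier_iff
proof (intro conjI ballI)
  show "blin (carrier A) A A (fst (m\<^sup>\<star>\<^bsub>MA\<^esub>))"
    by (rule blin_extensional_cong [OF blin_adj_conj [OF multiplier_snd_blin [OF assms]]])
      (simp add: fst_multiplier_adj)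
  show "blin (carrier A) A A (snd (m\<^sup>\<star>\<^bsub>MA\<^esub>))"
    by (rule blin_extensional_cong [OF blin_adj_conj [OF multiplier_fst_blin [OF assms]]])
      (simp add: snd_multiplier_adj)
  show "fst (m\<^sup>\<star>\<^bsub>MA\<^esub>) \<in> extensional (carrier A)" "snd (m\<^sup>\<star>\<^bsub>MA\<^esub>) \<in> extensional (carrier A)"
    by (simp_all add: multiplier_algebra_def split_beta)
  fix x y assume xy: "x \<in> carrier A" "y \<in> carrier A"
  note simps = xy assms fst_multiplier_adj snd_multiplier_adj adj_mult multiplier_fst_mult
    multiplier_snd_mult multiplier_fst_in multiplier_snd_in
  show "fst (m\<^sup>\<star>\<^bsub>MA\<^esub>) (x \<otimes> y) = fst (m\<^sup>\<star>\<^bsub>MA\<^esub>) x \<otimes> y" by (simp add: simps)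
  show "snd (m\<^sup>\<star>\<^bsub>MA\<^esub>) (x \<otimes> y) = x \<otimes> snd (m\<^sup>\<star>\<^bsub>MA\<^esub>) y" by (simp add: simps)
  have "(snd m (y\<^sup>\<star>) \<otimes> x\<^sup>\<star>)\<^sup>\<star> = (y\<^sup>\<star> \<otimes> fst m (x\<^sup>\<star>))\<^sup>\<star>"
    using xy by (simp add: multiplier_mid [OF assms])
  then show "snd (m\<^sup>\<star>\<^bsub>MA\<^esub>) x \<otimes> y = x \<otimes> fst (m\<^sup>\<star>\<^bsub>MA\<^esub>) y" by (simp add: simps)
qed

text \<open>The left actions agree on the closed span. They determine the right actions, because the
  product of \<open>snd m x\<close> with \<open>y\<close> is \<open>x \<otimes> fst m y\<close> and
  \<open>eq_of_right_mult\<close> cancels \<open>y\<close>.\<close>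

lemma multiplier_eqI:
  assumes mn: "m \<in> carrier MA" "n \<in> carrier MA"
    and X: "X \<subseteq> carrier A" "closed_span A X = carrier A" "\<And>x. x \<in> X \<Longrightarrow> fst m x = fst n x"
  shows "m = n"
proof -
  interpret two_cstar A A by (rule two_cstar_self)
  have "closed_subspace {x \<in> carrier A. fst m x = fst n x} A"
    by (rule blin_equalizer [OF closed_subspace_carrier multiplier_fst_blin multiplier_fst_blin]) fact+
  then have "closed_span A X \<subseteq> {x \<in> carrier A. fst m x = fst n x}"
    by (rule closed_span_least) (use X in auto)
  then have f: "fst m x = fst n x" if "x \<in> carrier A" for x using X(2) that by auto
  have s: "snd m x = snd n x" if x: "x \<in> carrier A" for x
    by (rule eq_of_right_mult) (use x mn f in \<open>auto simp: multiplier_snd_in multiplier_mid\<close>)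
  have "fst m = fst n" "snd m = snd n"
    using mn f s unfolding multiplier_iff by (auto intro: extensionalityI)
  then show ?thesis by (simp add: prod_eq_iff)
qed

lemma multiplier_eqI':
  assumes "m \<in> carrier MA" "n \<in> carrier MA" "\<And>x. x \<in> carrier A \<Longrightarrow> fst m x = fst n x"
  shows "m = n"
  by (rule multiplier_eqI [OF assms(1,2), of "carrier A"])
    (use assms closed_span_superset [of "carrier A"] closed_span_sub_carrier [of "carrier A"] in auto)

lemma multiplier_one_in: "\<one>\<^bsub>MA\<^esub> \<in> carrier MA"
  unfolding multiplier_iff
  by (auto simp: multiplier_algebra_def intro: blin_extensional_cong [OF blin_id])

lemma conv_minus:
  assumes "conv f l F" "conv g m F"
  shows "conv (\<lambda>i. f i \<ominus> g i) (l \<ominus> m) F"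
proof -
  have c: "l \<in> carrier A" "m \<in> carrier A" 
    and ev: "eventually (\<lambda>i. f i \<in> carrier A) F" "eventually (\<lambda>i. g i \<in> carrier A) F"
    using assms by (simp_all add: conv_def)
  have "conv (\<lambda>i. f i \<oplus> (-1) \<odot> g i) (l \<ominus> m) F"
    using conv_add [OF assms(1) conv_smult [OF assms(2), of "-1"]] c by (simp add: minus_eq_smult)
  then show ?thesis
    by (rule conv_cong) (use ev in \<open>eventually_elim, simp add: minus_eq_smult\<close>)
qed

lemma conv_iff_eps:
  "conv f l F \<longleftrightarrow> l \<in> carrier A \<and> (\<forall>e>0. eventually (\<lambda>i. f i \<in> carrier A \<and> \<parallel>f i \<ominus> l\<parallel> < e) F)"
proof -
  interpret Metric_space "carrier A" "cdist A" by (rule Metric_space_cdist)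
  show ?thesis
    unfolding limitin_iff_conv [symmetric] norm_topology_def limitin_metric
    by (simp add: cdist_def cong: conj_cong)
qed

text \<open>For a uniformly bounded net of linear maps the points of convergence form a closed set.
  The limits at approximating points \<open>y n\<close> are Cauchy, and the limit of these limits is
  the limit at \<open>x\<close> by an argument with three error terms.\<close>

lemma closed_subspace_convergent:
  assumes F: "F \<noteq> bot" and K: "0 \<le> K"
    and T: "\<And>i x. x \<in> carrier A \<Longrightarrow> T i x \<in> carrier A"
      "\<And>i x y. \<lbrakk>x \<in> carrier A; y \<in> carrier A\<rbrakk> \<Longrightarrow> T i (x \<oplus> y) = T i x \<oplus> T i y"
      "\<And>i c x. x \<in> carrier A \<Longrightarrow> T i (c \<odot> x) = c \<odot> T i x"
      "\<And>i x. x \<in> carrier A \<Longrightarrow> \<parallel>T i x\<parallel> \<le> K * \<parallel>x\<parallel>"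
  shows "closed_subspace {x \<in> carrier A. \<exists>l. conv (\<lambda>i. T i x) l F} A" (is "closed_subspace ?S A")
proof (rule closed_subspaceI)
  have Tm: "T i (x \<ominus> y) = T i x \<ominus> T i y" if "x \<in> carrier A" "y \<in> carrier A" for i x y
    using that by (simp add: minus_eq_smult T)
  have T0: "T i \<zero> = \<zero>" for i using T(3) [of \<zero> i 0] T(1) [of \<zero> i] by simp
  show "\<zero> \<in> ?S" by (auto simp: T0 intro!: conv_eventually_const)
  show "x \<oplus> y \<in> ?S" if xy: "x \<in> ?S" "y \<in> ?S" for x y
  proof -
    obtain l m where "conv (\<lambda>i. T i x) l F" "conv (\<lambda>i. T i y) m F" "x \<in> carrier A" "y \<in> carrier A"
      using xy by auto
    then show ?thesis using conv_add [of "\<lambda>i. T i x" l F "\<lambda>i. T i y" m] by (auto simp: T(2))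
  qed
  show "c \<odot> x \<in> ?S" if x: "x \<in> ?S" for c x
  proof -
    obtain l where "conv (\<lambda>i. T i x) l F" "x \<in> carrier A" using x by auto
    then show ?thesis using conv_smult [of "\<lambda>i. T i x" l F c] by (auto simp: T(3))
  qed
  show "x \<in> ?S" if x: "x \<in> carrier A" and ap: "\<And>e. 0 < e \<Longrightarrow> \<exists>y\<in>?S. \<parallel>x \<ominus> y\<parallel> < e" for x
  proof -
    have "\<exists>y l. y \<in> carrier A \<and> conv (\<lambda>i. T i y) l F \<and> \<parallel>x \<ominus> y\<parallel> < inverse (real (Suc n))" for n
      using ap [of "inverse (real (Suc n))"] by auto
    then obtain y l where y: "\<And>n. y n \<in> carrier A" and l: "\<And>n. conv (\<lambda>i. T i (y n)) (l n) F"
      and yn: "\<And>n. \<parallel>x \<ominus> y n\<parallel> < inverse (real (Suc n))" by metis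
    have lc: "l n \<in> carrier A" for n by (rule conv_carrier [OF l])
    have lb: "\<parallel>l m \<ominus> l n\<parallel> \<le> K * \<parallel>y m \<ominus> y n\<parallel>" for m n
      by (rule conv_nrm_le [OF conv_minus [OF l l] F])
        (use T(4) y in \<open>auto simp: Tm [symmetric] intro!: always_eventually\<close>)
    have yb: "\<parallel>y m \<ominus> y n\<parallel> \<le> inverse (real (Suc m)) + inverse (real (Suc n))" for m n
      using nrm_minus_triangle [OF y x y, of m n] nrm_minus_commute [OF y x, of m] yn [of m] yn [of n] by linarith
    \<comment> \<open>Two approximation errors account for the factor \<open>2 * K\<close>; the 1
      keeps it positive when \<open>K = 0\<close>.\<close>
    have small: "\<exists>N. (2 * K + 1) * inverse (real (Suc N)) < e" if e: "e > 0" for e :: real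
    proof -
      have "0 < e / (2 * K + 1)" using e K by simp
      then obtain N where "inverse (real (Suc N)) < e / (2 * K + 1)" using reals_Archimedean by blast
      then have "(2 * K + 1) * inverse (real (Suc N)) < (2 * K + 1) * (e / (2 * K + 1))"
        using K by (intro mult_strict_left_mono) auto
      then show ?thesis using K by auto
    qed
    have mono: "inverse (real (Suc m)) \<le> inverse (real (Suc N))" if "m \<ge> N" for m N
      using that by (intro le_imp_inverse_le) auto
    have "\<exists>L. conv l L sequentially"
    proof (rule Cauchy_conv [OF lc])
      fix e :: real assume "e > 0"
      then obtain N where N: "(2 * K + 1) * inverse (real (Suc N)) < e" using small by blast
      have "\<parallel>l m \<ominus> l n\<parallel> < e" if "m \<ge> N" "n \<ge> N" for m n
      proof -
        have "\<parallel>l m \<ominus> l n\<parallel> \<le> K * (inverse (real (Suc N)) + inverse (real (Suc N)))"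
          using lb [of m n] yb [of m n] mono [OF that(1)] mono [OF that(2)] K
          by (smt (verit) mult_left_mono)
        also have "\<dots> \<le> (2 * K + 1) * inverse (real (Suc N))" by (simp add: algebra_simps)
        finally show ?thesis using N by simp
      qed
      then show "\<exists>N. \<forall>m\<ge>N. \<forall>n\<ge>N. \<parallel>l m \<ominus> l n\<parallel> < e" by blast
    qed
    then obtain L where L: "conv l L sequentially" by blast
    have Lc: "L \<in> carrier A" by (rule conv_carrier [OF L])
    have "conv (\<lambda>i. T i x) L F"
      unfolding conv_iff_eps
    proof (intro conjI allI impI Lc)
      fix e :: real assume e: "e > 0"
      have "eventually (\<lambda>n. \<parallel>l n \<ominus> L\<parallel> < e / 3) sequentially"
        using L e unfolding conv_iff_eps by (auto elim!: eventually_mono dest!: spec [of _ "e / 3"])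
      then obtain N1 where N1: "\<And>n. n \<ge> N1 \<Longrightarrow> \<parallel>l n \<ominus> L\<parallel> < e / 3" by (auto simp: eventually_sequentially)
      obtain N2 where N2: "(2 * K + 1) * inverse (real (Suc N2)) < e / 3" using small [of "e / 3"] e by auto
      define n where "n = max N1 N2"
      have n1: "\<parallel>l n \<ominus> L\<parallel> < e / 3" using N1 by (simp add: n_def)
      have "inverse (real (Suc n)) \<le> inverse (real (Suc N2))" by (rule mono) (simp add: n_def)
      then have "K * \<parallel>x \<ominus> y n\<parallel> \<le> K * inverse (real (Suc N2))"
        using yn [of n] K by (intro mult_left_mono) linarith+
      also have "\<dots> \<le> (2 * K + 1) * inverse (real (Suc N2))" using K by (intro mult_right_mono) auto
      finally have n2: "K * \<parallel>x \<ominus> y n\<parallel> < e / 3" using N2 by simp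
      have "eventually (\<lambda>i. \<parallel>T i (y n) \<ominus> l n\<parallel> < e / 3) F"
        using l [of n] e unfolding conv_iff_eps by (auto elim!: eventually_mono dest!: spec [of _ "e / 3"])
      then show "eventually (\<lambda>i. T i x \<in> carrier A \<and> \<parallel>T i x \<ominus> L\<parallel> < e) F"
      proof eventually_elim
        case (elim i)
        have "\<parallel>T i x \<ominus> L\<parallel> \<le> \<parallel>T i x \<ominus> T i (y n)\<parallel> + \<parallel>T i (y n) \<ominus> L\<parallel>"
          by (rule nrm_minus_triangle) (use T(1) x y Lc in auto)
        moreover have "\<parallel>T i (y n) \<ominus> L\<parallel> \<le> \<parallel>T i (y n) \<ominus> l n\<parallel> + \<parallel>l n \<ominus> L\<parallel>"
          by (rule nrm_minus_triangle) (use T(1) y Lc lc in auto)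
        moreover have "\<parallel>T i x \<ominus> T i (y n)\<parallel> \<le> K * \<parallel>x \<ominus> y n\<parallel>"
          using T(4) [of "x \<ominus> y n" i] x y Tm by simp
        ultimately have "\<parallel>T i x \<ominus> L\<parallel> < e" using elim n1 n2 by linarith
        then show ?case using T(1) [OF x] by simp
      qed
    qed
    then show ?thesis using x by blast
  qed
qed auto

text \<open>Bounded nets need to converge only on spanning sets, one for each side. The limits on
  the two sides form a double centraliser because the identities relating them hold for every
  \<open>X i\<close> by associativity and pass to the limit.\<close>

lemma strict_limit_exists:
  assumes F: "F \<noteq> bot" and X: "\<And>i. X i \<in> carrier A" "\<And>i. \<parallel>X i\<parallel> \<le> K"
    and D: "D \<subseteq> carrier A" "closed_span A D = carrier A" "\<And>d. d \<in> D \<Longrightarrow> \<exists>l. conv (\<lambda>i. X i \<otimes> d) l F"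
    and G: "G \<subseteq> carrier A" "closed_span A G = carrier A" "\<And>d. d \<in> G \<Longrightarrow> \<exists>l. conv (\<lambda>i. d \<otimes> X i) l F"
  obtains m where "m \<in> carrier MA" "\<And>a. a \<in> carrier A \<Longrightarrow> conv (\<lambda>i. X i \<otimes> a) (fst m a) F"
    "\<And>a. a \<in> carrier A \<Longrightarrow> conv (\<lambda>i. a \<otimes> X i) (snd m a) F"
proof -
  have K: "0 \<le> K" using X nrm_nonneg order_trans by blast
  have Xl: "\<parallel>X i \<otimes> x\<parallel> \<le> K * \<parallel>x\<parallel>" "\<parallel>x \<otimes> X i\<parallel> \<le> K * \<parallel>x\<parallel>" if "x \<in> carrier A" for x i
    using nrm_mult [OF X(1) that, of i] nrm_mult [OF that X(1), of i] mult_right_mono [OF X(2), of "\<parallel>x\<parallel>" i] that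
    by (auto simp: mult.commute)
  have "closed_subspace {x \<in> carrier A. \<exists>l. conv (\<lambda>i. X i \<otimes> x) l F} A"
    by (rule closed_subspace_convergent [OF F K])
      (use X Xl in \<open>auto simp: mult_distrib_left smult_mult_right\<close>)
  then have "closed_span A D \<subseteq> {x \<in> carrier A. \<exists>l. conv (\<lambda>i. X i \<otimes> x) l F}"
    by (rule closed_span_least) (use D in auto)
  then have "\<forall>x\<in>carrier A. \<exists>l. conv (\<lambda>i. X i \<otimes> x) l F" using D(2) by auto
  then obtain L where L: "\<And>x. x \<in> carrier A \<Longrightarrow> conv (\<lambda>i. X i \<otimes> x) (L x) F" by metis
  have "closed_subspace {x \<in> carrier A. \<exists>l. conv (\<lambda>i. x \<otimes> X i) l F} A"
    by (rule closed_subspace_convergent [OF F K])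
      (use X Xl in \<open>auto simp: mult_distrib_right smult_mult_left\<close>)
  then have "closed_span A G \<subseteq> {x \<in> carrier A. \<exists>l. conv (\<lambda>i. x \<otimes> X i) l F}"
    by (rule closed_span_least) (use G in auto)
  then have "\<forall>x\<in>carrier A. \<exists>l. conv (\<lambda>i. x \<otimes> X i) l F" using G(2) by auto
  then obtain R where R: "\<And>x. x \<in> carrier A \<Longrightarrow> conv (\<lambda>i. x \<otimes> X i) (R x) F" by metis
  have LR: "L x \<in> carrier A" "R x \<in> carrier A" if "x \<in> carrier A" for x
    using conv_carrier L R that by blast+
  note uniq = conv_unique [OF _ _ F]
  have Ladd: "L (x \<oplus> y) = L x \<oplus> L y" "R (x \<oplus> y) = R x \<oplus> R y" if "x \<in> carrier A" "y \<in> carrier A" for x y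
    using uniq [OF L [of "x \<oplus> y"], of "L x \<oplus> L y"] conv_add [OF L [of x] L [of y]]
      uniq [OF R [of "x \<oplus> y"], of "R x \<oplus> R y"] conv_add [OF R [of x] R [of y]] that X
    by (simp_all add: mult_distrib_left mult_distrib_right)
  have Lsm: "L (c \<odot> x) = c \<odot> L x" "R (c \<odot> x) = c \<odot> R x" if "x \<in> carrier A" for c x
    using uniq [OF L [of "c \<odot> x"], of "c \<odot> L x"] conv_smult [OF L [of x], of c]
      uniq [OF R [of "c \<odot> x"], of "c \<odot> R x"] conv_smult [OF R [of x], of c] that X
    by (simp_all add: smult_mult_left smult_mult_right)
  have Lb: "\<parallel>L x\<parallel> \<le> K * \<parallel>x\<parallel>" "\<parallel>R x\<parallel> \<le> K * \<parallel>x\<parallel>" if "x \<in> carrier A" for x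
    using conv_nrm_le [OF L [OF that] F] conv_nrm_le [OF R [OF that] F] Xl [OF that] by auto
  have Lm: "L (x \<otimes> y) = L x \<otimes> y" "R (x \<otimes> y) = x \<otimes> R y" "R x \<otimes> y = x \<otimes> L y"
    if "x \<in> carrier A" "y \<in> carrier A" for x y
    using uniq [OF L [of "x \<otimes> y"], of "L x \<otimes> y"] conv_mult_right [OF that(2) L [of x]]
      uniq [OF R [of "x \<otimes> y"], of "x \<otimes> R y"] conv_mult_left [OF that(1) R [of y]]
      uniq [OF conv_mult_right [OF that(2) R [of x]], of "x \<otimes> L y"] conv_mult_left [OF that(1) L [of y]] that X
    by (simp_all add: mult_assoc)
  define m where "m = (restrict L (carrier A), restrict R (carrier A))"
  have "\<exists>K. \<forall>x\<in>carrier A. \<parallel>L x\<parallel> \<le> K * \<parallel>x\<parallel>" "\<exists>K. \<forall>x\<in>carrier A. \<parallel>R x\<parallel> \<le> K * \<parallel>x\<parallel>"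
    using Lb by blast+
  then have "m \<in> carrier MA"
    unfolding multiplier_iff blin_def using LR Ladd Lsm Lm by (auto simp: m_def)
  then show thesis by (rule that) (use L R in \<open>auto simp: m_def\<close>)
qed

text \<open>The adjoint is conjugate-linear, so \<open>blin_preimage\<close> does not cover it; it
  preserves the norm, which suffices.\<close>

lemma closed_subspace_adj:
  assumes "closed_subspace S A"
  shows "closed_subspace {x \<in> carrier A. x\<^sup>\<star> \<in> S} A"
proof (rule closed_subspaceI)
  fix x assume x: "x \<in> carrier A" and ap: "\<And>e. 0 < e \<Longrightarrow> \<exists>y\<in>{x \<in> carrier A. x\<^sup>\<star> \<in> S}. \<parallel>x \<ominus> y\<parallel> < e"
  have "x\<^sup>\<star> \<in> S"
  proof (rule closed_subspace_approx [OF assms])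
    fix e :: real assume "e > 0"
    then obtain y where y: "y \<in> carrier A" "y\<^sup>\<star> \<in> S" "\<parallel>x \<ominus> y\<parallel> < e" using ap by blast
    then have "\<parallel>x\<^sup>\<star> \<ominus> y\<^sup>\<star>\<parallel> < e" using x by (simp add: adj_minus [symmetric])
    then show "\<exists>y\<in>S. \<parallel>x\<^sup>\<star> \<ominus> y\<parallel> < e" using y by blast
  qed (use x in simp)
  then show "x \<in> {x \<in> carrier A. x\<^sup>\<star> \<in> S}" using x by simp
qed (use assms in \<open>auto simp: adj_add adj_smult closed_subspace_add closed_subspace_smult closed_subspace_zero\<close>)

text \<open>Nondegeneracy is stated with products in one order; this turns it into the statement
  with the other order, as \<open>strict_limit_exists\<close> requires both.\<close>

lemma closed_span_adj:
  assumes "X \<subseteq> carrier A" "closed_span A X = carrier A" "\<And>x. x \<in> X \<Longrightarrow> x\<^sup>\<star> \<in> Y" "Y \<subseteq> carrier A"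
  shows "closed_span A Y = carrier A"
proof
  show "closed_span A Y \<subseteq> carrier A" by (rule closed_span_sub_carrier) fact
  have "closed_span A X \<subseteq> {x \<in> carrier A. x\<^sup>\<star> \<in> closed_span A Y}"
    by (rule closed_span_least [OF closed_subspace_adj [OF closed_span_subspace]])
      (use assms closed_span_superset [of Y] in auto)
  then show "carrier A \<subseteq> closed_span A Y"
    using assms(2) by (metis (no_types, lifting) adj_adj adj_closed mem_Collect_eq subsetD subsetI)
qed

end

section \<open>Extending homomorphisms to multipliers\<close>

context two_cstar
begin

text \<open>Makes the definite description usable. An extension exists as the strict limit of
  \<open>\<phi> (v e\<^sub>i)\<close> along a bounded approximate unit \<open>e\<close>, and it is
  unique because its left action is prescribed on the spanning products
  \<open>\<phi>(a) b\<close>.\<close>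

lemma mult_extension_spec:
  assumes \<phi>: "star_hom (carrier A) A B \<phi>"
    and nd: "closed_span B {\<phi> a \<otimes>\<^bsub>B\<^esub> b | a b. a \<in> carrier A \<and> b \<in> carrier B} = carrier B"
    and v: "v \<in> carrier (multiplier_algebra A)" and F: "F \<noteq> bot"
    and e: "\<And>i. e i \<in> carrier A" "\<And>i. \<parallel>e i\<parallel>\<^bsub>A\<^esub> \<le> 1"
      "\<And>a. a \<in> carrier A \<Longrightarrow> A.conv (\<lambda>i. e i \<otimes>\<^bsub>A\<^esub> a) a F"
      "\<And>a. a \<in> carrier A \<Longrightarrow> A.conv (\<lambda>i. a \<otimes>\<^bsub>A\<^esub> e i) a F"
  shows "mult_extension A B \<phi> v \<in> carrier (multiplier_algebra B)"
    and "a \<in> carrier A \<Longrightarrow> fst (mult_extension A B \<phi> v) (\<phi> a) = \<phi> (fst v a)"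
    and "a \<in> carrier A \<Longrightarrow> snd (mult_extension A B \<phi> v) (\<phi> a) = \<phi> (snd v a)"
proof -
  let ?P = "\<lambda>m'. m' \<in> carrier (multiplier_algebra B) \<and>
     (\<forall>a\<in>carrier A. fst m' (\<phi> a) = \<phi> (fst v a) \<and> snd m' (\<phi> a) = \<phi> (snd v a))"
  let ?D = "{\<phi> a \<otimes>\<^bsub>B\<^esub> b | a b. a \<in> carrier A \<and> b \<in> carrier B}"
  let ?G = "{b \<otimes>\<^bsub>B\<^esub> \<phi> a | a b. a \<in> carrier A \<and> b \<in> carrier B}"
  note cl = star_hom_closed [OF \<phi>]
  have Dc: "?D \<subseteq> carrier B" "?G \<subseteq> carrier B" using cl by auto
  have Gspan: "closed_span B ?G = carrier B"
  proof (rule B.closed_span_adj [OF Dc(1) nd _ Dc(2)])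
    fix x assume "x \<in> ?D"
    then obtain a b where "x = \<phi> a \<otimes>\<^bsub>B\<^esub> b" "a \<in> carrier A" "b \<in> carrier B" by blast
    then have "x\<^sup>\<star>\<^bsub>B\<^esub> = b\<^sup>\<star>\<^bsub>B\<^esub> \<otimes>\<^bsub>B\<^esub> \<phi> (a\<^sup>\<star>\<^bsub>A\<^esub>)" using cl by (simp add: B.adj_mult star_hom_adj [OF \<phi>])
    then show "x\<^sup>\<star>\<^bsub>B\<^esub> \<in> ?G" using \<open>a \<in> _\<close> \<open>b \<in> _\<close> A.adj_closed B.adj_closed by blast
  qed
  have bl: "blin (carrier A) A B \<phi>" by (rule star_hom_blin [OF A.cstar_subalgebra_carrier \<phi>])
  have ctr: "\<parallel>\<phi> x\<parallel>\<^bsub>B\<^esub> \<le> \<parallel>x\<parallel>\<^bsub>A\<^esub>" if "x \<in> carrier A" for x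
    by (rule star_hom_contractive [OF A.cstar_subalgebra_carrier \<phi> that])
  have conv\<phi>: "B.conv (\<lambda>i. \<phi> (f i)) (\<phi> l) F" if f: "A.conv f l F" "\<And>i. f i \<in> carrier A" for f l
  proof (rule B.conv_I)
    have l: "l \<in> carrier A" using f(1) by (rule A.conv_carrier)
    then show "\<phi> l \<in> carrier B" by (rule cl)
    show "\<forall>\<^sub>F i in F. \<phi> (f i) \<in> carrier B \<and> \<parallel>\<phi> (f i) \<ominus>\<^bsub>B\<^esub> \<phi> l\<parallel>\<^bsub>B\<^esub> \<le> \<parallel>f i \<ominus>\<^bsub>A\<^esub> l\<parallel>\<^bsub>A\<^esub>"
      using f(2) l cl ctr by (auto simp: blin_minus [OF A.closed_subspace_carrier bl, symmetric])
    show "((\<lambda>i. \<parallel>f i \<ominus>\<^bsub>A\<^esub> l\<parallel>\<^bsub>A\<^esub>) \<longlongrightarrow> 0) F" using f(1) by (simp add: A.conv_def)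
  qed
  have vin: "fst v x \<in> carrier A" "snd v x \<in> carrier A" if "x \<in> carrier A" for x
    using A.multiplier_fst_in [OF v that] A.multiplier_snd_in [OF v that] by auto
  interpret AA: two_cstar A A by (rule A.two_cstar_self)
  obtain K where K: "K > 0" "\<And>x. x \<in> carrier A \<Longrightarrow> \<parallel>fst v x\<parallel>\<^bsub>A\<^esub> \<le> K * \<parallel>x\<parallel>\<^bsub>A\<^esub>"
    using AA.blin_bound [OF A.multiplier_fst_blin [OF v]] by blast
  have vm: "fst v (x \<ominus>\<^bsub>A\<^esub> y) = fst v x \<ominus>\<^bsub>A\<^esub> fst v y" if "x \<in> carrier A" "y \<in> carrier A" for x y
    using AA.blin_minus [OF A.closed_subspace_carrier A.multiplier_fst_blin [OF v]] that by blast
  \<comment> \<open>On the left \<open>X i \<otimes> \<phi> a\<close> is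
    \<open>\<phi> (v (e i \<otimes> a))\<close>. On the right the multiplier is first moved to the
    other factor, \<open>a (v e\<^sub>i) = (a v) e\<^sub>i\<close>, before the limit is
    taken.\<close>
  define X where "X i = \<phi> (fst v (e i))" for i
  have Xc: "X i \<in> carrier B" for i using cl vin e by (simp add: X_def)
  have Xb: "\<parallel>X i\<parallel>\<^bsub>B\<^esub> \<le> K" for i
  proof -
    have "\<parallel>X i\<parallel>\<^bsub>B\<^esub> \<le> K * \<parallel>e i\<parallel>\<^bsub>A\<^esub>" unfolding X_def using ctr [OF vin(1) [OF e(1)], of i] K(2) [OF e(1), of i] by linarith
    also have "\<dots> \<le> K * 1" using K(1) e(2) by (intro mult_left_mono) auto
    finally show ?thesis by simp
  qed
  have left: "B.conv (\<lambda>i. X i \<otimes>\<^bsub>B\<^esub> \<phi> a) (\<phi> (fst v a)) F" if a: "a \<in> carrier A" for a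
  proof -
    have "A.conv (\<lambda>i. fst v (e i \<otimes>\<^bsub>A\<^esub> a)) (fst v a) F"
      by (rule A.conv_bounded_linear [OF e(3) [OF a], of "fst v" K])
        (use vin K in \<open>auto simp: vm [symmetric]\<close>)
    from conv\<phi> [OF this] show ?thesis
      using a e vin by (simp add: X_def star_hom_mult [OF \<phi>] A.multiplier_fst_mult [OF v])
  qed
  have right: "B.conv (\<lambda>i. \<phi> a \<otimes>\<^bsub>B\<^esub> X i) (\<phi> (snd v a)) F" if a: "a \<in> carrier A" for a
  proof -
    have "\<phi> a \<otimes>\<^bsub>B\<^esub> X i = \<phi> (snd v a \<otimes>\<^bsub>A\<^esub> e i)" for i
      using a e vin by (simp add: X_def star_hom_mult [OF \<phi>, symmetric] A.multiplier_mid [OF v])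
    then show ?thesis using conv\<phi> [OF e(4) [OF vin(2) [OF a]]] a e vin by simp
  qed
  obtain m where m: "m \<in> carrier (multiplier_algebra B)"
    "\<And>a. a \<in> carrier B \<Longrightarrow> B.conv (\<lambda>i. X i \<otimes>\<^bsub>B\<^esub> a) (fst m a) F"
    "\<And>a. a \<in> carrier B \<Longrightarrow> B.conv (\<lambda>i. a \<otimes>\<^bsub>B\<^esub> X i) (snd m a) F"
  proof (rule B.strict_limit_exists [OF F, of X K ?D ?G])
    fix d assume "d \<in> ?D"
    then obtain a b where d: "d = \<phi> a \<otimes>\<^bsub>B\<^esub> b" and ab: "a \<in> carrier A" "b \<in> carrier B" by blast
    have "B.conv (\<lambda>i. X i \<otimes>\<^bsub>B\<^esub> d) (\<phi> (fst v a) \<otimes>\<^bsub>B\<^esub> b) F"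
      using B.conv_mult_right [OF ab(2) left [OF ab(1)]] ab cl Xc by (simp add: d B.mult_assoc)
    then show "\<exists>l. B.conv (\<lambda>i. X i \<otimes>\<^bsub>B\<^esub> d) l F" by blast
  next
    fix d assume "d \<in> ?G"
    then obtain a b where d: "d = b \<otimes>\<^bsub>B\<^esub> \<phi> a" and ab: "a \<in> carrier A" "b \<in> carrier B" by blast
    have "B.conv (\<lambda>i. d \<otimes>\<^bsub>B\<^esub> X i) (b \<otimes>\<^bsub>B\<^esub> \<phi> (snd v a)) F"
      using B.conv_mult_left [OF ab(2) right [OF ab(1)]] ab cl Xc by (simp add: d B.mult_assoc)
    then show "\<exists>l. B.conv (\<lambda>i. d \<otimes>\<^bsub>B\<^esub> X i) l F" by blast
  qed (use Xc Xb Dc nd Gspan in auto)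
  have Pm: "?P m"
    using m B.conv_unique [OF m(2) left F] B.conv_unique [OF m(3) right F] cl by blast
  have "m' = m" if m': "?P m'" for m'
  proof (rule B.multiplier_eqI [OF _ m(1) Dc(1) nd])
    show "fst m' x = fst m x" if x: "x \<in> ?D" for x
    proof -
      obtain a b where "x = \<phi> a \<otimes>\<^bsub>B\<^esub> b" "a \<in> carrier A" "b \<in> carrier B" using x by blast
      then show ?thesis using m' Pm cl B.multiplier_fst_mult by metis
    qed
  qed (use m' in blast)
  then have "?P (mult_extension A B \<phi> v)"
    unfolding mult_extension_def using Pm by (intro theI [of ?P m]) blast+
  then show "mult_extension A B \<phi> v \<in> carrier (multiplier_algebra B)"
    and "a \<in> carrier A \<Longrightarrow> fst (mult_extension A B \<phi> v) (\<phi> a) = \<phi> (fst v a)"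
    and "a \<in> carrier A \<Longrightarrow> snd (mult_extension A B \<phi> v) (\<phi> a) = \<phi> (snd v a)"
    by blast+
qed

end

section \<open>Conjugation by an isometry\<close>

context cstar_algebra
begin

text \<open>With \<open>a\<^sup>\<star> \<otimes> b\<close> read as an inner product of
  \<open>a\<close> and \<open>b\<close>, this moves a multiplier to the other side as its
  adjoint.\<close>

lemma multiplier_adj_left:
  assumes "m \<in> carrier MA" "a \<in> carrier A" "b \<in> carrier A"
  shows "(fst m a)\<^sup>\<star> \<otimes> b = a\<^sup>\<star> \<otimes> fst (m\<^sup>\<star>\<^bsub>MA\<^esub>) b"
proof -
  have "(b\<^sup>\<star> \<otimes> fst m a)\<^sup>\<star> = (snd m (b\<^sup>\<star>) \<otimes> a)\<^sup>\<star>" using assms by (simp add: multiplier_mid)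
  then show ?thesis
    using assms by (simp add: adj_mult fst_multiplier_adj multiplier_fst_in multiplier_snd_in)
qed

text \<open>The product \<open>W c W\<^sup>\<star>\<close> as an element of the algebra rather than
  of the multiplier algebra. Only left multiplication by \<open>W\<close> occurs: applied to the
  adjoint of \<open>W c\<close> it gives \<open>W c\<^sup>\<star> W\<^sup>\<star>\<close>, and a
  last adjoint restores \<open>c\<close>.\<close>

definition Ad :: "('a \<Rightarrow> 'a) \<times> ('a \<Rightarrow> 'a) \<Rightarrow> 'a \<Rightarrow> 'a" where
  "Ad W c = (fst W ((fst W c)\<^sup>\<star>))\<^sup>\<star>"

context
  fixes W assumes W: "isometry_in A W"
begin

lemma isometry_in_multiplier: "W \<in> carrier MA"
  using W by (simp add: isometry_in_def)

lemma isometry_adj_in: "W\<^sup>\<star>\<^bsub>MA\<^esub> \<in> carrier MA"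
  by (rule multiplier_adj_in [OF isometry_in_multiplier])

lemmas isometry_fst_in [simp] = multiplier_fst_in [OF isometry_in_multiplier]
lemmas isometry_adj_fst_in [simp] = multiplier_fst_in [OF isometry_adj_in]

lemma isometry_cancel: "a \<in> carrier A \<Longrightarrow> fst (W\<^sup>\<star>\<^bsub>MA\<^esub>) (fst W a) = a"
  using W fst_multiplier_mult [of a "W\<^sup>\<star>\<^bsub>MA\<^esub>" W] by (simp add: isometry_in_def fst_multiplier_one)

lemma Ad_in [simp]: "c \<in> carrier A \<Longrightarrow> Ad W c \<in> carrier A"
  by (simp add: Ad_def)

lemma Ad_mult_right: "\<lbrakk>c \<in> carrier A; x \<in> carrier A\<rbrakk> \<Longrightarrow> Ad W c \<otimes> x = fst W c \<otimes> fst (W\<^sup>\<star>\<^bsub>MA\<^esub>) x"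
  by (simp add: Ad_def multiplier_adj_left [OF isometry_in_multiplier])

lemma Ad_eqI:
  assumes "c \<in> carrier A" "z \<in> carrier A"
    "\<And>x. x \<in> carrier A \<Longrightarrow> z \<otimes> x = fst W c \<otimes> fst (W\<^sup>\<star>\<^bsub>MA\<^esub>) x"
  shows "Ad W c = z"
  by (rule eq_of_right_mult) (use assms in \<open>auto simp: Ad_mult_right\<close>)

lemma Ad_outer: "\<lbrakk>c \<in> carrier A; d \<in> carrier A\<rbrakk> \<Longrightarrow> Ad W (c \<otimes> d\<^sup>\<star>) = fst W c \<otimes> (fst W d)\<^sup>\<star>"
  by (rule Ad_eqI)
    (auto simp: multiplier_fst_mult [OF isometry_in_multiplier] mult_assoc
      multiplier_adj_left [OF isometry_in_multiplier])

text \<open>The isometry relation enters here, cancelling \<open>W\<^sup>\<star> W\<close> in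
  \<open>(W c W\<^sup>\<star>) (W x)\<close>. Multiplicativity of \<open>Ad W\<close> follows from
  this.\<close>

lemma Ad_fst: "\<lbrakk>c \<in> carrier A; x \<in> carrier A\<rbrakk> \<Longrightarrow> Ad W c \<otimes> fst W x = fst W (c \<otimes> x)"
  by (simp add: Ad_mult_right isometry_cancel multiplier_fst_mult [OF isometry_in_multiplier])

lemma mult_of_Ad:
  assumes c: "c \<in> carrier A"
  shows "mult_of A (Ad W c) = W \<otimes>\<^bsub>MA\<^esub> mult_of A c \<otimes>\<^bsub>MA\<^esub> W\<^sup>\<star>\<^bsub>MA\<^esub>"
  by (rule multiplier_eqI')
    (use c in \<open>auto simp: fst_mult_of fst_multiplier_mult Ad_mult_right
      multiplier_fst_mult [OF isometry_in_multiplier]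
      intro!: mult_of_in multiplier_mult_in isometry_in_multiplier isometry_adj_in\<close>)

lemma star_hom_Ad: "star_hom (carrier A) A A (Ad W)"
  unfolding star_hom_def
proof (intro conjI ballI allI)
  interpret two_cstar A A by (rule two_cstar_self)
  note bl = multiplier_fst_blin [OF isometry_in_multiplier]
  fix x y assume xy: "x \<in> carrier A" "y \<in> carrier A"
  show "Ad W (x \<oplus> y) = Ad W x \<oplus> Ad W y"
    by (rule Ad_eqI) (use xy in \<open>auto simp: mult_distrib_right Ad_mult_right blin_add [OF bl]\<close>)
  show "Ad W (x \<otimes> y) = Ad W x \<otimes> Ad W y"
  proof (rule Ad_eqI)
    fix z assume z: "z \<in> carrier A"
    have "Ad W y \<otimes> z = fst W (y \<otimes> fst (W\<^sup>\<star>\<^bsub>MA\<^esub>) z)"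
      using xy z by (simp add: Ad_mult_right multiplier_fst_mult [OF isometry_in_multiplier])
    then have "Ad W x \<otimes> Ad W y \<otimes> z = Ad W x \<otimes> fst W (y \<otimes> fst (W\<^sup>\<star>\<^bsub>MA\<^esub>) z)"
      using xy z by (simp add: mult_assoc del: Ad_mult_right)
    also have "\<dots> = fst W (x \<otimes> (y \<otimes> fst (W\<^sup>\<star>\<^bsub>MA\<^esub>) z))"
      using xy z by (intro Ad_fst) auto
    also have "\<dots> = fst W (x \<otimes> y) \<otimes> fst (W\<^sup>\<star>\<^bsub>MA\<^esub>) z"
      using xy z by (simp add: mult_assoc [symmetric] multiplier_fst_mult [OF isometry_in_multiplier, symmetric])
    finally show "Ad W x \<otimes> Ad W y \<otimes> z = fst W (x \<otimes> y) \<otimes> fst (W\<^sup>\<star>\<^bsub>MA\<^esub>) z" .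
  qed (use xy in auto)
next
  interpret two_cstar A A by (rule two_cstar_self)
  note bl = multiplier_fst_blin [OF isometry_in_multiplier]
  fix c x assume x: "x \<in> carrier A"
  show "Ad W (c \<odot> x) = c \<odot> Ad W x"
    by (rule Ad_eqI) (use x in \<open>auto simp: smult_mult_left Ad_mult_right blin_smult [OF bl]\<close>)
next
  fix x assume x: "x \<in> carrier A"
  show "Ad W (x\<^sup>\<star>) = (Ad W x)\<^sup>\<star>"
  proof (rule Ad_eqI)
    fix z assume z: "z \<in> carrier A"
    have "(Ad W x)\<^sup>\<star> \<otimes> z = fst W ((fst W x)\<^sup>\<star> \<otimes> z)"
      using x z by (simp add: Ad_def multiplier_fst_mult [OF isometry_in_multiplier])
    then show "(Ad W x)\<^sup>\<star> \<otimes> z = fst W (x\<^sup>\<star>) \<otimes> fst (W\<^sup>\<star>\<^bsub>MA\<^esub>) z"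
      using x z by (simp add: multiplier_adj_left [OF isometry_in_multiplier]
          multiplier_fst_mult [OF isometry_in_multiplier])
  qed (use x in auto)
qed auto

end

end

lemma star_hom_compose:
  assumes "star_hom S A B \<phi>" "star_hom T B D \<psi>" "\<And>x. x \<in> S \<Longrightarrow> \<phi> x \<in> T"
  shows "star_hom S A D (\<lambda>x. \<psi> (\<phi> x))"
  using assms unfolding star_hom_def by simp

lemma star_hom_subset: "star_hom S A B \<phi> \<Longrightarrow> T \<subseteq> S \<Longrightarrow> star_hom T A B \<phi>"
  unfolding star_hom_def by blast

lemma star_hom_ident: "S \<subseteq> carrier A \<Longrightarrow> star_hom S A A (\<lambda>x. x)"
  unfolding star_hom_def by blast

context two_cstar
begin

lemma star_hom_equalizer:
  assumes "cstar_subalgebra S A" "star_hom S A B \<phi>" "star_hom S A B \<psi>"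
  shows "cstar_subalgebra {x \<in> S. \<phi> x = \<psi> x} A"
  unfolding cstar_subalgebra_def
proof (intro conjI ballI)
  show "closed_subspace {x \<in> S. \<phi> x = \<psi> x} A"
    by (rule blin_equalizer) (use assms star_hom_blin A.cstar_subalgebra_subspace in auto)
qed (use assms A.cstar_subalgebra_mult A.cstar_subalgebra_adj in
    \<open>auto simp: star_hom_mult [OF assms(2)] star_hom_mult [OF assms(3)] star_hom_adj [OF assms(2)]
      star_hom_adj [OF assms(3)]\<close>)

lemma star_hom_finsum:
  assumes "cstar_subalgebra S A" "star_hom S A B \<phi>" "\<And>i. i \<in> I \<Longrightarrow> f i \<in> S"
  shows "\<phi> (finsum A f I) = finsum B (\<lambda>i. \<phi> (f i)) I"
  by (rule blin_finsum [OF A.cstar_subalgebra_subspace star_hom_blin]) fact+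

end

section \<open>Graph algebras and their cores\<close>

text \<open>The universe is the type of \<open>A\<close> itself: the universal property serves here
  to map \<open>A\<close> to itself, for the gauge action.\<close>

locale graph_cstar = cstar_algebra A for A :: "'a cstar" (structure) +
  fixes E :: "('v, 'e) pre_digraph" and p :: "'v \<Rightarrow> 'a" and t :: "'e \<Rightarrow> 'a"
  assumes wf: "wf_digraph E"
    and locally_finite: "v \<in> verts E \<Longrightarrow> finite (in_arcs E v) \<and> finite (out_arcs E v)"
    and no_sources_or_sinks: "v \<in> verts E \<Longrightarrow> in_arcs E v \<noteq> {} \<and> out_arcs E v \<noteq> {}"
    and graph_algebra: "graph_algebra TYPE('a) E A p t"
begin

lemma arc_verts [simp]: "e \<in> arcs E \<Longrightarrow> tail E e \<in> verts E" "e \<in> arcs E \<Longrightarrow> head E e \<in> verts E"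
  using wf by (simp_all add: wf_digraph_def)

lemma family: "cuntz_krieger_family E A p t"
  and generated: "generated_cstar A (p ` verts E \<union> t ` arcs E) = carrier A"
  and universal: "\<lbrakk>cstar_algebra (D :: 'a cstar); cuntz_krieger_family E D P T\<rbrakk> \<Longrightarrow>
      \<exists>\<phi>\<in>cstar_hom A D. (\<forall>v\<in>verts E. \<phi> (p v) = P v) \<and> (\<forall>e\<in>arcs E. \<phi> (t e) = T e)"
  using graph_algebra by (auto simp: graph_algebra_def)

lemma p_projection: "v \<in> verts E \<Longrightarrow> projection A (p v)"
  using family by (auto simp: cuntz_krieger_family_def)

lemma p_simps [simp]:
  "v \<in> verts E \<Longrightarrow> p v \<in> carrier A" "v \<in> verts E \<Longrightarrow> p v \<otimes> p v = p v" "v \<in> verts E \<Longrightarrow> (p v)\<^sup>\<star> = p v"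
  using p_projection by (auto dest: projectionD)

lemma p_orth: "\<lbrakk>v \<in> verts E; w \<in> verts E; v \<noteq> w\<rbrakk> \<Longrightarrow> p v \<otimes> p w = \<zero>"
  using family by (auto simp: cuntz_krieger_family_def)

lemma t_in [simp]: "e \<in> arcs E \<Longrightarrow> t e \<in> carrier A"
  using family by (auto simp: cuntz_krieger_family_def partial_isometry_def)

lemma t_adj_t: "e \<in> arcs E \<Longrightarrow> (t e)\<^sup>\<star> \<otimes> t e = p (tail E e)"
  using family by (auto simp: cuntz_krieger_family_def)

definition q :: "'e \<Rightarrow> 'a" where
  "q e = t e \<otimes> (t e)\<^sup>\<star>"

lemma q_in [simp]: "e \<in> arcs E \<Longrightarrow> q e \<in> carrier A"
  by (simp add: q_def)

lemma q_t: "e \<in> arcs E \<Longrightarrow> q e \<otimes> t e = t e"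
  using family by (auto simp: q_def cuntz_krieger_family_def partial_isometry_def)

lemma t_p: "e \<in> arcs E \<Longrightarrow> t e \<otimes> p (tail E e) = t e"
  using q_t by (simp add: q_def mult_assoc t_adj_t [symmetric])

lemma q_projection: "e \<in> arcs E \<Longrightarrow> projection A (q e)"
  unfolding projection_def
  using q_t [of e] by (simp add: q_def adj_mult) (metis adj_closed mult_assoc mult_closed t_in)

lemma p_eq_sum: "v \<in> verts E \<Longrightarrow> p v = finsum A q (in_arcs E v)"
  using family unfolding cuntz_krieger_family_def q_def by blast

text \<open>Not one of the Cuntz-Krieger relations, but forced by them: at each vertex the finitely
  many \<open>q e\<close> are projections whose sum is the projection \<open>p v\<close>.\<close>

lemma q_orth:
  assumes "e \<in> arcs E" "f \<in> arcs E" "head E e = head E f" "e \<noteq> f"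
  shows "q e \<otimes> q f = \<zero>"
proof (rule projections_orthogonal [of "in_arcs E (head E e)"])
  show "finite (in_arcs E (head E e))" using assms locally_finite by simp
  show "projection A (finsum A q (in_arcs E (head E e)))"
    using p_eq_sum p_projection assms by (metis arc_verts(2))
qed (use assms q_projection in auto)

lemma p_t: "e \<in> arcs E \<Longrightarrow> p (head E e) \<otimes> t e = t e"
proof -
  assume e: "e \<in> arcs E"
  have "p (head E e) \<otimes> t e = finsum A (\<lambda>f. q f \<otimes> t e) (in_arcs E (head E e))"
    unfolding p_eq_sum [OF arc_verts(2) [OF e]] by (rule finsum_mult_right) (use e in auto)
  also have "\<dots> = q e \<otimes> t e"
  proof (rule finsum_single)
    fix f assume f: "f \<in> in_arcs E (head E e)" "f \<noteq> e"
    have "q f \<otimes> t e = (q f \<otimes> q e) \<otimes> t e" using e f q_t [OF e] by (simp add: mult_assoc)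
    then show "q f \<otimes> t e = \<zero>" using q_orth [of f e] e f by simp
  qed (use e locally_finite in auto)
  finally show ?thesis by (simp add: q_t e)
qed

lemma p_t_zero: "\<lbrakk>e \<in> arcs E; v \<in> verts E; v \<noteq> head E e\<rbrakk> \<Longrightarrow> p v \<otimes> t e = \<zero>"
  using p_t [of e] p_orth [of v "head E e"] mult_assoc [of "p v" "p (head E e)" "t e"] by simp

lemma t_p_zero: "\<lbrakk>e \<in> arcs E; v \<in> verts E; v \<noteq> tail E e\<rbrakk> \<Longrightarrow> t e \<otimes> p v = \<zero>"
  using t_p [of e] p_orth [of "tail E e" v] mult_assoc [of "t e" "p (tail E e)" "p v"] by simp

lemma adj_t_p: "e \<in> arcs E \<Longrightarrow> (t e)\<^sup>\<star> \<otimes> p (head E e) = (t e)\<^sup>\<star>"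
  using arg_cong [OF p_t, of e "\<lambda>x. x\<^sup>\<star>"] by (simp add: adj_mult)

lemma adj_t_q: "e \<in> arcs E \<Longrightarrow> (t e)\<^sup>\<star> \<otimes> q e = (t e)\<^sup>\<star>"
  using arg_cong [OF q_t, of e "\<lambda>x. x\<^sup>\<star>"] projectionD [OF q_projection, of e] by (simp add: adj_mult)

text \<open>Edges with a common range are separated by their range projections, edges with distinct
  ranges by the vertex projections.\<close>

lemma t_orth:
  assumes e: "e \<in> arcs E" "f \<in> arcs E" "e \<noteq> f"
  shows "(t e)\<^sup>\<star> \<otimes> t f = \<zero>"
proof (cases "head E e = head E f")
  case True
  have "(t e)\<^sup>\<star> \<otimes> t f = ((t e)\<^sup>\<star> \<otimes> q e) \<otimes> (q f \<otimes> t f)" using e by (simp add: adj_t_q q_t)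
  also have "\<dots> = (t e)\<^sup>\<star> \<otimes> ((q e \<otimes> q f) \<otimes> t f)" using e by (simp add: mult_assoc)
  finally show ?thesis using q_orth [of e f] e True by simp
next
  case False
  have "(t e)\<^sup>\<star> \<otimes> t f = ((t e)\<^sup>\<star> \<otimes> p (head E e)) \<otimes> (p (head E f) \<otimes> t f)" using e by (simp add: adj_t_p p_t)
  also have "\<dots> = (t e)\<^sup>\<star> \<otimes> ((p (head E e) \<otimes> p (head E f)) \<otimes> t f)" using e by (simp add: mult_assoc)
  finally show ?thesis using p_orth [of "head E e" "head E f"] e False by simp
qed

text \<open>\<open>tpath n r s x\<close>: the element \<open>x\<close> is \<open>t\<^sub>\<mu>\<close> for some path \<open>\<mu>\<close> of length \<open>n\<close> with range \<open>r\<close> and source \<open>s\<close>.\<close>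

inductive tpath :: "nat \<Rightarrow> 'v \<Rightarrow> 'v \<Rightarrow> 'a \<Rightarrow> bool" where
  tpath_vertex: "v \<in> verts E \<Longrightarrow> tpath 0 v v (p v)"
| tpath_edge: "\<lbrakk>tpath n r s x; e \<in> arcs E; tail E e = r\<rbrakk> \<Longrightarrow> tpath (Suc n) (head E e) s (t e \<otimes> x)"

lemma
  assumes "tpath n r s x"
  shows tpath_in: "x \<in> carrier A" and tpath_range: "r \<in> verts E" and tpath_source: "s \<in> verts E"
    and p_tpath: "p r \<otimes> x = x"
proof -
  have "x \<in> carrier A \<and> r \<in> verts E \<and> s \<in> verts E \<and> p r \<otimes> x = x"
    using assms
  proof induction
    case (tpath_edge n r s x e)
    then show ?case using p_t by (simp add: mult_assoc [symmetric])
  qed simp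
  then show "x \<in> carrier A" "r \<in> verts E" "s \<in> verts E" "p r \<otimes> x = x" by simp_all
qed

text \<open>The inductive definition adds edges at the range. Adding one at the source is needed
  when the adjoint of an edge meets a path of length zero and is absorbed into the path on the
  right.\<close>

lemma tpath_snoc:
  assumes "tpath n r s x" "e \<in> arcs E" "head E e = s"
  shows "tpath (Suc n) r (tail E e) (x \<otimes> t e)"
  using assms
proof induction
  case (tpath_vertex v)
  then show ?case
    using tpath_edge [OF tpath.tpath_vertex [of "tail E e"], of e] p_t [of e] t_p [of e] by simp
next
  case (tpath_edge n r s x f)
  then show ?case
    using tpath.tpath_edge [of "Suc n" r "tail E e" "x \<otimes> t e" f] tpath_in by (simp add: mult_assoc)
qed

definition span_set :: "'a set" where
  "span_set = {x \<otimes> y\<^sup>\<star> | x y. \<exists>n m r r' s. tpath n r s x \<and> tpath m r' s y}"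

lemma span_set_in: "span_set \<subseteq> carrier A"
  by (auto simp: span_set_def tpath_in)

lemma span_setI: "tpath n r s x \<Longrightarrow> tpath m r' s y \<Longrightarrow> x \<otimes> y\<^sup>\<star> \<in> span_set"
  unfolding span_set_def by blast

text \<open>The product with a vertex projection or an edge keeps or prolongs the left path, or
  vanishes. The adjoint of an edge cancels the first edge of the left path, or prolongs the right
  path when the left one is a vertex, or gives zero.\<close>

lemma span_set_left_mult:
  assumes "a \<in> p ` verts E \<union> t ` arcs E \<union> (\<lambda>e. (t e)\<^sup>\<star>) ` arcs E" "z \<in> span_set"
  shows "a \<otimes> z \<in> span_set \<union> {\<zero>}"
proof -
  obtain x y n m r r' s where z: "z = x \<otimes> y\<^sup>\<star>" and x: "tpath n r s x" and y: "tpath m r' s y"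
    using assms(2) unfolding span_set_def by blast
  have c [simp]: "x \<in> carrier A" "y \<in> carrier A" "r \<in> verts E" "s \<in> verts E"
    using x y tpath_in tpath_range tpath_source by blast+
  have ac: "a \<in> carrier A" using assms(1) by auto
  have az: "a \<otimes> z = (a \<otimes> x) \<otimes> y\<^sup>\<star>" using ac by (simp add: z mult_assoc)
  have apr: "a \<otimes> x = (a \<otimes> p r) \<otimes> x" using ac p_tpath [OF x] by (simp add: mult_assoc)
  consider v where "a = p v" "v \<in> verts E" | e where "a = t e" "e \<in> arcs E" | e where "a = (t e)\<^sup>\<star>" "e \<in> arcs E"
    using assms(1) by blast
  then show ?thesis
  proof cases
    case 1
    then show ?thesis
      using p_tpath [OF x] apr az p_orth [of v r] span_setI [OF x y] by (cases "v = r") auto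
  next
    case 2
    then show ?thesis
      using apr az t_p_zero [of e r] span_setI [OF tpath_edge [OF x, of e] y]
      by (cases "tail E e = r") auto
  next
    case 3
    show ?thesis
    proof (cases "head E e = r")
      case False
      have "a \<otimes> p r = \<zero>"
        using 3 False arg_cong [OF p_t_zero [of e r], of "\<lambda>x. x\<^sup>\<star>"] by (simp add: adj_mult)
      then show ?thesis using apr az by simp
    next
      case True
      from x show ?thesis
      proof cases
        case tpath_vertex
        \<comment> \<open>The left path is a vertex, so
          \<open>t\<^sub>e\<^sup>\<star> y\<^sup>\<star>\<close> is the adjoint of
          \<open>y \<otimes> t e\<close>, with the vertex projection at \<open>s(e)\<close> as the
          new left factor.\<close>
        have "tpath (Suc m) r' (tail E e) (y \<otimes> t e)"
          by (rule tpath_snoc [OF y]) (use 3 True tpath_vertex in auto)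
        from span_setI [OF tpath.tpath_vertex [of "tail E e"] this]
        have "p (tail E e) \<otimes> (y \<otimes> t e)\<^sup>\<star> \<in> span_set" using 3 by simp
        also have "p (tail E e) \<otimes> (y \<otimes> t e)\<^sup>\<star> = (y \<otimes> (t e \<otimes> p (tail E e)))\<^sup>\<star>"
          using 3 by (simp add: adj_mult mult_assoc)
        also have "\<dots> = (t e)\<^sup>\<star> \<otimes> y\<^sup>\<star>" using 3 by (simp add: t_p adj_mult)
        also have "\<dots> = a \<otimes> z"
          using 3 True tpath_vertex adj_t_p [of e] az by simp
        finally show ?thesis by simp
      next
        case (tpath_edge k r0 x0 f)
        have x0: "x0 \<in> carrier A" "p (tail E f) \<otimes> x0 = x0"
          using tpath_in tpath_edge p_tpath by blast+
        have "a \<otimes> x = ((t e)\<^sup>\<star> \<otimes> t f) \<otimes> x0" using 3 tpath_edge x0 by (simp add: mult_assoc)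
        then show ?thesis
          using t_orth [of e f] t_adj_t [of e] 3 tpath_edge x0 span_setI [OF _ y, of k r0 x0]
            az by (cases "e = f") auto
      qed
    qed
  qed
qed

lemma adj_span_set: "z \<in> span_set \<Longrightarrow> z\<^sup>\<star> \<in> span_set"
  unfolding span_set_def using tpath_in by (fastforce simp: adj_mult)

text \<open>Products of two spanning elements are never computed. It is enough that each generator
  and its adjoint map the closed span into itself from the left: the elements with this property
  form a C*-subalgebra, hence are everything, and the closed span is itself a C*-subalgebra.\<close>

lemma closed_span_span_set: "closed_span A span_set = carrier A"
proof
  interpret two_cstar A A by (rule two_cstar_self)
  let ?X = "closed_span A span_set"
  have X: "closed_subspace ?X A" by (rule closed_span_subspace [OF span_set_in])
  show Xc: "?X \<subseteq> carrier A" by (rule closed_span_sub_carrier [OF span_set_in])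
  have Xadj: "x\<^sup>\<star> \<in> ?X" if "x \<in> ?X" for x
    using closed_span_least [OF closed_subspace_adj [OF X], of span_set] that span_set_in adj_span_set
      closed_span_superset [of span_set] by blast
  have gen: "a \<otimes> x \<in> ?X" if a: "a \<in> p ` verts E \<union> t ` arcs E \<union> (\<lambda>e. (t e)\<^sup>\<star>) ` arcs E" and x: "x \<in> ?X" for a x
  proof -
    have "a \<in> carrier A" using a by auto
    then have "closed_subspace {x \<in> carrier A. a \<otimes> x \<in> ?X} A"
      by (intro blin_preimage closed_subspace_carrier blin_mult_left X)
    then have "?X \<subseteq> {x \<in> carrier A. a \<otimes> x \<in> ?X}"
      using span_set_left_mult [OF a] closed_span_superset [of span_set] span_set_in closed_subspace_zero [OF X]
      by (intro closed_span_least) fastforce+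
    then show ?thesis using x by blast
  qed
  \<comment> \<open>The condition on the adjoint is built in so that \<open>S\<close> is closed
    under adjoints by definition.\<close>
  define S where "S = {a \<in> carrier A. \<forall>x\<in>?X. a \<otimes> x \<in> ?X \<and> a\<^sup>\<star> \<otimes> x \<in> ?X}"
  have "cstar_subalgebra S A"
    unfolding cstar_subalgebra_def
  proof (intro conjI ballI)
    have 1: "closed_subspace {a \<in> carrier A. a \<otimes> x \<in> ?X} A" if "x \<in> ?X" for x
      using that Xc by (intro blin_preimage closed_subspace_carrier blin_mult_right X) auto
    have 2: "closed_subspace {a \<in> carrier A. a\<^sup>\<star> \<in> {a \<in> carrier A. a \<otimes> x \<in> ?X}} A" if "x \<in> ?X" for x
      by (rule closed_subspace_adj [OF 1 [OF that]])
    have "S = \<Inter> ((\<lambda>x. {a \<in> carrier A. a \<otimes> x \<in> ?X}) ` ?X \<union>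
        (\<lambda>x. {a \<in> carrier A. a\<^sup>\<star> \<in> {a \<in> carrier A. a \<otimes> x \<in> ?X}}) ` ?X)"
      unfolding S_def using closed_subspace_zero [OF X] by auto
    then show "closed_subspace S A"
      using closed_subspace_Inter [of "(\<lambda>x. {a \<in> carrier A. a \<otimes> x \<in> ?X}) ` ?X \<union>
        (\<lambda>x. {a \<in> carrier A. a\<^sup>\<star> \<in> {a \<in> carrier A. a \<otimes> x \<in> ?X}}) ` ?X"] 1 2 closed_subspace_zero [OF X]
      by auto
  qed (use Xc in \<open>auto simp: S_def adj_mult mult_assoc subset_iff\<close>)
  moreover have "p ` verts E \<union> t ` arcs E \<subseteq> S"
    unfolding S_def using gen by fastforce
  ultimately have "generated_cstar A (p ` verts E \<union> t ` arcs E) \<subseteq> S" by (rule generated_least)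
  then have S: "S = carrier A" unfolding generated S_def by blast
  have "cstar_subalgebra ?X A"
    unfolding cstar_subalgebra_def using X Xadj S Xc unfolding S_def by blast
  moreover have "p v \<in> ?X" if "v \<in> verts E" for v
    using span_setI [OF tpath_vertex tpath_vertex, OF that that] closed_span_superset [of span_set] that by auto
  moreover have "t e \<in> ?X" if "e \<in> arcs E" for e
    using span_setI [OF tpath_edge [OF tpath_vertex] tpath_vertex, of "tail E e" e]
      closed_span_superset [of span_set] that by (auto simp: t_p)
  ultimately show "carrier A \<subseteq> ?X"
    using generated_least [of ?X "p ` verts E \<union> t ` arcs E"] generated by blast
qed

lemma hom_eq_on_generators:
  assumes D: "cstar_algebra D" and h: "star_hom (carrier A) A D \<phi>" "star_hom (carrier A) A D \<psi>"
    and eq: "\<And>v. v \<in> verts E \<Longrightarrow> \<phi> (p v) = \<psi> (p v)" "\<And>e. e \<in> arcs E \<Longrightarrow> \<phi> (t e) = \<psi> (t e)"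
    and x: "x \<in> carrier A"
  shows "\<phi> x = \<psi> x"
proof -
  interpret two_cstar A D by (intro two_cstar.intro cstar_algebra_axioms D)
  have "generated_cstar A (p ` verts E \<union> t ` arcs E) \<subseteq> {x \<in> carrier A. \<phi> x = \<psi> x}"
    by (rule generated_least [OF star_hom_equalizer [OF cstar_subalgebra_carrier h]]) (use eq in auto)
  then show ?thesis using x generated by auto
qed

end

section \<open>Averages over roots of unity\<close>

lemma unit_mult_cnj: "cmod z = 1 \<Longrightarrow> z * cnj z = 1" "cmod z = 1 \<Longrightarrow> cnj z * z = 1"
  by (simp_all add: complex_norm_square [symmetric] mult.commute [of "cnj z"])

definition unit_root :: "nat \<Rightarrow> complex" where
  "unit_root N = cis (2 * pi / real N)"

lemma norm_unit_root [simp]: "cmod (unit_root N) = 1"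
  by (simp add: unit_root_def)

text \<open>The summands are the powers of
  \<open>\<zeta> = \<omega>\<^sup>n\<^sup>-\<^sup>m\<close>, an \<open>N\<close>-th root of unity,
  so their sum vanishes unless \<open>\<zeta> = 1\<close>. As \<open>N\<close> exceeds
  \<open>n + m\<close>, it cannot divide a nonzero \<open>n - m\<close>.\<close>

lemma roots_of_unity_average:
  fixes n m N :: nat
  assumes N: "N > n + m"
  shows "(\<Sum>j<N. complex_of_real (1 / real N) * ((unit_root N ^ j) ^ n * cnj ((unit_root N ^ j) ^ m)))
    = (if n = m then 1 else 0)"
proof -
  define \<omega> where "\<omega> = unit_root N"
  define \<zeta> where "\<zeta> = \<omega> ^ n * cnj (\<omega> ^ m)"
  have pw: "(\<omega> ^ j) ^ n * cnj ((\<omega> ^ j) ^ m) = \<zeta> ^ j" for j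
    by (simp add: \<zeta>_def power_mult_distrib flip: power_mult) (simp add: mult.commute)
  have "\<zeta> = cis (real n * (2 * pi / real N)) * cis (- (real m * (2 * pi / real N)))"
    unfolding \<zeta>_def \<omega>_def unit_root_def Complex.DeMoivre cis_cnj ..
  then have \<zeta>: "\<zeta> = cis ((real n - real m) / real N * 2 * pi)"
    by (simp add: cis_mult algebra_simps diff_divide_distrib)
  have "\<omega> ^ N = 1" using N by (simp add: \<omega>_def unit_root_def Complex.DeMoivre)
  then have \<zeta>N: "\<zeta> ^ N = 1" using pw [of N] by simp
  have "(\<Sum>j<N. complex_of_real (1 / real N) * \<zeta> ^ j) = (if n = m then 1 else 0)"
  proof (cases "n = m")
    case True
    then show ?thesis using N by (simp add: \<zeta>)
  next
    case False
    have "\<zeta> \<noteq> 1"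
    proof
      assume "\<zeta> = 1"
      then have "cos ((real n - real m) / real N * 2 * pi) = 1" by (simp add: \<zeta> complex_eq_iff)
      then obtain k :: int where "(real n - real m) / real N * 2 * pi = of_int k * 2 * pi"
        using cos_one_2pi_int by blast
      then have "((real n - real m) / real N) * (2 * pi) = of_int k * (2 * pi)" by (simp only: mult.assoc)
      then have "(real n - real m) / real N = of_int k" by (subst (asm) mult_cancel_right) simp
      then have "real n - real m = of_int k * real N" using N by (simp add: field_simps)
      then have "of_int (int n - int m) = (of_int (k * int N) :: real)" by simp
      then have k: "int n - int m = k * int N" by (simp only: of_int_eq_iff)
      then have "k \<noteq> 0" using False by auto
      then have "int N \<le> \<bar>k * int N\<bar>" using mult_right_mono [of 1 "\<bar>k\<bar>" "int N"] by (simp add: abs_mult)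
      then show False using k N by linarith
    qed
    then have "(\<Sum>j<N. \<zeta> ^ j) = 0" by (simp add: geometric_sum \<zeta>N)
    then show ?thesis using False by (simp flip: sum_divide_distrib)
  qed
  then show ?thesis by (simp only: pw flip: \<omega>_def)
qed

section \<open>The gauge action and its fixed points\<close>

context graph_cstar
begin

lemma gauge_exists:
  assumes z: "cmod z = 1"
  obtains \<phi> where "star_hom (carrier A) A A \<phi>" "\<And>v. v \<in> verts E \<Longrightarrow> \<phi> (p v) = p v"
    "\<And>e. e \<in> arcs E \<Longrightarrow> \<phi> (t e) = z \<odot> t e"
proof -
  note zz = unit_mult_cnj [OF z]
  have "(z \<odot> t e) \<otimes> (z \<odot> t e)\<^sup>\<star> = t e \<otimes> (t e)\<^sup>\<star>" "(z \<odot> t e)\<^sup>\<star> \<otimes> (z \<odot> t e) = (t e)\<^sup>\<star> \<otimes> t e"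
    if "e \<in> arcs E" for e
    using that zz by (simp_all add: adj_smult smult_mult_left smult_mult_right)
  moreover have "t e \<otimes> (t e)\<^sup>\<star> \<otimes> (z \<odot> t e) = z \<odot> t e" if "e \<in> arcs E" for e
    using that q_t [of e] by (simp add: smult_mult_right q_def)
  ultimately have "cuntz_krieger_family E A p (\<lambda>e. z \<odot> t e)"
    using family by (auto simp: cuntz_krieger_family_def partial_isometry_def cong: M.finsum_cong)
  from universal [OF cstar_algebra_axioms this] show thesis
    using that by (auto simp: cstar_hom_iff)
qed

definition \<gamma> :: "complex \<Rightarrow> 'a \<Rightarrow> 'a" where
  "\<gamma> = gauge_action E A p t"

text \<open>The gauge action is a definite description over automorphisms. The universal property
  gives endomorphisms only; those for \<open>z\<close> and \<open>cnj z\<close> are mutually inverse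
  on generators, which makes them bijective, and agreement on generators gives uniqueness.\<close>

lemma
  assumes z: "cmod z = 1"
  shows gauge_hom: "star_hom (carrier A) A A (\<gamma> z)"
    and gauge_p: "v \<in> verts E \<Longrightarrow> \<gamma> z (p v) = p v"
    and gauge_t: "e \<in> arcs E \<Longrightarrow> \<gamma> z (t e) = z \<odot> t e"
proof -
  obtain \<phi> where \<phi>: "star_hom (carrier A) A A \<phi>" "\<And>v. v \<in> verts E \<Longrightarrow> \<phi> (p v) = p v"
    "\<And>e. e \<in> arcs E \<Longrightarrow> \<phi> (t e) = z \<odot> t e"
    using gauge_exists [OF z] by blast
  obtain \<psi> where \<psi>: "star_hom (carrier A) A A \<psi>" "\<And>v. v \<in> verts E \<Longrightarrow> \<psi> (p v) = p v"
    "\<And>e. e \<in> arcs E \<Longrightarrow> \<psi> (t e) = cnj z \<odot> t e"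
    using gauge_exists [of "cnj z"] z by auto
  note zz = unit_mult_cnj [OF z]
  note h = hom_eq_on_generators [OF cstar_algebra_axioms]
  note id = star_hom_ident [of "carrier A" A, OF order_refl]
  have "\<psi> (\<phi> x) = x" "\<phi> (\<psi> x) = x" if "x \<in> carrier A" for x
    using h [OF star_hom_compose [OF \<phi>(1) \<psi>(1)] id _ _ that] h [OF star_hom_compose [OF \<psi>(1) \<phi>(1)] id _ _ that]
      \<phi> \<psi> zz star_hom_closed [OF \<phi>(1)] star_hom_closed [OF \<psi>(1)]
    by (auto simp: star_hom_smult [OF \<phi>(1)] star_hom_smult [OF \<psi>(1)])
  then have bij: "bij_betw \<phi> (carrier A) (carrier A)"
    using star_hom_closed [OF \<phi>(1)] star_hom_closed [OF \<psi>(1)]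
    by (intro bij_betw_byWitness [where f' = \<psi>]) auto
  let ?P = "\<lambda>\<gamma>. \<gamma> \<in> cstar_iso A A \<and> \<gamma> \<in> extensional (carrier A) \<and>
     (\<forall>v\<in>verts E. \<gamma> (p v) = p v) \<and> (\<forall>e\<in>arcs E. \<gamma> (t e) = z \<odot> t e)"
  let ?g = "restrict \<phi> (carrier A)"
  have "star_hom (carrier A) A A ?g"
    using \<phi>(1) unfolding star_hom_def by simp
  moreover have "bij_betw ?g (carrier A) (carrier A)"
    using bij by (subst bij_betw_cong [of _ _ \<phi>]) auto
  ultimately have P: "?P ?g" using \<phi> by (simp add: cstar_iso_def cstar_hom_iff)
  have "g = ?g" if g: "?P g" for g
  proof (rule extensionalityI)
    show "g \<in> extensional (carrier A)" "?g \<in> extensional (carrier A)" using g by auto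
    show "g x = ?g x" if "x \<in> carrier A" for x
      by (rule h [where \<phi> = g and \<psi> = ?g]) (use g P that in \<open>auto simp: cstar_iso_def cstar_hom_iff\<close>)
  qed
  then have "?P (\<gamma> z)" unfolding \<gamma>_def gauge_action_def by (rule theI [of ?P, OF P])
  then show "star_hom (carrier A) A A (\<gamma> z)" "v \<in> verts E \<Longrightarrow> \<gamma> z (p v) = p v"
    "e \<in> arcs E \<Longrightarrow> \<gamma> z (t e) = z \<odot> t e"
    by (auto simp: cstar_iso_def cstar_hom_iff)
qed

lemma gauge_tpath:
  assumes z: "cmod z = 1" and x: "tpath n r s x"
  shows "\<gamma> z x = z ^ n \<odot> x"
  using x
proof induction
  case (tpath_edge n r s x e)
  have "x \<in> carrier A" using tpath_edge(1) by (rule tpath_in)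
  with tpath_edge show ?case
    by (simp add: star_hom_mult [OF gauge_hom [OF z]] gauge_t [OF z] smult_mult_left smult_mult_right
        mult.commute)
qed (simp add: gauge_p [OF z])

lemma gauge_span:
  assumes z: "cmod z = 1" and "tpath n r s x" "tpath m r' s y"
  shows "\<gamma> z (x \<otimes> y\<^sup>\<star>) = (z ^ n * cnj (z ^ m)) \<odot> (x \<otimes> y\<^sup>\<star>)"
  using tpath_in [OF assms(2)] tpath_in [OF assms(3)] gauge_tpath [OF z assms(2)] gauge_tpath [OF z assms(3)]
  by (simp add: star_hom_mult [OF gauge_hom [OF z]] star_hom_adj [OF gauge_hom [OF z]]
      adj_smult smult_mult_left smult_mult_right mult.commute)

definition C :: "'a set" where
  "C = {a \<in> carrier A. \<forall>z. cmod z = 1 \<longrightarrow> \<gamma> z a = a}"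

lemma core_eq: "core E A p t = A\<lparr>carrier := C\<rparr>"
  by (simp add: core_def C_def \<gamma>_def)

lemma C_gauge: "\<lbrakk>c \<in> C; cmod z = 1\<rbrakk> \<Longrightarrow> \<gamma> z c = c"
  by (simp add: C_def)

lemma C_I: "\<lbrakk>c \<in> carrier A; \<And>z. cmod z = 1 \<Longrightarrow> \<gamma> z c = c\<rbrakk> \<Longrightarrow> c \<in> C"
  by (simp add: C_def)

lemma C_in [simp]: "c \<in> C \<Longrightarrow> c \<in> carrier A"
  by (simp add: C_def)

lemma C_subalgebra: "cstar_subalgebra C A"
proof -
  interpret two_cstar A A by (rule two_cstar_self)
  have S: "cstar_subalgebra {a \<in> carrier A. \<gamma> z a = a} A" if "cmod z = 1" for z
    by (rule star_hom_equalizer [OF cstar_subalgebra_carrier gauge_hom [OF that] star_hom_ident]) simp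
  have "C = \<Inter> ((\<lambda>z. {a \<in> carrier A. \<gamma> z a = a}) ` {z. cmod z = 1})"
    unfolding C_def using norm_one by (auto simp del: norm_one)
  also have "closed_subspace \<dots> A"
    by (rule closed_subspace_Inter) (use S cstar_subalgebra_subspace in \<open>auto intro: exI [of _ 1]\<close>)
  finally have "closed_subspace C A" .
  then show ?thesis
    unfolding cstar_subalgebra_def
    by (auto intro!: C_I simp: C_gauge star_hom_mult [OF gauge_hom] star_hom_adj [OF gauge_hom])
qed

lemmas C_mult = cstar_subalgebra_mult [OF C_subalgebra]
lemmas C_adj = cstar_subalgebra_adj [OF C_subalgebra]
lemmas C_subspace = cstar_subalgebra_subspace [OF C_subalgebra]

definition core_set :: "'a set" where
  "core_set = {x \<otimes> y\<^sup>\<star> | x y. \<exists>n r r' s. tpath n r s x \<and> tpath n r' s y}"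

lemma core_setI: "tpath n r s x \<Longrightarrow> tpath n r' s y \<Longrightarrow> x \<otimes> y\<^sup>\<star> \<in> core_set"
  unfolding core_set_def by blast

lemma core_set_C: "core_set \<subseteq> C"
proof
  fix a assume "a \<in> core_set"
  then obtain x y n r r' s where a: "a = x \<otimes> y\<^sup>\<star>" and x: "tpath n r s x" and y: "tpath n r' s y"
    unfolding core_set_def by blast
  have "z ^ n * cnj (z ^ n) = 1" if "cmod z = 1" for z
    using unit_mult_cnj(1) [of "z ^ n"] that by (simp add: norm_power)
  then show "a \<in> C"
    using gauge_span [OF _ x y] tpath_in [OF x] tpath_in [OF y] by (intro C_I) (simp_all add: a)
qed

text \<open>A finite substitute for integrating the gauge action over the circle: the \<open>N\<close>-th average kills
  \<open>t\<^sub>\<mu> t\<^sub>\<nu>\<^sup>*\<close> as soon as \<open>|\<mu>| \<noteq> |\<nu>|\<close> and \<open>N > |\<mu>| + |\<nu>|\<close>.\<close>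

definition average :: "nat \<Rightarrow> 'a \<Rightarrow> 'a" where
  "average N x = finsum A (\<lambda>j. complex_of_real (1 / real N) \<odot> \<gamma> (unit_root N ^ j) x) {..<N}"

lemma average_root: "cmod (unit_root N ^ j) = 1"
  by (simp add: norm_power)

lemma average_term [simp]: "x \<in> carrier A \<Longrightarrow> \<gamma> (unit_root N ^ j) x \<in> carrier A"
  by (rule star_hom_closed [OF gauge_hom]) (simp_all add: norm_power)

lemma average_in [simp]: "x \<in> carrier A \<Longrightarrow> average N x \<in> carrier A"
  unfolding average_def by (rule finsum_closed') simp

lemma average_add: "\<lbrakk>x \<in> carrier A; y \<in> carrier A\<rbrakk> \<Longrightarrow> average N (x \<oplus> y) = average N x \<oplus> average N y"
  by (simp add: average_def norm_power star_hom_add [OF gauge_hom] smult_add_right Pi_def flip: M.finsum_addf)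

lemma average_smult: "x \<in> carrier A \<Longrightarrow> average N (c \<odot> x) = c \<odot> average N x"
  by (simp add: average_def norm_power star_hom_smult [OF gauge_hom] finsum_smult mult.commute)

lemma average_minus: "\<lbrakk>x \<in> carrier A; y \<in> carrier A\<rbrakk> \<Longrightarrow> average N (x \<ominus> y) = average N x \<ominus> average N y"
  by (simp add: minus_eq_smult average_add average_smult)

lemma nrm_average_le:
  assumes "x \<in> carrier A" "N > 0"
  shows "\<parallel>average N x\<parallel> \<le> \<parallel>x\<parallel>"
proof -
  interpret two_cstar A A by (rule two_cstar_self)
  have "\<parallel>average N x\<parallel> \<le> (\<Sum>j<N. \<parallel>complex_of_real (1 / real N) \<odot> \<gamma> (unit_root N ^ j) x\<parallel>)"
    unfolding average_def by (rule nrm_finsum_le) (use assms in simp)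
  also have "\<dots> \<le> (\<Sum>j<N. 1 / real N * \<parallel>x\<parallel>)"
    using assms star_hom_contractive [OF cstar_subalgebra_carrier gauge_hom [OF average_root]]
    by (intro sum_mono) (simp add: nrm_smult norm_divide divide_right_mono)
  also have "\<dots> = \<parallel>x\<parallel>" using assms by simp
  finally show ?thesis .
qed

lemma average_core: "c \<in> C \<Longrightarrow> N > 0 \<Longrightarrow> average N c = c"
proof -
  assume c: "c \<in> C" and N: "N > 0"
  have "\<gamma> (unit_root N ^ j) c = c" for j using c by (simp add: C_gauge norm_power)
  then have "average N c = finsum A (\<lambda>j. complex_of_real (1 / real N) \<odot> c) {..<N}"
    by (simp add: average_def)
  also have "\<dots> = (\<Sum>j<N. complex_of_real (1 / real N)) \<odot> c"
    by (rule finsum_smult_const) (use c in auto)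
  also have "(\<Sum>j<N. complex_of_real (1 / real N)) = 1" using N by simp
  finally show ?thesis using c by simp
qed

lemma average_span:
  assumes "tpath n r s x" "tpath m r' s y" "N > n + m"
  shows "average N (x \<otimes> y\<^sup>\<star>) = (if n = m then x \<otimes> y\<^sup>\<star> else \<zero>)"
proof -
  let ?\<omega> = "unit_root N"
  have c: "x \<otimes> y\<^sup>\<star> \<in> carrier A" using assms tpath_in by blast
  have "average N (x \<otimes> y\<^sup>\<star>) =
      finsum A (\<lambda>j. (complex_of_real (1 / real N) * ((?\<omega> ^ j) ^ n * cnj ((?\<omega> ^ j) ^ m))) \<odot> (x \<otimes> y\<^sup>\<star>)) {..<N}"
    unfolding average_def by (rule finsum_eq) (use c gauge_span [OF average_root assms(1,2)] in auto)
  also have "\<dots> = (\<Sum>j<N. complex_of_real (1 / real N) * ((?\<omega> ^ j) ^ n * cnj ((?\<omega> ^ j) ^ m))) \<odot> (x \<otimes> y\<^sup>\<star>)"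
    by (rule finsum_smult_const) (use c in auto)
  finally show ?thesis unfolding roots_of_unity_average [OF assms(3)] using c by simp
qed

text \<open>An element \<open>c\<close> of the core is approximated by some \<open>x\<close> whose
  averages become constant inside the closed span. Averaging fixes \<open>c\<close> and does not
  increase norms, so that constant value approximates \<open>c\<close> equally well.\<close>

lemma C_eq_closed_span: "C = closed_span A core_set"
proof
  let ?Y = "closed_span A core_set"
  have core_in: "core_set \<subseteq> carrier A" using core_set_C by auto
  have Y: "closed_subspace ?Y A" by (rule closed_span_subspace [OF core_in])
  show "?Y \<subseteq> C" by (rule closed_span_least [OF C_subspace core_set_C])
  \<comment> \<open>The averages are required to be constant from some \<open>N\<close> on, so for
    sums it suffices to take the larger bound. Spanning elements belong to \<open>G\<close> by
    \<open>average_span\<close>.\<close>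
  define G where "G = {x \<in> carrier A. \<exists>K. \<exists>y\<in>?Y. \<forall>N>K. average N x = y}"
  let ?cl = "{x \<in> carrier A. \<forall>e>0. \<exists>y\<in>G. \<parallel>x \<ominus> y\<parallel> < e}"
  have av0: "average N \<zero> = \<zero>" for N using average_smult [of \<zero> N 0] by simp
  have G0: "\<zero> \<in> G" using av0 closed_subspace_zero [OF Y] by (auto simp: G_def)
  have "closed_subspace ?cl A"
  proof (rule closed_subspace_closure [OF _ G0])
    show "G \<subseteq> carrier A" by (auto simp: G_def)
    fix x assume x: "x \<in> G"
    then obtain K y where K: "y \<in> ?Y" "\<And>N. N > K \<Longrightarrow> average N x = y" "x \<in> carrier A" by (auto simp: G_def)
    show "c \<odot> x \<in> G" for c
    proof -
      have "\<forall>N>K. average N (c \<odot> x) = c \<odot> y" using K by (simp add: average_smult)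
      then have "\<exists>K. \<exists>y\<in>?Y. \<forall>N>K. average N (c \<odot> x) = y"
        by (intro exI [of _ K] bexI [OF _ closed_subspace_smult [OF Y K(1)]])
      then show ?thesis using K by (simp add: G_def)
    qed
    fix x' assume x': "x' \<in> G"
    then obtain K' y' where K': "y' \<in> ?Y" "\<And>N. N > K' \<Longrightarrow> average N x' = y'" "x' \<in> carrier A" by (auto simp: G_def)
    have "\<forall>N>max K K'. average N (x \<oplus> x') = y \<oplus> y'" using K K' by (simp add: average_add)
    then have "\<exists>K. \<exists>y\<in>?Y. \<forall>N>K. average N (x \<oplus> x') = y"
      by (intro exI [of _ "max K K'"] bexI [OF _ closed_subspace_add [OF Y K(1) K'(1)]])
    then show "x \<oplus> x' \<in> G" using K K' by (simp add: G_def)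
  qed
  moreover have "span_set \<subseteq> ?cl"
  proof
    fix a assume "a \<in> span_set"
    then obtain x y n m r r' s where a: "a = x \<otimes> y\<^sup>\<star>" and x: "tpath n r s x" and y: "tpath m r' s y"
      unfolding span_set_def by blast
    have ac: "a \<in> carrier A" using a tpath_in [OF x] tpath_in [OF y] by simp
    have Y1: "(if n = m then x \<otimes> y\<^sup>\<star> else \<zero>) \<in> ?Y"
      using core_setI [OF x, of r' y] y closed_span_superset [of core_set] closed_subspace_zero [OF Y] by auto
    have "\<exists>K. \<exists>y\<in>?Y. \<forall>N>K. average N a = y"
      unfolding a by (intro exI [of _ "n + m"] bexI [OF _ Y1] allI impI average_span [OF x y])
    then have "a \<in> G" using ac by (simp add: G_def)
    then show "a \<in> ?cl" using ac by (auto intro!: bexI [of _ a])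
  qed
  ultimately have cl: "carrier A \<subseteq> ?cl" using closed_span_least [of ?cl span_set] closed_span_span_set by simp
  show "C \<subseteq> ?Y"
  proof
    fix c assume c: "c \<in> C"
    show "c \<in> ?Y"
    proof (rule closed_subspace_approx [OF Y])
      show "c \<in> carrier A" using c by simp
      fix e :: real assume "e > 0"
      then have "\<exists>x\<in>G. \<parallel>c \<ominus> x\<parallel> < e" using subsetD [OF cl C_in [OF c]] by simp
      then obtain x where x: "x \<in> G" "\<parallel>c \<ominus> x\<parallel> < e" by blast
      then obtain K y where K: "y \<in> ?Y" "\<And>N. N > K \<Longrightarrow> average N x = y" "x \<in> carrier A" by (auto simp: G_def)
      \<comment> \<open>\<open>Suc K\<close> is positive and exceeds the bound beyond which the
        averages of \<open>x\<close> equal \<open>y\<close>.\<close>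
      have "c \<ominus> y = average (Suc K) (c \<ominus> x)"
        using c K by (simp add: average_minus average_core)
      then have "\<parallel>c \<ominus> y\<parallel> < e" using nrm_average_le [of "c \<ominus> x" "Suc K"] c K x by simp
      then show "\<exists>y\<in>?Y. \<parallel>c \<ominus> y\<parallel> < e" using K by blast
    qed
  qed
qed

end

section \<open>The isometry and the endomorphism\<close>

context cstar_algebra
begin

lemma finsum_product:
  assumes "finite I" "finite J" "\<And>i. i \<in> I \<Longrightarrow> f i \<in> carrier A" "\<And>j. j \<in> J \<Longrightarrow> g j \<in> carrier A"
  shows "finsum A f I \<otimes> finsum A g J = finsum A (\<lambda>(i, j). f i \<otimes> g j) (I \<times> J)"
  using assms(1,3)
proof (induction I rule: finite_induct)
  case empty
  then show ?case using finsum_closed' [of J g] assms(4) by simp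
next
  case (insert i I)
  have g: "finsum A g J \<in> carrier A" "finsum A f I \<in> carrier A"
    by (rule finsum_closed', use assms(4) insert in simp)+
  have "finsum A (\<lambda>(i, j). f i \<otimes> g j) (insert i I \<times> J)
      = finsum A (\<lambda>(i, j). f i \<otimes> g j) (Pair i ` J \<union> I \<times> J)"
    by (rule arg_cong [of _ _ "finsum A _"]) auto
  also have "\<dots> = finsum A (\<lambda>(i, j). f i \<otimes> g j) (Pair i ` J) \<oplus> finsum A (\<lambda>(i, j). f i \<otimes> g j) (I \<times> J)"
    using insert assms by (intro M.finsum_Un_disjoint) auto
  also have "finsum A (\<lambda>(i, j). f i \<otimes> g j) (Pair i ` J) = finsum A (\<lambda>j. f i \<otimes> g j) J"
    using insert assms by (subst M.finsum_reindex) (auto simp: inj_on_def)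
  also have "\<dots> = f i \<otimes> finsum A g J"
    using insert assms by (intro finsum_mult_left [symmetric]) auto
  also have "finsum A (\<lambda>(i, j). f i \<otimes> g j) (I \<times> J) = finsum A f I \<otimes> finsum A g J"
    using insert by simp
  also have "f i \<otimes> finsum A g J \<oplus> finsum A f I \<otimes> finsum A g J = (f i \<oplus> finsum A f I) \<otimes> finsum A g J"
    using g insert by (simp add: mult_distrib_right)
  also have "f i \<oplus> finsum A f I = finsum A f (insert i I)"
    using insert by (intro M.finsum_insert [symmetric]) auto
  finally show ?case by simp
qed

end

section \<open>The weighted series of edges and its strict limit\<close>

context graph_cstar
begin

definition wt :: "'v \<Rightarrow> real" where
  "wt v = real (card (out_arcs E v)) powr (- 1 / 2)"

lemma card_out_pos: "v \<in> verts E \<Longrightarrow> card (out_arcs E v) > 0"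
  using locally_finite [of v] no_sources_or_sinks [of v] by (simp add: card_gt_0_iff)

text \<open>The normalisation that makes \<open>W\<close> an isometry: the squared weights of the
  edges leaving a vertex add up to 1.\<close>

lemma wt_square: "v \<in> verts E \<Longrightarrow> real (card (out_arcs E v)) * (wt v * wt v) = 1"
  using card_out_pos [of v] by (simp add: wt_def powr_minus_divide flip: powr_add)

lemma wt_pos: "v \<in> verts E \<Longrightarrow> wt v > 0"
  using card_out_pos [of v] by (simp add: wt_def)

text \<open>Finite diagonal elements over the vertex projections. The square of a partial sum has
  this form, and its norm is estimated through the coefficients.\<close>

definition diag :: "('v \<Rightarrow> complex) \<Rightarrow> 'v set \<Rightarrow> 'a" where
  "diag a V = finsum A (\<lambda>v. a v \<odot> p v) V"

lemma diag_in: "V \<subseteq> verts E \<Longrightarrow> diag a V \<in> carrier A"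
  unfolding diag_def by (rule finsum_closed') auto

lemma diag_mult:
  assumes V: "finite V" "V \<subseteq> verts E"
  shows "diag a V \<otimes> diag b V = diag (\<lambda>v. a v * b v) V"
proof -
  have "p v \<otimes> diag b V = b v \<odot> p v" if v: "v \<in> V" for v
  proof -
    have "p v \<otimes> diag b V = finsum A (\<lambda>w. b w \<odot> (p v \<otimes> p w)) V"
      unfolding diag_def using V v
      by (subst finsum_mult_left) (auto simp: smult_mult_right subset_iff intro!: finsum_eq)
    also have "\<dots> = b v \<odot> (p v \<otimes> p v)"
      by (rule finsum_single) (use V v p_orth [of v] in \<open>auto simp: subset_iff\<close>)
    finally show ?thesis using V v by auto
  qed
  then have "a v \<odot> p v \<otimes> diag b V = (a v * b v) \<odot> p v" if "v \<in> V" for v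
    using that V diag_in [OF V(2), of b] by (auto simp: smult_mult_left)
  then show ?thesis
    using V diag_in [OF V(2), of b] unfolding diag_def [of a] diag_def [of "\<lambda>v. a v * b v"]
    by (subst finsum_mult_right) (auto intro!: finsum_eq)
qed

lemma diag_adj: "V \<subseteq> verts E \<Longrightarrow> (diag a V)\<^sup>\<star> = diag (\<lambda>v. cnj (a v)) V"
  unfolding diag_def by (subst finsum_adj) (auto simp: adj_smult intro!: finsum_eq)

lemma diag_add: "V \<subseteq> verts E \<Longrightarrow> diag a V \<oplus> diag b V = diag (\<lambda>v. a v + b v) V"
  unfolding diag_def by (subst M.finsum_addf [symmetric]) (auto simp: smult_add_left intro!: finsum_eq)

lemma diag_smult: "V \<subseteq> verts E \<Longrightarrow> c \<odot> diag a V = diag (\<lambda>v. c * a v) V"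
  unfolding diag_def by (subst finsum_smult) (auto intro!: finsum_eq)

lemma diag_one_projection: "finite V \<Longrightarrow> V \<subseteq> verts E \<Longrightarrow> projection A (diag (\<lambda>v. 1) V)"
  unfolding projection_def by (simp add: diag_in diag_mult diag_adj)

lemma nrm_diag_unit:
  assumes V: "finite V" "V \<subseteq> verts E" and a: "\<And>v. cmod (a v) = 1"
  shows "\<parallel>diag a V\<parallel> \<le> 1"
proof -
  have "\<parallel>diag a V\<parallel>\<^sup>2 = \<parallel>diag (\<lambda>v. 1) V\<parallel>"
    using V unit_mult_cnj(2) [OF a] by (simp add: cstar_identity [symmetric] diag_in diag_adj diag_mult)
  also have "\<dots> \<le> 1\<^sup>2" using nrm_projection_le [OF diag_one_projection [OF V]] by simp
  finally show ?thesis by (rule power2_le_imp_le) simp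
qed

text \<open>A number in the unit interval is the mean of two conjugate complex numbers of modulus 1,
  and coefficients of modulus 1 are covered by \<open>nrm_diag_unit\<close>. This avoids computing
  the norm of a diagonal element.\<close>

lemma nrm_diag_le:
  assumes V: "finite V" "V \<subseteq> verts E" and a: "\<And>v. 0 \<le> a v" "\<And>v. a v \<le> 1"
  shows "\<parallel>diag (\<lambda>v. complex_of_real (a v)) V\<parallel> \<le> 1"
proof -
  define u where "u v = Complex (a v) (sqrt (1 - (a v)\<^sup>2))" for v
  have "(a v)\<^sup>2 \<le> 1" for v using a [of v] by (simp add: power_le_one)
  then have u: "cmod (u v) = 1" for v by (simp add: u_def cmod_def)
  have "(\<lambda>v. complex_of_real (a v)) = (\<lambda>v. (1/2) * (u v + cnj (u v)))"
    by (simp add: fun_eq_iff u_def complex_eq_iff)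
  then have "diag (\<lambda>v. complex_of_real (a v)) V = diag (\<lambda>v. (1/2) * (u v + cnj (u v))) V"
    by (rule arg_cong)
  also have "\<dots> = (1/2) \<odot> (diag u V \<oplus> diag (\<lambda>v. cnj (u v)) V)"
    by (simp only: diag_add [OF V(2)] diag_smult [OF V(2)])
  finally have "diag (\<lambda>v. complex_of_real (a v)) V = (1/2) \<odot> (diag u V \<oplus> diag (\<lambda>v. cnj (u v)) V)" .
  then have "\<parallel>diag (\<lambda>v. complex_of_real (a v)) V\<parallel> = \<parallel>diag u V \<oplus> diag (\<lambda>v. cnj (u v)) V\<parallel> / 2"
    using V by (simp add: nrm_smult diag_in)
  moreover have "\<parallel>diag u V \<oplus> diag (\<lambda>v. cnj (u v)) V\<parallel> \<le> \<parallel>diag u V\<parallel> + \<parallel>diag (\<lambda>v. cnj (u v)) V\<parallel>"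
    using V by (intro nrm_triangle diag_in)
  moreover have "\<parallel>diag u V\<parallel> \<le> 1" "\<parallel>diag (\<lambda>v. cnj (u v)) V\<parallel> \<le> 1"
    using u by (auto intro!: nrm_diag_unit V)
  ultimately show ?thesis by linarith
qed

definition wtt :: "'e \<Rightarrow> 'a" where
  "wtt e = complex_of_real (wt (tail E e)) \<odot> t e"

lemma wtt_in [simp]: "e \<in> arcs E \<Longrightarrow> wtt e \<in> carrier A"
  by (simp add: wtt_def)

lemma adj_t_sum:
  assumes F: "finite F" "F \<subseteq> arcs E" and e: "e \<in> F"
  shows "(t e)\<^sup>\<star> \<otimes> finsum A wtt F = complex_of_real (wt (tail E e)) \<odot> p (tail E e)"
proof -
  have "(t e)\<^sup>\<star> \<otimes> finsum A wtt F = finsum A (\<lambda>f. (t e)\<^sup>\<star> \<otimes> wtt f) F"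
    using F e by (intro finsum_mult_left) auto
  also have "\<dots> = (t e)\<^sup>\<star> \<otimes> wtt e"
  proof (rule finsum_single)
    fix f assume "f \<in> F" "f \<noteq> e"
    then show "(t e)\<^sup>\<star> \<otimes> wtt f = \<zero>"
      using t_orth [of e f] F e by (auto simp: wtt_def smult_mult_right subset_iff)
  qed (use F e in auto)
  also have "\<dots> = complex_of_real (wt (tail E e)) \<odot> p (tail E e)"
    using F e t_adj_t [of e] by (auto simp: wtt_def smult_mult_right subset_iff)
  finally show ?thesis .
qed

lemma nrm_partial_sum_le:
  assumes F: "finite F" "F \<subseteq> arcs E"
  shows "\<parallel>finsum A wtt F\<parallel> \<le> 1"
proof -
  define X where "X = finsum A wtt F"
  have Xc: "X \<in> carrier A" unfolding X_def using F by (intro finsum_closed') auto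
  \<comment> \<open>Orthogonality of the edges will make \<open>X\<^sup>\<star> \<otimes> X\<close>
    diagonal over these vertices. The coefficient at \<open>v\<close> is the proportion of the edges
    leaving \<open>v\<close> that belong to \<open>F\<close>, hence at most 1.\<close>
  define V where "V = tail E ` F"
  have V: "finite V" "V \<subseteq> verts E" using F by (auto simp: V_def)
  define a where "a v = real (card {e \<in> F. tail E e = v}) * (wt v * wt v)" for v
  define h where "h = X\<^sup>\<star> \<otimes> X"
  have hc: "h \<in> carrier A" using Xc by (simp add: h_def)
  have "h = finsum A (\<lambda>e. (wtt e)\<^sup>\<star> \<otimes> X) F"
    unfolding h_def X_def using F Xc by (subst finsum_adj) (auto simp: X_def intro!: finsum_mult_right)
  also have "\<dots> = finsum A (\<lambda>e. complex_of_real (wt (tail E e) * wt (tail E e)) \<odot> p (tail E e)) F"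
  proof (rule finsum_eq)
    fix e assume e: "e \<in> F"
    then show "(wtt e)\<^sup>\<star> \<otimes> X = complex_of_real (wt (tail E e) * wt (tail E e)) \<odot> p (tail E e)"
      using adj_t_sum [OF F e] F Xc by (auto simp: wtt_def adj_smult smult_mult_left X_def [symmetric] subset_iff)
  qed (use F in auto)
  finally have h: "h = finsum A (\<lambda>e. complex_of_real (wt (tail E e) * wt (tail E e)) \<odot> p (tail E e)) F" .
  have ph: "p v \<otimes> h = complex_of_real (a v) \<odot> p v" if v: "v \<in> V" for v
  proof -
    have vv: "v \<in> verts E" using v V by auto
    have "p v \<otimes> h = finsum A (\<lambda>e. p v \<otimes> (complex_of_real (wt (tail E e) * wt (tail E e)) \<odot> p (tail E e))) F"
      unfolding h using F vv by (intro finsum_mult_left) auto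
    also have "\<dots> = finsum A (\<lambda>e. (if tail E e = v then complex_of_real (wt v * wt v) else 0) \<odot> p v) F"
      by (rule finsum_eq) (use F vv p_orth in \<open>auto simp: smult_mult_right subset_iff\<close>)
    also have "\<dots> = (\<Sum>e\<in>F. if tail E e = v then complex_of_real (wt v * wt v) else 0) \<odot> p v"
      by (rule finsum_smult_const) (use F vv in auto)
    also have "(\<Sum>e\<in>F. if tail E e = v then complex_of_real (wt v * wt v) else 0) = complex_of_real (a v)"
      using F by (simp add: a_def sum.If_cases Int_def conj_commute)
    finally show ?thesis .
  qed
  have pone: "diag (\<lambda>v. 1) V \<otimes> h = h"
  proof -
    have d: "diag (\<lambda>v. 1) V \<otimes> p v = p v" if v: "v \<in> V" for v
    proof -
      have vv: "v \<in> verts E" using v V by auto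
      have "diag (\<lambda>v. 1) V \<otimes> p v = finsum A (\<lambda>w. 1 \<odot> p w \<otimes> p v) V"
        unfolding diag_def using V vv by (intro finsum_mult_right) auto
      also have "\<dots> = 1 \<odot> p v \<otimes> p v"
        by (rule finsum_single) (use V v vv p_orth in \<open>auto simp: subset_iff\<close>)
      finally show ?thesis using vv by simp
    qed
    have "diag (\<lambda>v. 1) V \<otimes> h =
        finsum A (\<lambda>e. diag (\<lambda>v. 1) V \<otimes> (complex_of_real (wt (tail E e) * wt (tail E e)) \<odot> p (tail E e))) F"
      unfolding h using F V by (intro finsum_mult_left diag_in) auto
    also have "\<dots> = h"
      unfolding h using F d diag_in [OF V(2)]
      by (intro finsum_eq) (auto simp: smult_mult_right V_def subset_iff)
    finally show ?thesis .
  qed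
  have "h = finsum A (\<lambda>v. 1 \<odot> p v \<otimes> h) V"
    using pone unfolding diag_def using V hc by (subst (asm) finsum_mult_right) auto
  also have "\<dots> = diag (\<lambda>v. complex_of_real (a v)) V"
    unfolding diag_def by (rule finsum_eq) (use V ph in auto)
  finally have hd: "h = diag (\<lambda>v. complex_of_real (a v)) V" .
  \<comment> \<open>\<open>nrm_diag_le\<close> asks for bounds at every \<open>v\<close>; off
    \<open>V\<close> the coefficient is set to zero.\<close>
  define b where "b v = (if v \<in> V then a v else 0)" for v
  have "diag (\<lambda>v. complex_of_real (a v)) V = diag (\<lambda>v. complex_of_real (b v)) V"
    unfolding diag_def by (rule finsum_eq) (use V in \<open>auto simp: b_def\<close>)
  moreover have "\<parallel>diag (\<lambda>v. complex_of_real (b v)) V\<parallel> \<le> 1"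
  proof (rule nrm_diag_le [OF V])
    show "0 \<le> b v" for v by (simp add: b_def a_def)
    show "b v \<le> 1" for v
    proof (cases "v \<in> V")
      case True
      then have v: "v \<in> verts E" using V by auto
      have "card {e \<in> F. tail E e = v} \<le> card (out_arcs E v)"
        using F locally_finite [OF v] by (intro card_mono) auto
      then have "a v \<le> real (card (out_arcs E v)) * (wt v * wt v)"
        unfolding a_def by (intro mult_right_mono) auto
      then show ?thesis using wt_square [OF v] True by (simp add: b_def)
    qed (simp add: b_def)
  qed
  ultimately have "\<parallel>X\<^sup>\<star> \<otimes> X\<parallel> \<le> 1" unfolding h_def [symmetric] hd by simp
  then have "\<parallel>X\<parallel>\<^sup>2 \<le> 1\<^sup>2" using Xc by (simp add: cstar_identity)
  then show ?thesis unfolding X_def [symmetric] by (rule power2_le_imp_le [of _ 1]) simp_all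
qed

text \<open>Intersecting with the set of arcs makes the net total; this does not change its limit.\<close>

definition X :: "'e set \<Rightarrow> 'a" where
  "X F = finsum A wtt (F \<inter> arcs E)"

lemma X_in [simp]: "X F \<in> carrier A"
  unfolding X_def by (rule finsum_closed') simp

lemma nrm_X: "\<parallel>X F\<parallel> \<le> 1"
  using nrm_partial_sum_le [of "F \<inter> arcs E"] by (cases "finite (F \<inter> arcs E)") (auto simp: X_def M.finsum_infinite)

abbreviation FS where "FS \<equiv> finite_subsets_at_top (arcs E)"

definition w :: "'v \<Rightarrow> 'a" where
  "w v = finsum A wtt (out_arcs E v)"

lemma w_in [simp]: "w v \<in> carrier A"
  unfolding w_def by (rule finsum_closed') simp

lemma eventually_FS:
  assumes "finite S" "S \<subseteq> arcs E" "\<And>F. \<lbrakk>finite F; S \<subseteq> F; F \<subseteq> arcs E\<rbrakk> \<Longrightarrow> P F"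
  shows "eventually P FS"
  unfolding eventually_finite_subsets_at_top by (intro exI [of _ S] conjI allI impI) (use assms in auto)

lemma X_p: "v \<in> verts E \<Longrightarrow> eventually (\<lambda>F. X F \<otimes> p v = w v) FS"
proof (rule eventually_FS [of "out_arcs E v"])
  fix F assume v: "v \<in> verts E" and F: "finite F" "out_arcs E v \<subseteq> F" "F \<subseteq> arcs E"
  have "X F \<otimes> p v = finsum A (\<lambda>e. wtt e \<otimes> p v) F"
    unfolding X_def using F v by (subst finsum_mult_right) (auto simp: Int_absorb2)
  also have "\<dots> = finsum A (\<lambda>e. wtt e \<otimes> p v) (out_arcs E v)"
    by (rule finsum_neutral) (use F v t_p_zero in \<open>auto simp: wtt_def smult_mult_left subset_iff\<close>)
  also have "\<dots> = w v"
    unfolding w_def by (rule finsum_eq) (use v t_p in \<open>auto simp: wtt_def smult_mult_left\<close>)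
  finally show "X F \<otimes> p v = w v" .
qed (use locally_finite in auto)

lemma p_X: "v \<in> verts E \<Longrightarrow> eventually (\<lambda>F. p v \<otimes> X F = finsum A wtt (in_arcs E v)) FS"
proof (rule eventually_FS [of "in_arcs E v"])
  fix F assume v: "v \<in> verts E" and F: "finite F" "in_arcs E v \<subseteq> F" "F \<subseteq> arcs E"
  have "p v \<otimes> X F = finsum A (\<lambda>e. p v \<otimes> wtt e) F"
    unfolding X_def using F v by (subst finsum_mult_left) (auto simp: Int_absorb2)
  also have "\<dots> = finsum A (\<lambda>e. p v \<otimes> wtt e) (in_arcs E v)"
    by (rule finsum_neutral) (use F v p_t_zero in \<open>auto simp: wtt_def smult_mult_right subset_iff\<close>)
  also have "\<dots> = finsum A wtt (in_arcs E v)"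
    by (rule finsum_eq) (use v p_t in \<open>auto simp: wtt_def smult_mult_right\<close>)
  finally show "p v \<otimes> X F = finsum A wtt (in_arcs E v)" .
qed (use locally_finite in auto)

text \<open>A spanning set on which the net \<open>X F\<close> is eventually constant from the left;
  \<open>p_right\<close> is its counterpart for the other side.\<close>

definition p_left :: "'a set" where
  "p_left = {p v \<otimes> a | v a. v \<in> verts E \<and> a \<in> carrier A}"

lemma p_left_in: "p_left \<subseteq> carrier A"
  by (auto simp: p_left_def)

lemma span_set_p_left: "span_set \<subseteq> p_left"
proof
  fix a assume "a \<in> span_set"
  then obtain x y n m r r' s where a: "a = x \<otimes> y\<^sup>\<star>" and x: "tpath n r s x" and y: "tpath m r' s y"
    unfolding span_set_def by blast
  have "a = p r \<otimes> a" "r \<in> verts E" "a \<in> carrier A"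
    using p_tpath [OF x] tpath_in [OF x] tpath_in [OF y] tpath_range [OF x]
    by (auto simp: a mult_assoc [symmetric])
  then show "a \<in> p_left" unfolding p_left_def by blast
qed

lemma closed_span_p_left: "closed_span A p_left = carrier A"
  using closed_span_mono [OF span_set_p_left] closed_span_span_set closed_span_sub_carrier [OF p_left_in] by blast

definition p_right :: "'a set" where
  "p_right = {a \<otimes> p v | v a. v \<in> verts E \<and> a \<in> carrier A}"

lemma closed_span_p_right: "closed_span A p_right = carrier A"
proof (rule closed_span_adj [OF p_left_in closed_span_p_left])
  fix x assume "x \<in> p_left"
  then obtain v a where "x = p v \<otimes> a" and va: "v \<in> verts E" "a \<in> carrier A" by (auto simp: p_left_def)
  then have "x\<^sup>\<star> = a\<^sup>\<star> \<otimes> p v" by (simp add: adj_mult)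
  then show "x\<^sup>\<star> \<in> p_right" unfolding p_right_def using va adj_closed by blast
qed (auto simp: p_right_def)

lemma FS_nontrivial: "FS \<noteq> bot"
  by simp

definition W :: "('a \<Rightarrow> 'a) \<times> ('a \<Rightarrow> 'a)" where
  "W = (SOME m. m \<in> carrier MA \<and> (\<forall>a\<in>carrier A. conv (\<lambda>F. X F \<otimes> a) (fst m a) FS \<and>
    conv (\<lambda>F. a \<otimes> X F) (snd m a) FS))"

lemma
  shows W_in: "W \<in> carrier MA"
    and W_left: "a \<in> carrier A \<Longrightarrow> conv (\<lambda>F. X F \<otimes> a) (fst W a) FS"
    and W_right: "a \<in> carrier A \<Longrightarrow> conv (\<lambda>F. a \<otimes> X F) (snd W a) FS"
proof -
  let ?G = p_right
  have G: "?G \<subseteq> carrier A" by (auto simp: p_right_def)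
  note Gs = closed_span_p_right
  obtain m where "m \<in> carrier MA" "\<And>a. a \<in> carrier A \<Longrightarrow> conv (\<lambda>F. X F \<otimes> a) (fst m a) FS"
    "\<And>a. a \<in> carrier A \<Longrightarrow> conv (\<lambda>F. a \<otimes> X F) (snd m a) FS"
  proof (rule strict_limit_exists [OF FS_nontrivial X_in nrm_X p_left_in closed_span_p_left _ G Gs])
    fix d assume "d \<in> p_left"
    then obtain v a where d: "d = p v \<otimes> a" "v \<in> verts E" "a \<in> carrier A"
      unfolding p_left_def by blast
    have "eventually (\<lambda>F. X F \<otimes> d = w v \<otimes> a) FS"
      using X_p [OF d(2)] by eventually_elim (use d in \<open>simp add: mult_assoc [symmetric]\<close>)
    then have "conv (\<lambda>F. X F \<otimes> d) (w v \<otimes> a) FS" using d by (intro conv_eventually_const) auto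
    then show "\<exists>l. conv (\<lambda>F. X F \<otimes> d) l FS" ..
  next
    fix d assume "d \<in> ?G"
    then obtain v a where d: "d = a \<otimes> p v" "v \<in> verts E" "a \<in> carrier A"
      unfolding p_right_def by blast
    have "eventually (\<lambda>F. d \<otimes> X F = a \<otimes> finsum A wtt (in_arcs E v)) FS"
      using p_X [OF d(2)] by eventually_elim (use d in \<open>simp add: mult_assoc\<close>)
    moreover have "a \<otimes> finsum A wtt (in_arcs E v) \<in> carrier A"
      using d by (intro mult_closed finsum_closed') auto
    ultimately have "conv (\<lambda>F. d \<otimes> X F) (a \<otimes> finsum A wtt (in_arcs E v)) FS"
      by (intro conv_eventually_const)
    then show "\<exists>l. conv (\<lambda>F. d \<otimes> X F) l FS" ..
  qed blast
  then have "\<exists>m. m \<in> carrier MA \<and> (\<forall>a\<in>carrier A. conv (\<lambda>F. X F \<otimes> a) (fst m a) FS \<and>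
    conv (\<lambda>F. a \<otimes> X F) (snd m a) FS)" by blast
  from someI_ex [OF this] show "W \<in> carrier MA" "a \<in> carrier A \<Longrightarrow> conv (\<lambda>F. X F \<otimes> a) (fst W a) FS"
    "a \<in> carrier A \<Longrightarrow> conv (\<lambda>F. a \<otimes> X F) (snd W a) FS"
    unfolding W_def by blast+
qed

lemma strict_sums_W: "strict_sums A wtt (arcs E) W"
  unfolding strict_sums_def strict_limit_def limitin_iff_conv
proof (intro conjI ballI W_in)
  fix a assume a: "a \<in> carrier A"
  have ev: "eventually (\<lambda>F. finsum A wtt F = X F) FS"
    by (rule eventually_FS [of "{}"]) (auto simp: X_def Int_absorb2)
  show "conv (\<lambda>F. fst (mult_of A (finsum A wtt F)) a) (fst W a) FS"
    by (rule conv_cong [OF W_left [OF a]]) (use ev in \<open>eventually_elim, simp add: fst_mult_of a\<close>)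
  show "conv (\<lambda>F. snd (mult_of A (finsum A wtt F)) a) (snd W a) FS"
    by (rule conv_cong [OF W_right [OF a]]) (use ev in \<open>eventually_elim, simp add: snd_mult_of a\<close>)
qed

lemma fst_W_p: "v \<in> verts E \<Longrightarrow> fst W (p v) = w v"
  by (rule conv_unique [OF W_left conv_eventually_const [OF _ X_p] FS_nontrivial]) auto

lemma fst_W_range: "\<lbrakk>v \<in> verts E; a \<in> carrier A; p v \<otimes> a = a\<rbrakk> \<Longrightarrow> fst W a = w v \<otimes> a"
  using multiplier_fst_mult [OF W_in, of "p v" a] fst_W_p [of v] by simp

text \<open>Once \<open>F\<close> contains all edges leaving \<open>v\<close>, each of them
  contributes \<open>wt v * wt v\<close> times \<open>p v\<close>, and \<open>wt_square\<close> adds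
  these up to \<open>p v\<close>.\<close>

lemma adj_w_X: "v \<in> verts E \<Longrightarrow> eventually (\<lambda>F. (w v)\<^sup>\<star> \<otimes> X F = p v) FS"
proof (rule eventually_FS [of "out_arcs E v"])
  fix F assume v: "v \<in> verts E" and F: "finite F" "out_arcs E v \<subseteq> F" "F \<subseteq> arcs E"
  have X: "X F = finsum A wtt F" using F by (simp add: X_def Int_absorb2)
  have "(w v)\<^sup>\<star> \<otimes> X F = finsum A (\<lambda>e. (wtt e)\<^sup>\<star> \<otimes> X F) (out_arcs E v)"
    unfolding w_def by (subst finsum_adj) (auto intro!: finsum_mult_right)
  also have "\<dots> = finsum A (\<lambda>e. complex_of_real (wt v * wt v) \<odot> p v) (out_arcs E v)"
  proof (rule finsum_eq)
    fix e assume e: "e \<in> out_arcs E v"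
    then have "(t e)\<^sup>\<star> \<otimes> X F = complex_of_real (wt v) \<odot> p v"
      using adj_t_sum [OF F(1,3), of e] F(2) by (auto simp: X)
    then show "(wtt e)\<^sup>\<star> \<otimes> X F = complex_of_real (wt v * wt v) \<odot> p v"
      using e v by (simp add: wtt_def adj_smult smult_mult_left)
  qed (use v in simp)
  also have "\<dots> = (\<Sum>e\<in>out_arcs E v. complex_of_real (wt v * wt v)) \<odot> p v"
    by (rule finsum_smult_const) (use v locally_finite in auto)
  also have "(\<Sum>e\<in>out_arcs E v. complex_of_real (wt v * wt v)) = 1"
    using arg_cong [OF wt_square [OF v], of complex_of_real] by simp
  finally show "(w v)\<^sup>\<star> \<otimes> X F = p v" using v by simp
qed (use locally_finite in auto)

text \<open>Since \<open>w v\<close> is \<open>W p\<^sub>v\<close>, this says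
  \<open>p\<^sub>v W\<^sup>\<star> W = p\<^sub>v\<close>; its adjoint is the isometry relation on
  the spanning set \<open>p_left\<close>.\<close>

lemma snd_W_adj_w: "v \<in> verts E \<Longrightarrow> snd W ((w v)\<^sup>\<star>) = p v"
  by (rule conv_unique [OF W_right conv_eventually_const [OF _ adj_w_X] FS_nontrivial]) auto

lemma isometry_W: "isometry_in A W"
  unfolding isometry_in_def
proof (intro conjI W_in)
  show "W\<^sup>\<star>\<^bsub>MA\<^esub> \<otimes>\<^bsub>MA\<^esub> W = \<one>\<^bsub>MA\<^esub>"
  proof (rule multiplier_eqI [OF multiplier_mult_in [OF multiplier_adj_in [OF W_in] W_in] multiplier_one_in
        p_left_in closed_span_p_left])
    fix x assume "x \<in> p_left"
    then obtain v a where x: "x = p v \<otimes> a" "v \<in> verts E" "a \<in> carrier A" by (auto simp: p_left_def)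
    have "fst W x = w v \<otimes> a" using x fst_W_p by (simp add: multiplier_fst_mult [OF W_in])
    moreover have "snd W ((w v \<otimes> a)\<^sup>\<star>) = a\<^sup>\<star> \<otimes> p v"
      using x by (simp add: adj_mult multiplier_snd_mult [OF W_in] snd_W_adj_w)
    ultimately show "fst (W\<^sup>\<star>\<^bsub>MA\<^esub> \<otimes>\<^bsub>MA\<^esub> W) x = fst \<one>\<^bsub>MA\<^esub> x"
      using x by (simp add: fst_multiplier_mult fst_multiplier_adj fst_multiplier_one adj_mult)
  qed
qed

lemma q_w:
  assumes "e \<in> arcs E"
  shows "q e \<otimes> w (tail E e) = wtt e"
proof -
  have "(t e)\<^sup>\<star> \<otimes> w (tail E e) = complex_of_real (wt (tail E e)) \<odot> p (tail E e)"
    unfolding w_def by (rule adj_t_sum) (use assms locally_finite in auto)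
  then show ?thesis
    using assms t_p [of e] by (simp add: q_def mult_assoc wtt_def smult_mult_right)
qed

text \<open>In effect the gauge action multiplies \<open>W\<close> by \<open>z\<close>, as it does
  each \<open>t e\<close>. Stated for \<open>W a\<close>, it needs no extension of the action to
  multipliers. In \<open>W c W\<^sup>\<star>\<close> the factors \<open>z\<close> and
  \<open>cnj z\<close> then cancel, which is why \<open>\<beta>\<close> preserves the core.\<close>

lemma gauge_W:
  assumes z: "cmod z = 1" and a: "a \<in> carrier A"
  shows "\<gamma> z (fst W a) = z \<odot> fst W (\<gamma> z a)"
proof -
  interpret two_cstar A A by (rule two_cstar_self)
  note h = gauge_hom [OF z]
  note bl = star_hom_blin [OF cstar_subalgebra_carrier h]
  have ga: "\<gamma> z a \<in> carrier A" by (rule star_hom_closed [OF h a])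
  have "\<gamma> z (wtt e) = z \<odot> wtt e" if "e \<in> arcs E" for e
    using that by (simp add: wtt_def star_hom_smult [OF h] gauge_t [OF z] mult.commute)
  then have sums: "finsum A (\<lambda>e. \<gamma> z (wtt e)) (F \<inter> arcs E) = finsum A (\<lambda>e. z \<odot> wtt e) (F \<inter> arcs E)" for F
    by (intro finsum_eq) auto
  have "\<gamma> z (X F) = z \<odot> X F" for F
  proof -
    have "\<gamma> z (X F) = finsum A (\<lambda>e. \<gamma> z (wtt e)) (F \<inter> arcs E)"
      unfolding X_def by (rule star_hom_finsum [OF cstar_subalgebra_carrier h]) simp
    also have "\<dots> = finsum A (\<lambda>e. z \<odot> wtt e) (F \<inter> arcs E)" by (rule sums)
    also have "\<dots> = z \<odot> X F" unfolding X_def by (rule finsum_smult [symmetric]) simp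
    finally show ?thesis .
  qed
  then have eq: "\<gamma> z (X F \<otimes> a) = z \<odot> (X F \<otimes> \<gamma> z a)" for F
    using a ga by (simp add: star_hom_mult [OF h] smult_mult_left)
  have "conv (\<lambda>F. \<gamma> z (X F \<otimes> a)) (\<gamma> z (fst W a)) FS"
    by (rule conv_bounded_linear [OF W_left [OF a], of _ 1])
      (use star_hom_closed [OF h] star_hom_contractive [OF cstar_subalgebra_carrier h] in
        \<open>auto simp: blin_minus [OF closed_subspace_carrier bl, symmetric]\<close>)
  moreover have "conv (\<lambda>F. \<gamma> z (X F \<otimes> a)) (z \<odot> fst W (\<gamma> z a)) FS"
    unfolding eq by (rule conv_smult [OF W_left [OF ga]])
  ultimately show ?thesis by (rule conv_unique [OF _ _ FS_nontrivial])
qed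

abbreviation \<beta> where "\<beta> \<equiv> Ad W"

lemma \<beta>_C:
  assumes c: "c \<in> C"
  shows "\<beta> c \<in> C"
proof (rule C_I)
  interpret two_cstar A A by (rule two_cstar_self)
  note Win [simp] = multiplier_fst_in [OF W_in]
  show "\<beta> c \<in> carrier A" using c by (simp add: Ad_in [OF isometry_W])
  fix z assume z: "cmod z = 1"
  note h = gauge_hom [OF z]
  have "\<gamma> z ((fst W c)\<^sup>\<star>) = cnj z \<odot> (fst W c)\<^sup>\<star>"
    using c by (simp add: star_hom_adj [OF h] gauge_W [OF z] C_gauge [OF c z] adj_smult)
  then have "\<gamma> z (fst W ((fst W c)\<^sup>\<star>)) = z \<odot> (cnj z \<odot> fst W ((fst W c)\<^sup>\<star>))"
    using c by (simp add: gauge_W [OF z] blin_smult [OF multiplier_fst_blin [OF W_in]])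
  then have "\<gamma> z (fst W ((fst W c)\<^sup>\<star>)) = fst W ((fst W c)\<^sup>\<star>)"
    using c unit_mult_cnj [OF z] by simp
  then show "\<gamma> z (\<beta> c) = \<beta> c"
    using c by (simp add: Ad_def star_hom_adj [OF h])
qed

lemma p_C [simp]: "v \<in> verts E \<Longrightarrow> p v \<in> C"
  by (rule C_I) (auto simp: gauge_p)

lemma star_hom_\<beta>: "star_hom C A (core E A p t) \<beta>"
proof -
  have "star_hom C A A \<beta>"
    by (rule star_hom_subset [OF star_hom_Ad [OF isometry_W]]) auto
  then show ?thesis unfolding star_hom_def core_eq using \<beta>_C by simp
qed

text \<open>The vertex projections lie in the core, so the products include the spanning set
  \<open>p_left\<close>.\<close>

lemma inclusion_nondegenerate: "(\<lambda>a. a) \<in> nondegenerate_hom (core E A p t) A"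
proof -
  let ?D = "{a \<otimes> b | a b. a \<in> C \<and> b \<in> carrier A}"
  have D: "?D \<subseteq> carrier A" by auto
  have "p_left \<subseteq> ?D" unfolding p_left_def using p_C by blast
  then have "closed_span A ?D = carrier A"
    using closed_span_mono [of p_left ?D] closed_span_p_left closed_span_sub_carrier [of ?D] D by blast
  then show ?thesis
    unfolding nondegenerate_hom_def core_eq by (simp add: cstar_hom_core_iff star_hom_ident subset_iff)
qed

lemma covariant: "stacey_covariant (core E A p t) \<beta> A (\<lambda>a. a) W"
  unfolding stacey_covariant_def
proof (intro conjI ballI inclusion_nondegenerate isometry_W)
  show "mult_of A (\<beta> c) = W \<otimes>\<^bsub>MA\<^esub> mult_of A c \<otimes>\<^bsub>MA\<^esub> W\<^sup>\<star>\<^bsub>MA\<^esub>" if "c \<in> carrier (core E A p t)" for c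
    by (rule mult_of_Ad [OF isometry_W]) (use that in \<open>simp add: core_eq\<close>)
qed

section \<open>The endomorphism on path elements\<close>

lemma tpath_edges:
  "set (e # es) \<subseteq> arcs E \<Longrightarrow> successively (\<lambda>f g. tail E f = head E g) (e # es) \<Longrightarrow>
    tpath (Suc (length es)) (head E e) (tail E (last (e # es))) (edges_prod A t e es)"
proof (induction es arbitrary: e)
  case Nil
  then show ?case using tpath_edge [OF tpath_vertex, of "tail E e" e] t_p [of e] by simp
next
  case (Cons f fs)
  then have "tpath (Suc (length fs)) (head E f) (tail E (last (f # fs))) (edges_prod A t f fs)" by simp
  from tpath_edge [OF this, of e] show ?case using Cons by simp
qed

lemma tpath_path_elt:
  "\<mu> \<in> finite_paths E \<Longrightarrow> tpath (fpath_length \<mu>) (fpath_range E \<mu>) (fpath_source E \<mu>) (path_elt A p t \<mu>)"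
proof (cases \<mu>)
  case (Edges e es)
  assume "\<mu> \<in> finite_paths E"
  then show ?thesis using tpath_edges [of e es] by (simp add: finite_paths_def Edges)
qed (simp add: finite_paths_def tpath_vertex)

lemma path_elt_edge_cons:
  "\<mu> \<in> finite_paths E \<Longrightarrow> e \<in> out_arcs E (fpath_range E \<mu>) \<Longrightarrow>
    path_elt A p t (edge_cons e \<mu>) = t e \<otimes> path_elt A p t \<mu>"
  using t_p [of e] by (cases \<mu>) auto

lemma W_tpath: "tpath n r s x \<Longrightarrow> fst W x = finsum A (\<lambda>e. complex_of_real (wt r) \<odot> (t e \<otimes> x)) (out_arcs E r)"
proof -
  assume x: "tpath n r s x"
  have "fst W x = w r \<otimes> x" by (rule fst_W_range [OF tpath_range [OF x] tpath_in [OF x] p_tpath [OF x]])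
  also have "\<dots> = finsum A (\<lambda>e. wtt e \<otimes> x) (out_arcs E r)"
    unfolding w_def using tpath_in [OF x] by (intro finsum_mult_right) auto
  also have "\<dots> = finsum A (\<lambda>e. complex_of_real (wt r) \<odot> (t e \<otimes> x)) (out_arcs E r)"
    using tpath_in [OF x] by (intro finsum_eq) (auto simp: wtt_def smult_mult_left)
  finally show ?thesis .
qed

text \<open>\<open>Ad_outer\<close> splits the left side into \<open>W t\<^sub>\<mu>\<close> and the
  adjoint of \<open>W t\<^sub>\<nu>\<close>. Each is a finite sum over the edges that prolong its
  path, and their product is the double sum.\<close>

lemma \<beta>_path:
  assumes \<mu>: "\<mu> \<in> finite_paths E" and \<nu>: "\<nu> \<in> finite_paths E"
  shows "\<beta> (path_elt A p t \<mu> \<otimes> (path_elt A p t \<nu>)\<^sup>\<star>) =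
    finsum A
      (\<lambda>(e, f). complex_of_real ((real (card (out_arcs E (fpath_range E \<mu>))) *
            real (card (out_arcs E (fpath_range E \<nu>)))) powr (- 1 / 2))
        \<odot> (path_elt A p t (edge_cons e \<mu>) \<otimes> (path_elt A p t (edge_cons f \<nu>))\<^sup>\<star>))
      (out_arcs E (fpath_range E \<mu>) \<times> out_arcs E (fpath_range E \<nu>))"
proof -
  let ?x = "path_elt A p t \<mu>" and ?y = "path_elt A p t \<nu>"
  let ?r = "fpath_range E \<mu>" and ?r' = "fpath_range E \<nu>"
  note x = tpath_path_elt [OF \<mu>] and y = tpath_path_elt [OF \<nu>]
  note c [simp] = tpath_in [OF x] tpath_in [OF y]
  have "\<beta> (?x \<otimes> ?y\<^sup>\<star>) = fst W ?x \<otimes> (fst W ?y)\<^sup>\<star>" by (rule Ad_outer [OF isometry_W]) auto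
  also have "(fst W ?y)\<^sup>\<star> = finsum A (\<lambda>f. complex_of_real (wt ?r') \<odot> (t f \<otimes> ?y)\<^sup>\<star>) (out_arcs E ?r')"
    unfolding W_tpath [OF y] by (subst finsum_adj) (auto simp: adj_smult intro!: finsum_eq)
  also have "fst W ?x \<otimes> finsum A (\<lambda>f. complex_of_real (wt ?r') \<odot> (t f \<otimes> ?y)\<^sup>\<star>) (out_arcs E ?r')
      = finsum A (\<lambda>(e, f). (complex_of_real (wt ?r) \<odot> (t e \<otimes> ?x)) \<otimes> (complex_of_real (wt ?r') \<odot> (t f \<otimes> ?y)\<^sup>\<star>))
          (out_arcs E ?r \<times> out_arcs E ?r')"
    unfolding W_tpath [OF x]
    using locally_finite tpath_range [OF x] tpath_range [OF y] by (intro finsum_product) auto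
  also have "\<dots> = finsum A
      (\<lambda>(e, f). complex_of_real ((real (card (out_arcs E ?r)) * real (card (out_arcs E ?r'))) powr (- 1 / 2))
        \<odot> (path_elt A p t (edge_cons e \<mu>) \<otimes> (path_elt A p t (edge_cons f \<nu>))\<^sup>\<star>))
      (out_arcs E ?r \<times> out_arcs E ?r')"
  proof (rule finsum_eq)
    fix ef assume ef: "ef \<in> out_arcs E ?r \<times> out_arcs E ?r'"
    then obtain e f where [simp]: "ef = (e, f)" and e: "e \<in> out_arcs E ?r" and f: "f \<in> out_arcs E ?r'" by auto
    have wt: "(real (card (out_arcs E ?r)) * real (card (out_arcs E ?r'))) powr (- 1 / 2) = wt ?r * wt ?r'"
      unfolding wt_def by (rule powr_mult)
    show "(case ef of (e, f) \<Rightarrow> (complex_of_real (wt ?r) \<odot> (t e \<otimes> ?x)) \<otimes> (complex_of_real (wt ?r') \<odot> (t f \<otimes> ?y)\<^sup>\<star>)) =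
      (case ef of (e, f) \<Rightarrow> complex_of_real ((real (card (out_arcs E ?r)) * real (card (out_arcs E ?r'))) powr (- 1 / 2))
        \<odot> (path_elt A p t (edge_cons e \<mu>) \<otimes> (path_elt A p t (edge_cons f \<nu>))\<^sup>\<star>))"
      unfolding wt using e f
      by (simp add: path_elt_edge_cons \<mu> \<nu> smult_mult_left smult_mult_right mult.commute)
    show "(case ef of (e, f) \<Rightarrow> complex_of_real ((real (card (out_arcs E ?r)) * real (card (out_arcs E ?r'))) powr (- 1 / 2))
        \<odot> (path_elt A p t (edge_cons e \<mu>) \<otimes> (path_elt A p t (edge_cons f \<nu>))\<^sup>\<star>)) \<in> carrier A"
      using e f by (simp add: path_elt_edge_cons \<mu> \<nu>)
  qed
  finally show ?thesis .
qed

end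

section \<open>The Stacey crossed product\<close>

text \<open>Two universal properties in opposite directions: the crossed product with universe the
  type of \<open>A\<close> maps to \<open>A\<close>, and the graph algebra with universe the type of
  \<open>B\<close> maps to \<open>B\<close>.\<close>

locale graph_stacey = graph_cstar A E p t + B: cstar_algebra B
  for A :: "'a cstar" (structure) and E :: "('v, 'e) pre_digraph" and p :: "'v \<Rightarrow> 'a" and t :: "'e \<Rightarrow> 'a"
    and B :: "'b cstar" +
  fixes i :: "'a \<Rightarrow> 'b" and v :: "('b \<Rightarrow> 'b) \<times> ('b \<Rightarrow> 'b)"
  assumes crossed: "stacey_crossed_product TYPE('a) (core E A p t) \<beta> B i v"
    and graph_algebra_B: "graph_algebra TYPE('b) E A p t"
begin

sublocale AB: two_cstar A B
  by (intro two_cstar.intro cstar_algebra_axioms B.cstar_algebra_axioms)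

sublocale BA: two_cstar B A
  by (intro two_cstar.intro cstar_algebra_axioms B.cstar_algebra_axioms)

sublocale BB: two_cstar B B
  by (rule B.two_cstar_self)

lemma covariant_B: "stacey_covariant (core E A p t) \<beta> B i v"
  using crossed by (simp add: stacey_crossed_product_def)

lemma i_hom: "star_hom C A B i"
  and i_nondegenerate: "closed_span B {i c \<otimes>\<^bsub>B\<^esub> b | c b. c \<in> C \<and> b \<in> carrier B} = carrier B"
  and v_isometry: "isometry_in B v"
  using covariant_B unfolding stacey_covariant_def nondegenerate_hom_def core_eq cstar_hom_core_iff mem_Collect_eq
  by (simp_all)

lemma generated_B: "generated_cstar B (i ` C \<union> (\<lambda>c. fst v (i c)) ` C \<union> (\<lambda>c. snd v (i c)) ` C) = carrier B"
  using crossed by (simp add: stacey_crossed_product_def core_eq)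

lemmas i_in [simp] = star_hom_closed [OF i_hom]
lemmas i_mult = star_hom_mult [OF i_hom]
lemmas i_adj = star_hom_adj [OF i_hom]
lemmas i_smult = star_hom_smult [OF i_hom]
lemmas i_contractive = AB.star_hom_contractive [OF C_subalgebra i_hom]

lemmas v_in = B.isometry_in_multiplier [OF v_isometry]
lemmas fst_v_in [simp] = B.multiplier_fst_in [OF v_in]
lemmas snd_v_in [simp] = B.multiplier_snd_in [OF v_in]
lemmas fst_v_mult = B.multiplier_fst_mult [OF v_in]

lemma i_\<beta>:
  assumes c: "c \<in> C"
  shows "i (\<beta> c) = B.Ad v (i c)"
proof (rule B.eq_of_right_mult)
  have eq: "mult_of B (i (\<beta> c)) = mult_of B (B.Ad v (i c))"
    using covariant_B c B.mult_of_Ad [OF v_isometry, of "i c"]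
    unfolding stacey_covariant_def core_eq by simp
  show "i (\<beta> c) \<otimes>\<^bsub>B\<^esub> z = B.Ad v (i c) \<otimes>\<^bsub>B\<^esub> z" if "z \<in> carrier B" for z
    using arg_cong [OF eq, of "\<lambda>m. fst m z"] that by (simp add: B.fst_mult_of)
qed (use c \<beta>_C in \<open>auto intro: B.Ad_in [OF v_isometry]\<close>)

text \<open>Covariance in a form that stays inside \<open>B\<close>: the multiplier \<open>v\<close>
  disappears when it occurs on both sides.\<close>

lemma v_outer: "\<lbrakk>c \<in> C; d \<in> C\<rbrakk> \<Longrightarrow> fst v (i c) \<otimes>\<^bsub>B\<^esub> (fst v (i d))\<^sup>\<star>\<^bsub>B\<^esub> = i (\<beta> (c \<otimes> d\<^sup>\<star>))"
  using B.Ad_outer [OF v_isometry, of "i c" "i d"] C_mult C_adj by (simp add: i_\<beta> i_mult i_adj)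

lemma i_\<beta>_fst_v: "\<lbrakk>c \<in> C; b \<in> carrier B\<rbrakk> \<Longrightarrow> i (\<beta> c) \<otimes>\<^bsub>B\<^esub> fst v b = fst v (i c \<otimes>\<^bsub>B\<^esub> b)"
  by (simp add: i_\<beta> B.Ad_fst [OF v_isometry])

lemma t_conj_C:
  assumes "e \<in> arcs E" "f \<in> arcs E" "c \<in> C"
  shows "t e \<otimes> (c \<otimes> (t f)\<^sup>\<star>) \<in> C"
proof (rule C_I)
  fix z assume z: "cmod z = 1"
  note h = gauge_hom [OF z]
  have "\<gamma> z (t e \<otimes> (c \<otimes> (t f)\<^sup>\<star>)) = (z \<odot> t e) \<otimes> (c \<otimes> (z \<odot> t f)\<^sup>\<star>)"
    using assms by (simp add: star_hom_mult [OF h] star_hom_adj [OF h] gauge_t [OF z] C_gauge [OF _ z])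
  then show "\<gamma> z (t e \<otimes> (c \<otimes> (t f)\<^sup>\<star>)) = t e \<otimes> (c \<otimes> (t f)\<^sup>\<star>)"
    using assms unit_mult_cnj [OF z] by (simp add: adj_smult smult_mult_left smult_mult_right)
qed (use assms in auto)

lemma q_C [simp]: "e \<in> arcs E \<Longrightarrow> q e \<in> C"
  using t_conj_C [of e e "p (tail E e)"] t_p [of e]
  by (simp add: q_def mult_assoc [symmetric])

lemma C_least: "closed_subspace S A \<Longrightarrow> core_set \<subseteq> S \<Longrightarrow> C \<subseteq> S"
  unfolding C_eq_closed_span by (rule closed_span_least)

section \<open>A Cuntz-Krieger family in the crossed product\<close>

definition V :: "'v \<Rightarrow> 'b" where
  "V u = fst v (i (p u))"

lemma V_in [simp]: "u \<in> verts E \<Longrightarrow> V u \<in> carrier B"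
  by (simp add: V_def)

text \<open>\<open>i (\<beta> (p u))\<close> is the range projection
  \<open>v i(p u) v\<^sup>\<star>\<close> of \<open>V u\<close>. Through this relation an element of
  the core next to \<open>V u\<close> may be compressed by \<open>\<beta> (p u)\<close>.\<close>

lemma \<beta>_V: "u \<in> verts E \<Longrightarrow> i (\<beta> (p u)) \<otimes>\<^bsub>B\<^esub> V u = V u"
  by (simp add: V_def i_\<beta>_fst_v i_mult [symmetric])

lemma V_p: "u \<in> verts E \<Longrightarrow> V u \<otimes>\<^bsub>B\<^esub> i (p u) = V u"
  by (simp add: V_def fst_v_mult [symmetric] i_mult [symmetric])

lemma adj_V_V: "u \<in> verts E \<Longrightarrow> (V u)\<^sup>\<star>\<^bsub>B\<^esub> \<otimes>\<^bsub>B\<^esub> V u = i (p u)"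
  by (simp add: V_def B.multiplier_adj_left [OF v_in] B.isometry_cancel [OF v_isometry]
      i_adj [symmetric] i_mult [symmetric])

lemma \<beta>_p: "u \<in> verts E \<Longrightarrow> \<beta> (p u) = w u \<otimes> (w u)\<^sup>\<star>"
  using Ad_outer [OF isometry_W, of "p u" "p u"] fst_W_p by simp

definition T :: "'e \<Rightarrow> 'b" where
  "T e = complex_of_real (1 / wt (tail E e)) \<odot>\<^bsub>B\<^esub> (i (q e) \<otimes>\<^bsub>B\<^esub> V (tail E e))"

lemma T_in [simp]: "e \<in> arcs E \<Longrightarrow> T e \<in> carrier B"
  by (simp add: T_def)

lemma wt_cancel: "u \<in> verts E \<Longrightarrow> complex_of_real (1 / wt u) * complex_of_real (wt u) = 1"
  using wt_pos [of u] by (simp flip: of_real_mult)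

text \<open>By \<open>v_outer\<close> the inner part \<open>V i(c) V\<^sup>\<star>\<close> is the
  image of \<open>w c w\<^sup>\<star>\<close>, an element of the core. The outer \<open>q e\<close>
  and \<open>q f\<close> cut out the single edges,
  \<open>q e \<otimes> w (tail E e) = wtt e\<close>, and the weights cancel against those in
  \<open>T\<close>.\<close>

lemma T_conj:
  assumes e: "e \<in> arcs E" and f: "f \<in> arcs E" and c: "c \<in> C"
  shows "T e \<otimes>\<^bsub>B\<^esub> (i c \<otimes>\<^bsub>B\<^esub> (T f)\<^sup>\<star>\<^bsub>B\<^esub>) = i (t e \<otimes> (c \<otimes> (t f)\<^sup>\<star>))"
proof -
  let ?r = "tail E e" and ?s = "tail E f"
  let ?k = "complex_of_real (1 / wt ?r) * complex_of_real (1 / wt ?s)"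
  have pc: "p ?r \<otimes> c \<in> C" using e c C_mult by simp
  have "V ?r \<otimes>\<^bsub>B\<^esub> i c = fst v (i (p ?r \<otimes> c))"
    using e c by (simp add: V_def fst_v_mult [symmetric] i_mult)
  then have "(V ?r \<otimes>\<^bsub>B\<^esub> i c) \<otimes>\<^bsub>B\<^esub> (V ?s)\<^sup>\<star>\<^bsub>B\<^esub> = i (\<beta> ((p ?r \<otimes> c) \<otimes> (p ?s)\<^sup>\<star>))"
    using v_outer [OF pc, of "p ?s"] f by (simp add: V_def)
  also have "\<beta> ((p ?r \<otimes> c) \<otimes> (p ?s)\<^sup>\<star>) = (w ?r \<otimes> c) \<otimes> (w ?s)\<^sup>\<star>"
    using Ad_outer [OF isometry_W, of "p ?r \<otimes> c" "p ?s"] e f c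
    by (simp add: multiplier_fst_mult [OF W_in] fst_W_p del: p_simps(3))
  finally have VV: "(V ?r \<otimes>\<^bsub>B\<^esub> i c) \<otimes>\<^bsub>B\<^esub> (V ?s)\<^sup>\<star>\<^bsub>B\<^esub> = i ((w ?r \<otimes> c) \<otimes> (w ?s)\<^sup>\<star>)" .
  have wC: "(w ?r \<otimes> c) \<otimes> (w ?s)\<^sup>\<star> \<in> C"
    using \<beta>_C [of "(p ?r \<otimes> c) \<otimes> (p ?s)\<^sup>\<star>"] \<open>\<beta> _ = _\<close> pc f C_mult [OF pc, of "p ?s"] by simp
  have iq: "(i (q f))\<^sup>\<star>\<^bsub>B\<^esub> = i (q f)"
    using f projectionD [OF q_projection [OF f]] by (simp add: i_adj [symmetric])
  have "T e \<otimes>\<^bsub>B\<^esub> (i c \<otimes>\<^bsub>B\<^esub> (T f)\<^sup>\<star>\<^bsub>B\<^esub>) =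
      ?k \<odot>\<^bsub>B\<^esub> (i (q e) \<otimes>\<^bsub>B\<^esub> (((V ?r \<otimes>\<^bsub>B\<^esub> i c) \<otimes>\<^bsub>B\<^esub> (V ?s)\<^sup>\<star>\<^bsub>B\<^esub>) \<otimes>\<^bsub>B\<^esub> i (q f)))"
    using e f c iq by (simp add: T_def B.adj_smult B.adj_mult B.smult_mult_left B.smult_mult_right B.mult_assoc
        mult.commute)
  also have "\<dots> = ?k \<odot>\<^bsub>B\<^esub> i (q e \<otimes> (((w ?r \<otimes> c) \<otimes> (w ?s)\<^sup>\<star>) \<otimes> q f))"
    unfolding VV using e f wC C_mult by (simp add: i_mult)
  also have "q e \<otimes> (((w ?r \<otimes> c) \<otimes> (w ?s)\<^sup>\<star>) \<otimes> q f) = (q e \<otimes> w ?r) \<otimes> (c \<otimes> (q f \<otimes> w ?s)\<^sup>\<star>)"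
    using e f c projectionD [OF q_projection [OF f]] by (simp add: adj_mult mult_assoc)
  also have "\<dots> = (complex_of_real (wt ?r) * complex_of_real (wt ?s)) \<odot> (t e \<otimes> (c \<otimes> (t f)\<^sup>\<star>))"
    using e f c by (simp add: q_w wtt_def adj_smult smult_mult_left smult_mult_right mult.commute)
  also have "?k \<odot>\<^bsub>B\<^esub> i \<dots> = (?k * (complex_of_real (wt ?r) * complex_of_real (wt ?s))) \<odot>\<^bsub>B\<^esub> i (t e \<otimes> (c \<otimes> (t f)\<^sup>\<star>))"
    using t_conj_C [OF e f c] by (simp add: i_smult)
  also have "?k * (complex_of_real (wt ?r) * complex_of_real (wt ?s)) =
      (complex_of_real (1 / wt ?r) * complex_of_real (wt ?r)) * (complex_of_real (1 / wt ?s) * complex_of_real (wt ?s))"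
    by (simp only: mult_ac)
  finally show ?thesis using e f t_conj_C [OF e f c] wt_cancel [of ?r] wt_cancel [of ?s] by simp
qed

lemma i_q: "e \<in> arcs E \<Longrightarrow> i (q e) \<otimes>\<^bsub>B\<^esub> i (q e) = i (q e)"
  using projectionD [OF q_projection, of e] by (simp add: i_mult [symmetric])

text \<open>Here the adjoint of \<open>V\<close> stands on the left, so \<open>v_outer\<close> does
  not apply. Instead \<open>i (q e)\<close> is compressed by \<open>\<beta> (p u)\<close>, and
  \<open>w\<^sup>\<star> q\<^sub>e w\<close>, being the square of \<open>wtt e\<close>, is a
  multiple of \<open>p u\<close>.\<close>

lemma T_adj_T:
  assumes e: "e \<in> arcs E"
  shows "(T e)\<^sup>\<star>\<^bsub>B\<^esub> \<otimes>\<^bsub>B\<^esub> T e = i (p (tail E e))"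
proof -
  let ?u = "tail E e"
  let ?k = "complex_of_real (1 / wt ?u)" and ?n = "complex_of_real (wt ?u)"
  have u: "?u \<in> verts E" using e by simp
  note bC = \<beta>_C [OF p_C [OF u]]
  have "(w ?u)\<^sup>\<star> \<otimes> (q e \<otimes> w ?u) = (q e \<otimes> w ?u)\<^sup>\<star> \<otimes> (q e \<otimes> w ?u)"
    using e projectionD [OF q_projection [OF e]] mult_assoc [of "q e" "q e" "w ?u"]
    by (simp add: adj_mult mult_assoc)
  also have "\<dots> = (?n * ?n) \<odot> p ?u"
    using e t_adj_t [OF e] by (simp add: q_w wtt_def adj_smult smult_mult_left smult_mult_right)
  finally have wqw: "(w ?u)\<^sup>\<star> \<otimes> (q e \<otimes> w ?u) = (?n * ?n) \<odot> p ?u" .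
  have wp: "w ?u \<otimes> p ?u = w ?u"
    using multiplier_fst_mult [OF W_in, of "p ?u" "p ?u"] fst_W_p [OF u] u by simp
  have "\<beta> (p ?u) \<otimes> (q e \<otimes> \<beta> (p ?u)) = (w ?u \<otimes> ((w ?u)\<^sup>\<star> \<otimes> (q e \<otimes> w ?u))) \<otimes> (w ?u)\<^sup>\<star>"
    using e by (simp add: \<beta>_p mult_assoc)
  also have "\<dots> = (?n * ?n) \<odot> \<beta> (p ?u)"
    unfolding wqw using u wp by (simp add: \<beta>_p smult_mult_left smult_mult_right)
  finally have bqb: "\<beta> (p ?u) \<otimes> (q e \<otimes> \<beta> (p ?u)) = (?n * ?n) \<odot> \<beta> (p ?u)" .
  have adjb: "(i (\<beta> (p ?u)))\<^sup>\<star>\<^bsub>B\<^esub> = i (\<beta> (p ?u))"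
    using u bC by (simp add: i_adj [symmetric]) (simp add: \<beta>_p adj_mult)
  have iqs: "(i (q e))\<^sup>\<star>\<^bsub>B\<^esub> = i (q e)"
    using e projectionD [OF q_projection [OF e]] by (simp add: i_adj [symmetric])
  have Vadj: "(V ?u)\<^sup>\<star>\<^bsub>B\<^esub> \<otimes>\<^bsub>B\<^esub> i (\<beta> (p ?u)) = (V ?u)\<^sup>\<star>\<^bsub>B\<^esub>"
    using arg_cong [OF \<beta>_V [OF u], of "adj B"] u bC adjb by (simp add: B.adj_mult)
  have "(T e)\<^sup>\<star>\<^bsub>B\<^esub> \<otimes>\<^bsub>B\<^esub> T e = (?k * ?k) \<odot>\<^bsub>B\<^esub> ((V ?u)\<^sup>\<star>\<^bsub>B\<^esub> \<otimes>\<^bsub>B\<^esub> ((i (q e) \<otimes>\<^bsub>B\<^esub> i (q e)) \<otimes>\<^bsub>B\<^esub> V ?u))"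
    using e iqs by (simp add: T_def B.adj_smult B.adj_mult B.smult_mult_left B.smult_mult_right B.mult_assoc)
  \<comment> \<open>\<open>V ?u\<close> absorbs \<open>i (\<beta> (p ?u))\<close>; inserting it on
    both sides moves the computation into the core.\<close>
  also have "\<dots> = (?k * ?k) \<odot>\<^bsub>B\<^esub> (((V ?u)\<^sup>\<star>\<^bsub>B\<^esub> \<otimes>\<^bsub>B\<^esub> i (\<beta> (p ?u))) \<otimes>\<^bsub>B\<^esub> (i (q e) \<otimes>\<^bsub>B\<^esub> (i (\<beta> (p ?u)) \<otimes>\<^bsub>B\<^esub> V ?u)))"
    unfolding Vadj \<beta>_V [OF u] i_q [OF e] ..
  also have "\<dots> = (?k * ?k) \<odot>\<^bsub>B\<^esub> ((V ?u)\<^sup>\<star>\<^bsub>B\<^esub> \<otimes>\<^bsub>B\<^esub> (i (\<beta> (p ?u) \<otimes> (q e \<otimes> \<beta> (p ?u))) \<otimes>\<^bsub>B\<^esub> V ?u))"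
    using e u bC C_mult by (simp add: i_mult B.mult_assoc)
  also have "\<dots> = (?k * ?k) \<odot>\<^bsub>B\<^esub> ((?n * ?n) \<odot>\<^bsub>B\<^esub> i (p ?u))"
    unfolding bqb using u bC adj_V_V [OF u]
    by (simp add: i_smult B.smult_mult_left B.smult_mult_right B.mult_assoc \<beta>_V)
  also have "\<dots> = ((?k * ?n) * (?k * ?n)) \<odot>\<^bsub>B\<^esub> i (p ?u)"
    using u by (simp only: B.smult_smult [OF i_in [OF p_C [OF u]]] mult_ac)
  finally show ?thesis using u wt_cancel [OF u] by simp
qed

lemma T_T_adj: "e \<in> arcs E \<Longrightarrow> T e \<otimes>\<^bsub>B\<^esub> (T e)\<^sup>\<star>\<^bsub>B\<^esub> = i (q e)"
proof -
  assume e: "e \<in> arcs E"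
  let ?u = "tail E e"
  have "T e \<otimes>\<^bsub>B\<^esub> i (p ?u) = T e"
    using e by (simp add: T_def B.smult_mult_left B.mult_assoc V_p)
  then have "(T e \<otimes>\<^bsub>B\<^esub> i (p ?u))\<^sup>\<star>\<^bsub>B\<^esub> = (T e)\<^sup>\<star>\<^bsub>B\<^esub>" by simp
  then have "i (p ?u) \<otimes>\<^bsub>B\<^esub> (T e)\<^sup>\<star>\<^bsub>B\<^esub> = (T e)\<^sup>\<star>\<^bsub>B\<^esub>"
    using e by (simp add: B.adj_mult i_adj [symmetric])
  moreover have "t e \<otimes> (p ?u \<otimes> (t e)\<^sup>\<star>) = q e"
    using e t_p [OF e] by (simp add: q_def mult_assoc [symmetric])
  ultimately show ?thesis using T_conj [OF e e, of "p ?u"] e by simp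
qed

lemma family_B: "cuntz_krieger_family E B (\<lambda>u. i (p u)) T"
  unfolding cuntz_krieger_family_def
proof (intro conjI ballI impI)
  fix u assume u: "u \<in> verts E"
  show "projection B (i (p u))"
    using u by (simp add: projection_def i_mult [symmetric] i_adj [symmetric])
  have "i (p u) = i (finsum A q (in_arcs E u))" by (simp add: p_eq_sum [OF u, symmetric])
  also have "\<dots> = finsum B (\<lambda>e. i (q e)) (in_arcs E u)"
    by (rule AB.star_hom_finsum [OF C_subalgebra i_hom]) simp
  also have "\<dots> = finsum B (\<lambda>e. T e \<otimes>\<^bsub>B\<^esub> (T e)\<^sup>\<star>\<^bsub>B\<^esub>) (in_arcs E u)"
    by (rule B.finsum_eq) (auto simp: T_T_adj)
  finally show "i (p u) = finsum B (\<lambda>e. T e \<otimes>\<^bsub>B\<^esub> (T e)\<^sup>\<star>\<^bsub>B\<^esub>) (in_arcs E u)" .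
  have "i \<zero> = \<zero>\<^bsub>B\<^esub>" by (rule AB.blin_zero [OF C_subspace AB.star_hom_blin [OF C_subalgebra i_hom]])
  then show "i (p u) \<otimes>\<^bsub>B\<^esub> i (p u') = \<zero>\<^bsub>B\<^esub>" if "u' \<in> verts E" "u \<noteq> u'" for u'
    using u that p_orth [of u u'] by (simp add: i_mult [symmetric])
next
  fix e assume e: "e \<in> arcs E"
  show "(T e)\<^sup>\<star>\<^bsub>B\<^esub> \<otimes>\<^bsub>B\<^esub> T e = i (p (tail E e))" by (rule T_adj_T [OF e])
  have "i (q e) \<otimes>\<^bsub>B\<^esub> T e = complex_of_real (1 / wt (tail E e)) \<odot>\<^bsub>B\<^esub> ((i (q e) \<otimes>\<^bsub>B\<^esub> i (q e)) \<otimes>\<^bsub>B\<^esub> V (tail E e))"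
    using e by (simp add: T_def B.smult_mult_right B.mult_assoc)
  then have "i (q e) \<otimes>\<^bsub>B\<^esub> T e = T e" by (simp add: i_q [OF e] T_def)
  then show "partial_isometry B (T e)" using e by (simp add: partial_isometry_def T_T_adj)
qed

section \<open>The homomorphism from the graph algebra to the crossed product\<close>

definition \<psi> :: "'a \<Rightarrow> 'b" where
  "\<psi> = (SOME \<psi>. star_hom (carrier A) A B \<psi> \<and> (\<forall>u\<in>verts E. \<psi> (p u) = i (p u)) \<and> (\<forall>e\<in>arcs E. \<psi> (t e) = T e))"

lemma \<psi>_hom: "star_hom (carrier A) A B \<psi>"
  and \<psi>_p: "u \<in> verts E \<Longrightarrow> \<psi> (p u) = i (p u)"
  and \<psi>_t: "e \<in> arcs E \<Longrightarrow> \<psi> (t e) = T e"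
proof -
  have "\<exists>\<psi>. star_hom (carrier A) A B \<psi> \<and> (\<forall>u\<in>verts E. \<psi> (p u) = i (p u)) \<and> (\<forall>e\<in>arcs E. \<psi> (t e) = T e)"
    using graph_algebra_B family_B B.cstar_algebra_axioms
    unfolding graph_algebra_def cstar_hom_iff [symmetric] by blast
  from someI_ex [OF this] show "star_hom (carrier A) A B \<psi>" "u \<in> verts E \<Longrightarrow> \<psi> (p u) = i (p u)"
    "e \<in> arcs E \<Longrightarrow> \<psi> (t e) = T e"
    unfolding \<psi>_def by blast+
qed

lemmas \<psi>_in [simp] = star_hom_closed [OF \<psi>_hom]
lemmas \<psi>_mult = star_hom_mult [OF \<psi>_hom]
lemmas \<psi>_adj = star_hom_adj [OF \<psi>_hom]

text \<open>Both paths lose their first edge at the same time, so equal length is what makes the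
  induction work. At length zero the common source forces both to be the same vertex.\<close>

lemma \<psi>_core_tpath: "tpath n r s x \<Longrightarrow> tpath n r' s y \<Longrightarrow> \<psi> (x \<otimes> y\<^sup>\<star>) = i (x \<otimes> y\<^sup>\<star>)"
proof (induction arbitrary: r' y rule: tpath.induct)
  case (tpath_vertex u)
  from tpath_vertex(2) have "y = p u" by cases simp
  then show ?case using tpath_vertex(1) by (simp add: \<psi>_p)
next
  case (tpath_edge n r s x e)
  from tpath_edge.prems obtain f y0 r0 where y: "y = t f \<otimes> y0" and f: "f \<in> arcs E" and y0: "tpath n r0 s y0"
    by cases auto
  have IH: "\<psi> (x \<otimes> y0\<^sup>\<star>) = i (x \<otimes> y0\<^sup>\<star>)" by (rule tpath_edge.IH [OF y0])
  have c: "x \<in> carrier A" "y0 \<in> carrier A" using tpath_in [OF tpath_edge.hyps(1)] tpath_in [OF y0] by auto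
  have xy: "x \<otimes> y0\<^sup>\<star> \<in> C" using core_setI [OF tpath_edge.hyps(1) y0] core_set_C by blast
  note e = tpath_edge.hyps(2)
  have eq: "(t e \<otimes> x) \<otimes> y\<^sup>\<star> = t e \<otimes> ((x \<otimes> y0\<^sup>\<star>) \<otimes> (t f)\<^sup>\<star>)"
    using c e f by (simp add: y adj_mult mult_assoc)
  have "\<psi> (t e \<otimes> ((x \<otimes> y0\<^sup>\<star>) \<otimes> (t f)\<^sup>\<star>)) = T e \<otimes>\<^bsub>B\<^esub> (\<psi> (x \<otimes> y0\<^sup>\<star>) \<otimes>\<^bsub>B\<^esub> (T f)\<^sup>\<star>\<^bsub>B\<^esub>)"
    using c e f by (simp add: \<psi>_mult [of "t e"] \<psi>_mult [of "x \<otimes> y0\<^sup>\<star>"] \<psi>_adj \<psi>_t)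
  then show ?case unfolding eq IH T_conj [OF e f xy] .
qed

lemma \<psi>_C: "c \<in> C \<Longrightarrow> \<psi> c = i c"
proof -
  have "star_hom C A B \<psi>" by (rule star_hom_subset [OF \<psi>_hom]) auto
  then have "closed_subspace {c \<in> C. \<psi> c = i c} A"
    using AB.star_hom_equalizer [OF C_subalgebra _ i_hom] cstar_subalgebra_subspace by blast
  moreover have "core_set \<subseteq> {c \<in> C. \<psi> c = i c}"
  proof
    fix a assume a: "a \<in> core_set"
    then have "\<psi> a = i a" unfolding core_set_def using \<psi>_core_tpath by blast
    then show "a \<in> {c \<in> C. \<psi> c = i c}" using a core_set_C by blast
  qed
  ultimately have "C \<subseteq> {c \<in> C. \<psi> c = i c}" by (rule C_least)
  then show "c \<in> C \<Longrightarrow> \<psi> c = i c" by blast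
qed

lemma blin_i_mult:
  assumes "b \<in> carrier B"
  shows "blin C A B (\<lambda>c. i c \<otimes>\<^bsub>B\<^esub> b)"
proof -
  have "\<parallel>i c \<otimes>\<^bsub>B\<^esub> b\<parallel>\<^bsub>B\<^esub> \<le> \<parallel>b\<parallel>\<^bsub>B\<^esub> * \<parallel>c\<parallel>" if "c \<in> C" for c
    using B.nrm_mult [of "i c" b] mult_right_mono [OF i_contractive [OF that] B.nrm_nonneg [OF assms]] assms that
    by (simp add: mult.commute)
  then show ?thesis
    unfolding blin_def using assms
    by (auto simp: star_hom_add [OF i_hom] i_smult B.mult_distrib_right B.smult_mult_left)
qed

text \<open>Nondegeneracy of \<open>i\<close> speaks of all core elements; with vertex projections
  alone the finite sums \<open>pp F\<close> act eventually as the identity on the spanning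
  products.\<close>

definition D_left :: "'b set" where
  "D_left = {i (p u) \<otimes>\<^bsub>B\<^esub> b | u b. u \<in> verts E \<and> b \<in> carrier B}"

definition D_right :: "'b set" where
  "D_right = {b \<otimes>\<^bsub>B\<^esub> i (p u) | u b. u \<in> verts E \<and> b \<in> carrier B}"

lemma D_in: "D_left \<subseteq> carrier B" "D_right \<subseteq> carrier B"
  by (auto simp: D_left_def D_right_def)

text \<open>A spanning element \<open>a\<close> of the core satisfies
  \<open>a = p r \<otimes> a\<close> for the range \<open>r\<close> of its left path, so
  \<open>i a \<otimes> b\<close> is already in \<open>D_left\<close>. Continuity in \<open>a\<close>
  covers the rest of the core.\<close>

lemma closed_span_D_left: "closed_span B D_left = carrier B"
proof
  let ?X = "closed_span B D_left"
  have X: "closed_subspace ?X B" by (rule B.closed_span_subspace [OF D_in(1)])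
  show "?X \<subseteq> carrier B" by (rule B.closed_span_sub_carrier [OF D_in(1)])
  have "i c \<otimes>\<^bsub>B\<^esub> b \<in> ?X" if c: "c \<in> C" and b: "b \<in> carrier B" for c b
  proof -
    have "core_set \<subseteq> {c \<in> C. i c \<otimes>\<^bsub>B\<^esub> b \<in> ?X}"
    proof
      fix a assume a: "a \<in> core_set"
      then have aC: "a \<in> C" using core_set_C by blast
      from a obtain x y n r r' s where xy: "a = x \<otimes> y\<^sup>\<star>" "tpath n r s x" "tpath n r' s y"
        unfolding core_set_def by blast
      have r: "r \<in> verts E" by (rule tpath_range [OF xy(2)])
      have "a = p r \<otimes> a"
        using p_tpath [OF xy(2)] tpath_in [OF xy(2)] tpath_in [OF xy(3)] r by (simp add: xy(1) mult_assoc [symmetric])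
      then have "i a \<otimes>\<^bsub>B\<^esub> b = i (p r) \<otimes>\<^bsub>B\<^esub> (i a \<otimes>\<^bsub>B\<^esub> b)"
        using i_mult [of "p r" a] r aC b by (simp add: B.mult_assoc [symmetric])
      moreover have "i a \<otimes>\<^bsub>B\<^esub> b \<in> carrier B" using aC b by simp
      ultimately have "i a \<otimes>\<^bsub>B\<^esub> b \<in> D_left" unfolding D_left_def using r by blast
      then show "a \<in> {c \<in> C. i c \<otimes>\<^bsub>B\<^esub> b \<in> ?X}" using aC B.closed_span_superset by blast
    qed
    then have "C \<subseteq> {c \<in> C. i c \<otimes>\<^bsub>B\<^esub> b \<in> ?X}"
      by (rule C_least [OF AB.blin_preimage [OF C_subspace blin_i_mult [OF b] X]])
    then show ?thesis using c by blast
  qed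
  then have "{i c \<otimes>\<^bsub>B\<^esub> b | c b. c \<in> C \<and> b \<in> carrier B} \<subseteq> ?X" by blast
  then have "closed_span B {i c \<otimes>\<^bsub>B\<^esub> b | c b. c \<in> C \<and> b \<in> carrier B} \<subseteq> ?X"
    by (rule B.closed_span_least [OF X])
  then show "carrier B \<subseteq> ?X" by (simp add: i_nondegenerate)
qed

lemma closed_span_D_right: "closed_span B D_right = carrier B"
proof (rule B.closed_span_adj [OF D_in(1) closed_span_D_left _ D_in(2)])
  fix x assume "x \<in> D_left"
  then obtain u b where "x = i (p u) \<otimes>\<^bsub>B\<^esub> b" and ub: "u \<in> verts E" "b \<in> carrier B" unfolding D_left_def by blast
  then have "x\<^sup>\<star>\<^bsub>B\<^esub> = b\<^sup>\<star>\<^bsub>B\<^esub> \<otimes>\<^bsub>B\<^esub> i (p u)" by (simp add: B.adj_mult i_adj [symmetric])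
  then show "x\<^sup>\<star>\<^bsub>B\<^esub> \<in> D_right" unfolding D_right_def using ub B.adj_closed by blast
qed

section \<open>An approximate unit of vertex projections\<close>

abbreviation VS where "VS \<equiv> finite_subsets_at_top (verts E)"

text \<open>The intersection makes \<open>pp F\<close> an element of the core for every
  \<open>F\<close>, as the lemmas on nets ask for membership at every index.\<close>

definition pp :: "'v set \<Rightarrow> 'a" where
  "pp F = diag (\<lambda>_. 1) (F \<inter> verts E)"

lemma pp_C [simp]: "pp F \<in> C"
  unfolding pp_def diag_def by (rule closed_subspace_finsum [OF C_subspace]) simp

lemma nrm_i_pp: "\<parallel>i (pp F)\<parallel>\<^bsub>B\<^esub> \<le> 1"
proof -
  have "\<parallel>pp F\<parallel> \<le> 1"
  proof (cases "finite (F \<inter> verts E)")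
    case True
    then show ?thesis unfolding pp_def by (intro nrm_projection_le diag_one_projection) auto
  next
    case False
    then show ?thesis by (simp add: pp_def diag_def M.finsum_infinite)
  qed
  then show ?thesis using i_contractive [OF pp_C, of F] by linarith
qed

lemma pp_p: "u \<in> verts E \<Longrightarrow> eventually (\<lambda>F. pp F \<otimes> p u = p u \<and> p u \<otimes> pp F = p u) VS"
proof -
  assume u: "u \<in> verts E"
  have "pp F \<otimes> p u = p u \<and> p u \<otimes> pp F = p u" if F: "finite F \<and> {u} \<subseteq> F \<and> F \<subseteq> verts E" for F
  proof -
    have pp: "pp F = finsum A p F"
      using F unfolding pp_def diag_def by (simp add: Int_absorb2) (rule finsum_eq, auto)
    have "pp F \<otimes> p u = finsum A (\<lambda>x. p x \<otimes> p u) F"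
      unfolding pp using F u by (intro finsum_mult_right) auto
    also have "\<dots> = p u \<otimes> p u" by (rule finsum_single) (use F u p_orth in \<open>auto simp: subset_iff\<close>)
    finally have 1: "pp F \<otimes> p u = p u" using u by simp
    have "(pp F)\<^sup>\<star> = pp F" unfolding pp_def by (subst diag_adj) auto
    then have "p u \<otimes> pp F = (pp F \<otimes> p u)\<^sup>\<star>" using u by (simp add: adj_mult)
    then show ?thesis using 1 u by simp
  qed
  then show ?thesis
    unfolding eventually_finite_subsets_at_top using u by (intro exI [of _ "{u}"]) blast
qed

text \<open>Convergence is clear on the spanning sets. \<open>strict_limit_exists\<close> extends it
  to all of \<open>B\<close> with some multiplier as limit, which is then seen to be the
  identity.\<close>

lemma
  assumes b: "b \<in> carrier B"
  shows approximate_unit_left: "B.conv (\<lambda>F. i (pp F) \<otimes>\<^bsub>B\<^esub> b) b VS"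
    and approximate_unit_right: "B.conv (\<lambda>F. b \<otimes>\<^bsub>B\<^esub> i (pp F)) b VS"
proof -
  have F: "VS \<noteq> bot" by simp
  have left: "B.conv (\<lambda>F. i (pp F) \<otimes>\<^bsub>B\<^esub> d) d VS" if "d \<in> D_left" for d
  proof -
    obtain u x where d: "d = i (p u) \<otimes>\<^bsub>B\<^esub> x" "u \<in> verts E" "x \<in> carrier B"
      using \<open>d \<in> D_left\<close> unfolding D_left_def by blast
    show ?thesis
    proof (rule B.conv_eventually_const)
      show "eventually (\<lambda>F. i (pp F) \<otimes>\<^bsub>B\<^esub> d = d) VS"
        using pp_p [OF d(2)] 
      proof eventually_elim
        case (elim F)
        then have "i (pp F) \<otimes>\<^bsub>B\<^esub> i (p u) = i (p u)" using d by (simp add: i_mult [symmetric])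
        then show ?case using d by (simp add: B.mult_assoc [symmetric])
      qed
    qed (use d in simp)
  qed
  have right: "B.conv (\<lambda>F. d \<otimes>\<^bsub>B\<^esub> i (pp F)) d VS" if "d \<in> D_right" for d
  proof -
    obtain u x where d: "d = x \<otimes>\<^bsub>B\<^esub> i (p u)" "u \<in> verts E" "x \<in> carrier B"
      using \<open>d \<in> D_right\<close> unfolding D_right_def by blast
    show ?thesis
    proof (rule B.conv_eventually_const)
      show "eventually (\<lambda>F. d \<otimes>\<^bsub>B\<^esub> i (pp F) = d) VS"
        using pp_p [OF d(2)] 
      proof eventually_elim
        case (elim F)
        then have "i (p u) \<otimes>\<^bsub>B\<^esub> i (pp F) = i (p u)" using d by (simp add: i_mult [symmetric])
        then show ?case using d by (simp add: B.mult_assoc)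
      qed
    qed (use d in simp)
  qed
  obtain m where m: "m \<in> carrier (multiplier_algebra B)"
    "\<And>a. a \<in> carrier B \<Longrightarrow> B.conv (\<lambda>F. i (pp F) \<otimes>\<^bsub>B\<^esub> a) (fst m a) VS"
    "\<And>a. a \<in> carrier B \<Longrightarrow> B.conv (\<lambda>F. a \<otimes>\<^bsub>B\<^esub> i (pp F)) (snd m a) VS"
  proof (rule B.strict_limit_exists [OF F, of "\<lambda>F. i (pp F)" 1 D_left D_right])
    show "\<exists>l. B.conv (\<lambda>F. i (pp F) \<otimes>\<^bsub>B\<^esub> d) l VS" if "d \<in> D_left" for d using left [OF that] by blast
    show "\<exists>l. B.conv (\<lambda>F. d \<otimes>\<^bsub>B\<^esub> i (pp F)) l VS" if "d \<in> D_right" for d using right [OF that] by blast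
  qed (use nrm_i_pp D_in closed_span_D_left closed_span_D_right in auto)
  \<comment> \<open>Checking the left action on \<open>D_left\<close> is enough; the limit on the
    right follows from the equality of multipliers.\<close>
  have "m = \<one>\<^bsub>multiplier_algebra B\<^esub>"
  proof (rule B.multiplier_eqI [OF m(1) B.multiplier_one_in D_in(1) closed_span_D_left])
    fix x assume x: "x \<in> D_left"
    then have "x \<in> carrier B" using D_in by blast
    then show "fst m x = fst \<one>\<^bsub>multiplier_algebra B\<^esub> x"
      using B.conv_unique [OF m(2) left [OF x] F] by (simp add: B.fst_multiplier_one)
  qed
  then show "B.conv (\<lambda>F. i (pp F) \<otimes>\<^bsub>B\<^esub> b) b VS" "B.conv (\<lambda>F. b \<otimes>\<^bsub>B\<^esub> i (pp F)) b VS"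
    using m(2) [OF b] m(3) [OF b] b by (simp_all add: B.fst_multiplier_one B.snd_multiplier_one)
qed

section \<open>Every candidate for the integrated homomorphism is inverse to
  \<open>\<psi>\<close>\<close>

definition integrated :: "('b \<Rightarrow> 'a) \<Rightarrow> bool" where
  "integrated \<phi> \<longleftrightarrow> \<phi> \<in> nondegenerate_hom B A \<and> (\<forall>c\<in>C. \<phi> (i c) = c) \<and> mult_extension B A \<phi> v = W"

text \<open>The condition on \<open>mult_extension\<close> becomes an equation between elements
  through \<open>mult_extension_spec\<close>, with the approximate unit \<open>i (pp F)\<close> of
  \<open>B\<close>.\<close>

lemma
  assumes \<phi>: "integrated \<phi>"
  shows integrated_hom: "star_hom (carrier B) B A \<phi>"
    and integrated_i: "c \<in> C \<Longrightarrow> \<phi> (i c) = c"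
    and integrated_fst: "b \<in> carrier B \<Longrightarrow> \<phi> (fst v b) = fst W (\<phi> b)"
proof -
  show h: "star_hom (carrier B) B A \<phi>" and "c \<in> C \<Longrightarrow> \<phi> (i c) = c"
    using \<phi> by (auto simp: integrated_def nondegenerate_hom_def cstar_hom_iff)
  have nd: "closed_span A {\<phi> a \<otimes> b | a b. a \<in> carrier B \<and> b \<in> carrier A} = carrier A"
    using \<phi> by (simp add: integrated_def nondegenerate_hom_def)
  show "b \<in> carrier B \<Longrightarrow> \<phi> (fst v b) = fst W (\<phi> b)"
    using BA.mult_extension_spec(2) [OF h nd v_in, of VS "\<lambda>F. i (pp F)" b]
      approximate_unit_left approximate_unit_right nrm_i_pp \<phi> by (simp add: integrated_def)
qed

lemma integrated_\<psi>:
  assumes \<phi>: "integrated \<phi>" and x: "x \<in> carrier A"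
  shows "\<phi> (\<psi> x) = x"
proof (rule hom_eq_on_generators [OF cstar_algebra_axioms _ _ _ _ x])
  note h = integrated_hom [OF \<phi>]
  show "star_hom (carrier A) A A (\<lambda>x. \<phi> (\<psi> x))"
    by (rule star_hom_compose [OF \<psi>_hom h]) simp
  show "star_hom (carrier A) A A (\<lambda>x. x)" by (rule star_hom_ident) simp
  show "\<phi> (\<psi> (p u)) = p u" if "u \<in> verts E" for u
    using that by (simp add: \<psi>_p integrated_i [OF \<phi>])
  fix e assume e: "e \<in> arcs E"
  let ?u = "tail E e"
  have "\<phi> (V ?u) = w ?u"
    unfolding V_def using e by (simp add: integrated_fst [OF \<phi>] integrated_i [OF \<phi>] fst_W_p)
  then have "\<phi> (T e) = complex_of_real (1 / wt ?u) \<odot> (q e \<otimes> w ?u)"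
    using e by (simp add: T_def star_hom_smult [OF h] star_hom_mult [OF h] integrated_i [OF \<phi>])
  also have "\<dots> = (complex_of_real (1 / wt ?u) * complex_of_real (wt ?u)) \<odot> t e"
    using e by (simp add: q_w wtt_def)
  finally show "\<phi> (\<psi> (t e)) = t e" using e wt_cancel [of ?u] by (simp add: \<psi>_t)
qed

text \<open>Summing \<open>T e\<close> with its weight over the edges leaving \<open>u\<close> gives
  \<open>i Q V u\<close>, where \<open>Q\<close> is the sum of their \<open>q e\<close>. It remains
  that \<open>Q\<close> acts on \<open>V u\<close> as identity: it does so on \<open>w u\<close>,
  hence on \<open>\<beta> (p u)\<close>, hence on \<open>V u\<close> by
  \<open>\<beta>_V\<close>.\<close>

lemma \<psi>_w: "u \<in> verts E \<Longrightarrow> \<psi> (w u) = V u"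
proof -
  assume u: "u \<in> verts E"
  let ?Q = "finsum A q (out_arcs E u)"
  have QC: "?Q \<in> C" by (rule closed_subspace_finsum [OF C_subspace]) simp
  have "?Q \<otimes> w u = finsum A (\<lambda>e. q e \<otimes> w u) (out_arcs E u)"
    by (rule finsum_mult_right) auto
  also have "\<dots> = finsum A wtt (out_arcs E u)"
    by (rule finsum_eq) (use q_w in auto)
  finally have Qw: "?Q \<otimes> w u = w u" by (simp only: w_def [symmetric])
  have Qb: "?Q \<otimes> \<beta> (p u) = \<beta> (p u)"
    using u Qw C_in [OF QC] by (simp add: \<beta>_p mult_assoc [symmetric])
  have "\<psi> (w u) = finsum B (\<lambda>e. \<psi> (wtt e)) (out_arcs E u)"
    unfolding w_def by (rule AB.star_hom_finsum [OF cstar_subalgebra_carrier \<psi>_hom]) simp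
  also have "\<dots> = finsum B (\<lambda>e. i (q e) \<otimes>\<^bsub>B\<^esub> V u) (out_arcs E u)"
  proof (rule B.finsum_eq)
    fix e assume e: "e \<in> out_arcs E u"
    then have "\<psi> (wtt e) = (complex_of_real (1 / wt u) * complex_of_real (wt u)) \<odot>\<^bsub>B\<^esub> (i (q e) \<otimes>\<^bsub>B\<^esub> V u)"
      using u by (simp add: wtt_def star_hom_smult [OF \<psi>_hom] \<psi>_t T_def mult.commute)
    then show "\<psi> (wtt e) = i (q e) \<otimes>\<^bsub>B\<^esub> V u" using wt_cancel [OF u] e u by simp
  qed (use u in auto)
  also have "\<dots> = finsum B (\<lambda>e. i (q e)) (out_arcs E u) \<otimes>\<^bsub>B\<^esub> V u"
    using u by (intro B.finsum_mult_right [symmetric]) auto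
  also have "finsum B (\<lambda>e. i (q e)) (out_arcs E u) = i ?Q"
    by (rule AB.star_hom_finsum [OF C_subalgebra i_hom, symmetric]) simp
  also have "i ?Q \<otimes>\<^bsub>B\<^esub> V u = i ?Q \<otimes>\<^bsub>B\<^esub> (i (\<beta> (p u)) \<otimes>\<^bsub>B\<^esub> V u)" by (simp add: \<beta>_V u)
  also have "\<dots> = i (?Q \<otimes> \<beta> (p u)) \<otimes>\<^bsub>B\<^esub> V u"
    using QC \<beta>_C [OF p_C [OF u]] u by (simp add: i_mult B.mult_assoc)
  also have "\<dots> = V u" by (simp add: Qb \<beta>_V u)
  finally show ?thesis .
qed

text \<open>The fixed elements form a C*-subalgebra, so the three kinds of generators of
  \<open>B\<close> are checked. Spanning elements of the core reduce \<open>v i(c)\<close> to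
  \<open>V r \<otimes> i c\<close>, and boundedness extends this to the whole core.\<close>

lemma \<psi>_integrated:
  assumes \<phi>: "integrated \<phi>" and b: "b \<in> carrier B"
  shows "\<psi> (\<phi> b) = b"
proof -
  note h = integrated_hom [OF \<phi>]
  define S where "S = {b \<in> carrier B. \<psi> (\<phi> b) = b}"
  have S: "cstar_subalgebra S B"
    unfolding S_def
    by (rule BB.star_hom_equalizer [OF B.cstar_subalgebra_carrier star_hom_compose [OF h \<psi>_hom] star_hom_ident])
      (auto intro: star_hom_closed [OF h])
  note Ss = B.cstar_subalgebra_subspace [OF S]
  have iS: "i c \<in> S" if "c \<in> C" for c
    using that by (simp add: S_def integrated_i [OF \<phi>] \<psi>_C)
  have VS: "V u \<in> S" if "u \<in> verts E" for u
    using that by (simp add: S_def) (simp add: V_def integrated_fst [OF \<phi>] integrated_i [OF \<phi>] fst_W_p \<psi>_w)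
  have bl: "blin C A B (\<lambda>c. fst v (i c))"
  proof -
    obtain K where K: "K > 0" "\<And>x. x \<in> carrier B \<Longrightarrow> \<parallel>fst v x\<parallel>\<^bsub>B\<^esub> \<le> K * \<parallel>x\<parallel>\<^bsub>B\<^esub>"
      using BB.blin_bound [OF B.multiplier_fst_blin [OF v_in]] by blast
    have "\<parallel>fst v (i c)\<parallel>\<^bsub>B\<^esub> \<le> K * \<parallel>c\<parallel>" if "c \<in> C" for c
      using K(2) [OF i_in [OF that]] mult_left_mono [OF i_contractive [OF that], of K] K(1) by linarith
    then show ?thesis
      unfolding blin_def using B.multiplier_fst_blin [OF v_in]
      by (auto simp: star_hom_add [OF i_hom] i_smult BB.blin_add BB.blin_smult)
  qed
  have "core_set \<subseteq> {c \<in> C. fst v (i c) \<in> S}"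
  proof
    fix a assume a: "a \<in> core_set"
    then have aC: "a \<in> C" using core_set_C by blast
    from a obtain x y n r r' s where xy: "a = x \<otimes> y\<^sup>\<star>" "tpath n r s x" "tpath n r' s y"
      unfolding core_set_def by blast
    have r: "r \<in> verts E" by (rule tpath_range [OF xy(2)])
    have "a = p r \<otimes> a"
      using p_tpath [OF xy(2)] tpath_in [OF xy(2)] tpath_in [OF xy(3)] r by (simp add: xy(1) mult_assoc [symmetric])
    then have "i a = i (p r) \<otimes>\<^bsub>B\<^esub> i a" using i_mult [of "p r" a] r aC by simp
    then have "fst v (i a) = V r \<otimes>\<^bsub>B\<^esub> i a" unfolding V_def using fst_v_mult [of "i (p r)" "i a"] r aC by simp
    then have "fst v (i a) \<in> S" using B.cstar_subalgebra_mult [OF S VS [OF r] iS [OF aC]] by simp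
    then show "a \<in> {c \<in> C. fst v (i c) \<in> S}" using aC by blast
  qed
  then have "C \<subseteq> {c \<in> C. fst v (i c) \<in> S}"
    by (rule C_least [OF AB.blin_preimage [OF C_subspace bl Ss]])
  then have fS: "fst v (i c) \<in> S" if "c \<in> C" for c using that by blast
  \<comment> \<open>\<open>i(c) v\<close> has no such factorisation. It is the limit of
    \<open>(i(c) v) i(pp F) = i(c) (v i(pp F))\<close>, a product of elements already known to be in
    \<open>S\<close>.\<close>
  have sS: "snd v (i c) \<in> S" if c: "c \<in> C" for c
  proof (rule B.closed_subspace_conv [OF Ss approximate_unit_right])
    show "snd v (i c) \<in> carrier B" using c by simp
    have "snd v (i c) \<otimes>\<^bsub>B\<^esub> i (pp F) = i c \<otimes>\<^bsub>B\<^esub> fst v (i (pp F))" for F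
      using c by (simp add: B.multiplier_mid [OF v_in])
    then show "eventually (\<lambda>F. snd v (i c) \<otimes>\<^bsub>B\<^esub> i (pp F) \<in> S) VS"
      using B.cstar_subalgebra_mult [OF S iS [OF c] fS [OF pp_C]] by simp
  qed simp
  have "carrier B \<subseteq> S"
    using generated_B B.generated_least [OF S, of "i ` C \<union> (\<lambda>c. fst v (i c)) ` C \<union> (\<lambda>c. snd v (i c)) ` C"] iS fS sS
    by auto
  then show ?thesis using b unfolding S_def by blast
qed

lemma integrated_exists:
  obtains \<phi> where "integrated \<phi>" "\<phi> \<in> extensional (carrier B)"
proof -
  have "\<exists>\<phi>\<in>nondegenerate_hom B A. (\<forall>c\<in>carrier (core E A p t). \<phi> (i c) = c) \<and> mult_extension B A \<phi> v = W"
    using crossed covariant cstar_algebra_axioms unfolding stacey_crossed_product_def by blast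
  then obtain \<phi> where \<phi>: "\<phi> \<in> nondegenerate_hom B A" "\<And>c. c \<in> C \<Longrightarrow> \<phi> (i c) = c" "mult_extension B A \<phi> v = W"
    by (auto simp: core_eq)
  let ?f = "restrict \<phi> (carrier B)"
  \<comment> \<open>The universal property supplies a homomorphism with arbitrary values off the
    carrier. Restricting it leaves the description of the extension unchanged, as that evaluates the
    map on the carrier only.\<close>
  have "mult_extension B A ?f v = mult_extension B A \<phi> v"
    unfolding mult_extension_def by (simp cong: conj_cong)
  moreover have "star_hom (carrier B) B A ?f"
    using \<phi>(1) by (simp add: nondegenerate_hom_def cstar_hom_iff star_hom_def)
  moreover have "{?f a \<otimes> b | a b. a \<in> carrier B \<and> b \<in> carrier A} = {\<phi> a \<otimes> b | a b. a \<in> carrier B \<and> b \<in> carrier A}"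
    by (auto intro: exI)
  ultimately have "integrated ?f"
    using \<phi> by (simp add: integrated_def nondegenerate_hom_def cstar_hom_iff)
  then show thesis by (rule that) simp
qed

lemma integrated_iso:
  assumes \<phi>: "integrated \<phi>"
  shows "\<phi> \<in> cstar_iso B A"
  unfolding cstar_iso_def cstar_hom_iff mem_Collect_eq
proof
  show h: "star_hom (carrier B) B A \<phi>" by (rule integrated_hom [OF \<phi>])
  show "bij_betw \<phi> (carrier B) (carrier A)"
    by (rule bij_betw_byWitness [where f' = \<psi>])
      (use integrated_\<psi> [OF \<phi>] \<psi>_integrated [OF \<phi>] star_hom_closed [OF h] \<psi>_in in blast)+
qed

lemma stacey_integrated_iso: "stacey_integrated (core E A p t) B i v A (\<lambda>a. a) W \<in> cstar_iso B A"
proof -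
  obtain \<phi> where \<phi>: "integrated \<phi>" "\<phi> \<in> extensional (carrier B)" by (rule integrated_exists)
  have "stacey_integrated (core E A p t) B i v A (\<lambda>a. a) W
      = (THE \<phi>. \<phi> \<in> extensional (carrier B) \<and> integrated \<phi>)"
    unfolding stacey_integrated_def integrated_def core_eq by (rule arg_cong [of _ _ The]) auto
  also have "\<dots> = \<phi>"
  proof (rule the_equality)
    show "\<phi> \<in> extensional (carrier B) \<and> integrated \<phi>" using \<phi> by simp
    fix f assume f: "f \<in> extensional (carrier B) \<and> integrated f"
    show "f = \<phi>"
    proof (rule extensionalityI [of _ "carrier B"])
      \<comment> \<open>Since \<open>\<psi> (\<phi> x) = x\<close>, applying \<open>f\<close> gives
        \<open>f x = f (\<psi> (\<phi> x)) = \<phi> x\<close>.\<close>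
      show "f x = \<phi> x" if "x \<in> carrier B" for x
        using integrated_\<psi> [of f "\<phi> x"] \<psi>_integrated [OF \<phi>(1) that] star_hom_closed [OF integrated_hom [OF \<phi>(1)] that] f
        by simp
    qed (use f \<phi> in auto)
  qed
  finally show ?thesis using integrated_iso [OF \<phi>(1)] by simp
qed

end

theorem proposition5p1:
  fixes E :: "('v, 'e) pre_digraph"
    and A :: "'a cstar" and p :: "'v \<Rightarrow> 'a" and t :: "'e \<Rightarrow> 'a"
  assumes "wf_digraph E"
    and locally_finite: "\<And>v. v \<in> verts E \<Longrightarrow> finite (in_arcs E v) \<and> finite (out_arcs E v)"
    and no_sources_or_sinks: "\<And>v. v \<in> verts E \<Longrightarrow> in_arcs E v \<noteq> {} \<and> out_arcs E v \<noteq> {}"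
    and "graph_algebra TYPE('a) E A p t"
    and "graph_algebra TYPE('b) E A p t"
  shows "\<exists>\<beta> \<in> cstar_hom (core E A p t) (core E A p t).
    (\<forall>\<mu>\<in>finite_paths E. \<forall>\<nu>\<in>finite_paths E.
       fpath_length \<mu> = fpath_length \<nu> \<and> fpath_source E \<mu> = fpath_source E \<nu> \<longrightarrow>
       \<beta> (path_elt A p t \<mu> \<otimes>\<^bsub>A\<^esub> (path_elt A p t \<nu>)\<^sup>\<star>\<^bsub>A\<^esub>) =
         finsum A
           (\<lambda>(e, f). complex_of_real
              ((real (card (out_arcs E (fpath_range E \<mu>))) *
                real (card (out_arcs E (fpath_range E \<nu>)))) powr (- 1 / 2))
            \<odot>\<^bsub>A\<^esub> (path_elt A p t (edge_cons e \<mu>) \<otimes>\<^bsub>A\<^esub> (path_elt A p t (edge_cons f \<nu>))\<^sup>\<star>\<^bsub>A\<^esub>))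
           (out_arcs E (fpath_range E \<mu>) \<times> out_arcs E (fpath_range E \<nu>))) \<and>
    (\<exists>W.
       strict_sums A
         (\<lambda>e. complex_of_real (real (card (out_arcs E (tail E e))) powr (- 1 / 2)) \<odot>\<^bsub>A\<^esub> t e)
         (arcs E) W \<and>
       isometry_in A W \<and>
       (\<forall>\<mu>\<in>finite_paths E. \<forall>\<nu>\<in>finite_paths E.
          fpath_length \<mu> = fpath_length \<nu> \<and> fpath_source E \<mu> = fpath_source E \<nu> \<longrightarrow>
          mult_of A (\<beta> (path_elt A p t \<mu> \<otimes>\<^bsub>A\<^esub> (path_elt A p t \<nu>)\<^sup>\<star>\<^bsub>A\<^esub>)) =
            W \<otimes>\<^bsub>multiplier_algebra A\<^esub>
              mult_of A (path_elt A p t \<mu> \<otimes>\<^bsub>A\<^esub> (path_elt A p t \<nu>)\<^sup>\<star>\<^bsub>A\<^esub>)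
              \<otimes>\<^bsub>multiplier_algebra A\<^esub> W\<^sup>\<star>\<^bsub>multiplier_algebra A\<^esub>) \<and>
       stacey_covariant (core E A p t) \<beta> A (\<lambda>a. a) W \<and>
       (\<forall>(B :: 'b cstar) i v.
          stacey_crossed_product TYPE('a) (core E A p t) \<beta> B i v \<longrightarrow>
          stacey_integrated (core E A p t) B i v A (\<lambda>a. a) W \<in> cstar_iso B A))"
proof -
  have "cstar_algebra A" using assms(4) by (simp add: graph_algebra_def)
  then interpret graph_cstar A E p t
    by (intro graph_cstar.intro graph_cstar_axioms.intro assms(1,4) locally_finite no_sources_or_sinks)
  have hom: "\<beta> \<in> cstar_hom (core E A p t) (core E A p t)"
    using star_hom_\<beta> unfolding core_eq cstar_hom_core_iff .
  have wtt: "(\<lambda>e. complex_of_real (real (card (out_arcs E (tail E e))) powr (- 1 / 2)) \<odot>\<^bsub>A\<^esub> t e) = wtt"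
    by (simp add: fun_eq_iff wtt_def wt_def)
  have carrier: "path_elt A p t \<mu> \<otimes>\<^bsub>A\<^esub> (path_elt A p t \<nu>)\<^sup>\<star>\<^bsub>A\<^esub> \<in> carrier A"
    if "\<mu> \<in> finite_paths E" "\<nu> \<in> finite_paths E" for \<mu> \<nu>
    using tpath_in [OF tpath_path_elt [OF that(1)]] tpath_in [OF tpath_path_elt [OF that(2)]] by simp
  \<comment> \<open>\<open>B\<close> is universally quantified in the statement, so the locale of
    the crossed product is interpreted anew for each \<open>B\<close>, within the graph algebra
    fixed above.\<close>
  have iso: "stacey_integrated (core E A p t) B i v A (\<lambda>a. a) W \<in> cstar_iso B A"
    if "stacey_crossed_product TYPE('a) (core E A p t) \<beta> B i v" for B :: "'b cstar" and i v
  proof -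
    have "cstar_algebra B" using that by (simp add: stacey_crossed_product_def)
    then interpret graph_stacey A E p t B i v
      by (intro graph_stacey.intro graph_stacey_axioms.intro graph_cstar_axioms that assms(5))
    show ?thesis by (rule stacey_integrated_iso)
  qed
  show ?thesis
    unfolding wtt
    by (intro bexI [OF _ hom] conjI exI [of _ W] ballI allI impI)
      (rule \<beta>_path strict_sums_W isometry_W covariant iso mult_of_Ad [OF isometry_W carrier] | assumption)+
qed

end
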